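(* Let $(W,S)$ be an irreducible Coxeter system with $S$ finite and $W$ neither finite nor affine. Then $W$ is not presentable by a product.
   Context: A Coxeter system $(W,S)$ is irreducible if its Coxeter graph is connected. The Coxeter group $W$ is affine if it is infinite and contains a subgroup of finite index isomorphic to $\mathbf{Z}^d$ for some $d\geq 1$ (equivalently, the Tits form of $(W,S)$ is positive semidefinite and not positive definite). An infinite group $\Gamma$ is presentable by a product if there exist groups $\Gamma_1,\Gamma_2$ and a homomorphism $\varphi\colon\Gamma_1\times\Gamma_2\longrightarrow\Gamma$ such that $\varphi(\Gamma_1\times\{1\})$ and $\varphi(\{1\}\times\Gamma_2)$ are both infinite and $\varphi(\Gamma_1\times\Gamma_2)$ is of finite index in $\Gamma$. *)

theory Defs
  imports "HOL-Algebra.Algebra"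
begin

section \<open>Group presentations\<close>

text \<open>A word over an alphabet \<open>S\<close> is a list of letters; \<open>(s, False)\<close> stands for \<open>s\<close> and
  \<open>(s, True)\<close> for the formal inverse of \<open>s\<close>.\<close>

type_synonym 'a word = "('a \<times> bool) list"

abbreviation words :: "'a set \<Rightarrow> 'a word set" where
  "words S \<equiv> lists (S \<times> UNIV)"

definition word_val :: "('a, 'm) monoid_scheme \<Rightarrow> 'a word \<Rightarrow> 'a" where
  "word_val G w = foldr (\<lambda>(s, b) x. (if b then inv\<^bsub>G\<^esub> s else s) \<otimes>\<^bsub>G\<^esub> x) w \<one>\<^bsub>G\<^esub>"

text \<open>The congruence on words whose quotient is the group \<open>\<langle>S | R\<rangle>\<close>, i.e. the free group on \<open>S\<close>
  modulo the normal closure of \<open>R\<close>.\<close>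

inductive pres_eq :: "'a set \<Rightarrow> 'a word set \<Rightarrow> 'a word \<Rightarrow> 'a word \<Rightarrow> bool" for S R where
  refl: "w \<in> words S \<Longrightarrow> pres_eq S R w w"
| sym: "pres_eq S R u v \<Longrightarrow> pres_eq S R v u"
| trans: "pres_eq S R u v \<Longrightarrow> pres_eq S R v w \<Longrightarrow> pres_eq S R u w"
| cancel: "u \<in> words S \<Longrightarrow> v \<in> words S \<Longrightarrow> s \<in> S \<Longrightarrow>
    pres_eq S R (u @ [(s, b), (s, \<not> b)] @ v) (u @ v)"
| relator: "u \<in> words S \<Longrightarrow> v \<in> words S \<Longrightarrow> r \<in> R \<Longrightarrow> pres_eq S R (u @ r @ v) (u @ v)"

definition has_presentation :: "('a, 'm) monoid_scheme \<Rightarrow> 'a set \<Rightarrow> 'a word set \<Rightarrow> bool" where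
  "has_presentation G S R \<longleftrightarrow>
     group G \<and> S \<subseteq> carrier G \<and> R \<subseteq> words S \<and> generate G S = carrier G \<and>
     (\<forall>w \<in> words S. word_val G w = \<one>\<^bsub>G\<^esub> \<longleftrightarrow> pres_eq S R w [])"

section \<open>Coxeter systems\<close>

text \<open>The exponent \<open>m(s,t)\<close> is the order of \<open>s t\<close> in \<open>W\<close>. Since \<^const>\<open>group.ord\<close> is \<open>0\<close> on
  elements of infinite order, the value \<open>0\<close> stands for \<open>m(s,t) = \<infinity>\<close>.\<close>

definition cox_m :: "('a, 'm) monoid_scheme \<Rightarrow> 'a \<Rightarrow> 'a \<Rightarrow> nat" where
  "cox_m W s t = group.ord W (s \<otimes>\<^bsub>W\<^esub> t)"

text \<open>The words \<open>(s t)\<^sup>m\<close> with \<open>m = m(s,t)\<close> finite; for \<open>s = t\<close> this is the relator \<open>s s\<close>.\<close>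

definition cox_relators :: "('a, 'm) monoid_scheme \<Rightarrow> 'a set \<Rightarrow> 'a word set" where
  "cox_relators W S =
     {concat (replicate (cox_m W s t) [(s, False), (t, False)]) | s t.
        s \<in> S \<and> t \<in> S \<and> cox_m W s t \<noteq> 0}"

definition coxeter_system :: "('a, 'm) monoid_scheme \<Rightarrow> 'a set \<Rightarrow> bool" where
  "coxeter_system W S \<longleftrightarrow>
     group W \<and> S \<subseteq> carrier W \<and> (\<forall>s \<in> S. group.ord W s = 2) \<and>
     has_presentation W S (cox_relators W S)"

text \<open>Edges of the Coxeter graph join distinct \<open>s\<close>, \<open>t\<close> with \<open>m(s,t) \<ge> 3\<close> or \<open>m(s,t) = \<infinity>\<close>.\<close>

definition coxeter_graph :: "('a, 'm) monoid_scheme \<Rightarrow> 'a set \<Rightarrow> ('a \<times> 'a) set" where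
  "coxeter_graph W S =
     {(s, t). s \<in> S \<and> t \<in> S \<and> s \<noteq> t \<and> (cox_m W s t \<ge> 3 \<or> cox_m W s t = 0)}"

definition irreducible_coxeter_system :: "('a, 'm) monoid_scheme \<Rightarrow> 'a set \<Rightarrow> bool" where
  "irreducible_coxeter_system W S \<longleftrightarrow>
     coxeter_system W S \<and> (\<forall>s \<in> S. \<forall>t \<in> S. (s, t) \<in> (coxeter_graph W S)\<^sup>*)"

section \<open>Finite index, affine groups, presentability by a product\<close>

definition finite_index_subgroup :: "'a set \<Rightarrow> ('a, 'm) monoid_scheme \<Rightarrow> bool" where
  "finite_index_subgroup H G \<longleftrightarrow> subgroup H G \<and> finite (rcosets\<^bsub>G\<^esub> H)"

definition affine_group :: "('a, 'm) monoid_scheme \<Rightarrow> bool" where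
  "affine_group G \<longleftrightarrow>
     infinite (carrier G) \<and>
     (\<exists>H. \<exists>d::nat. d \<ge> 1 \<and> finite_index_subgroup H G \<and>
        G\<lparr>carrier := H\<rparr> \<cong> product_group {..<d} (\<lambda>_. integer_group))"

text \<open>A definition cannot quantify over types, so the types carrying the two factors are
  parameters; a statement with these as type variables covers factors of every type.\<close>

definition presentable_by_product ::
    "'b itself \<Rightarrow> 'c itself \<Rightarrow> ('a, 'm) monoid_scheme \<Rightarrow> bool" where
  "presentable_by_product _ _ G \<longleftrightarrow>
     infinite (carrier G) \<and>
     (\<exists>(G1 :: 'b monoid) (G2 :: 'c monoid) \<phi>.
        group G1 \<and> group G2 \<and> \<phi> \<in> hom (G1 \<times>\<times> G2) G \<and>
        infinite (\<phi> ` (carrier G1 \<times> {\<one>\<^bsub>G2\<^esub>})) \<and>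
        infinite (\<phi> ` ({\<one>\<^bsub>G1\<^esub>} \<times> carrier G2)) \<and>
        finite_index_subgroup (\<phi> ` carrier (G1 \<times>\<times> G2)) G)"

end

theory Submission
  imports Defs Complex_Main "HOL-Library.Function_Algebras"
begin

text \<open>Work in the geometric representation of \<open>W\<close>, with its root system and the invariant form
  \<open>B\<close>. If \<open>\<bar>B\<bar> \<le> 1\<close> on all pairs of roots, then \<open>B\<close> takes only finitely many values on roots, so the
  elements acting trivially modulo the radical of \<open>B\<close> have finite index; they form a discrete
  group of translations, and \<open>W\<close> is finite or affine. Otherwise there are roots \<open>x\<close>, \<open>y\<close> with
  \<open>B(x,y) < -1\<close>, and by irreducibility they can be chosen such that only finitely many elements
  fix both. Then \<open>g = r\<^sub>x r\<^sub>y\<close> has two isotropic eigenlines, and the action on them makes the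
  stabiliser \<open>E\<close> of this pair of lines virtually cyclic, while \<open>E\<close> contains the centraliser of
  every nontrivial power of \<open>g\<close>. If two infinite commuting subgroups \<open>P\<close>, \<open>Q\<close> had a product of finite
  index, some power of \<open>g\<close> would be \<open>p q\<close>; one of \<open>p\<close>, \<open>q\<close> has a power equal to a power of \<open>g\<close>,
  which forces first one factor and then the other into \<open>E\<close>, so \<open>W\<close> would be virtually cyclic.\<close>

subsection \<open>Symmetric bilinear forms and their reflections\<close>

text \<open>The form may be degenerate and its signature is unknown, so nothing can rest on
  nondegeneracy or on a model of hyperbolic space. Finiteness is extracted from the roots instead:
  only finitely many have bounded height, and an element is determined by the images of the simple
  roots, or by the positive roots that it makes negative. For an arbitrary pair \<open>x\<close>,
  \<open>y\<close> the stabiliser of the two eigenlines can be too big: reflections in roots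
  orthogonal to both may generate an infinite group fixing both. The plane is therefore required to
  contain a vector \<open>v\<close> with \<open>B(v,v) < 0\<close> that lies in the negative of the
  fundamental chamber and has all coordinates on \<open>S\<close> positive. An element fixing
  \<open>v\<close> inverts only roots orthogonal to \<open>v\<close>, and the full support of
  \<open>v\<close> bounds their height. Irreducibility serves to enlarge the support and to compare
  coordinates along edges of the graph. Affineness means a \<open>Z^d\<close> of finite index, so it
  excludes both exits: displacements in the radical give some \<open>d >= 1\<close>, and a virtually
  cyclic infinite group is the case \<open>d = 1\<close>.\<close>

definition scl :: "real \<Rightarrow> ('i \<Rightarrow> real) \<Rightarrow> 'i \<Rightarrow> real"  (infixr "*\<^sub>v" 75)
  where "c *\<^sub>v x = (\<lambda>i. c * x i)"

lemma scl_apply [simp]: "(c *\<^sub>v x) i = c * x i"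
  by (simp add: scl_def)

lemma vector_space_scl: "vector_space scl"
  by standard (auto simp: fun_eq_iff algebra_simps)

lemma scl_scl: "a *\<^sub>v b *\<^sub>v z = (a * b) *\<^sub>v z"
  by (simp add: fun_eq_iff)

definition unit_vec :: "'i \<Rightarrow> 'i \<Rightarrow> real"
  where "unit_vec s = (\<lambda>t. if t = s then 1 else 0)"

definition is_nonneg :: "('i \<Rightarrow> real) \<Rightarrow> bool"
  where "is_nonneg x \<longleftrightarrow> (\<forall>i. 0 \<le> x i)"

lemma is_nonneg_comb:
  "is_nonneg x \<Longrightarrow> is_nonneg y \<Longrightarrow> 0 \<le> a \<Longrightarrow> 0 \<le> b \<Longrightarrow> is_nonneg (a *\<^sub>v x + b *\<^sub>v y)"
  by (simp add: is_nonneg_def)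

lemma is_nonneg_unit_vec [simp]: "is_nonneg (unit_vec s)"
  by (simp add: is_nonneg_def unit_vec_def)

locale gram_form =
  fixes S :: "'a set" and B :: "'a \<Rightarrow> 'a \<Rightarrow> real"
  assumes finite_S: "finite S"
    and B_sym: "s \<in> S \<Longrightarrow> t \<in> S \<Longrightarrow> B s t = B t s"
begin

definition bil :: "('a \<Rightarrow> real) \<Rightarrow> ('a \<Rightarrow> real) \<Rightarrow> real"
  where "bil x y = (\<Sum>s\<in>S. \<Sum>t\<in>S. x s * y t * B s t)"

text \<open>The general factor \<open>2 / bil v v\<close> becomes \<open>2\<close> because every
  root is normalised to \<open>bil v v = 1\<close>.\<close>

definition reflect :: "('a \<Rightarrow> real) \<Rightarrow> ('a \<Rightarrow> real) \<Rightarrow> 'a \<Rightarrow> real"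
  where "reflect v x = x - (2 * bil x v) *\<^sub>v v"

lemma bil_add_left: "bil (x + y) z = bil x z + bil y z"
  by (simp add: bil_def sum.distrib algebra_simps)

lemma bil_scl_left: "bil (c *\<^sub>v x) z = c * bil x z"
  by (simp add: bil_def sum_distrib_left algebra_simps)

lemma bil_sym: "bil x y = bil y x"
proof -
  have "bil x y = (\<Sum>t\<in>S. \<Sum>s\<in>S. x s * y t * B s t)"
    unfolding bil_def by (rule sum.swap)
  also have "\<dots> = bil y x"
    unfolding bil_def
    by (rule sum.cong[OF HOL.refl], rule sum.cong[OF HOL.refl]) (simp add: B_sym[of _ s for s])
  finally show ?thesis .
qed

lemma bil_diff_left: "bil (x - y) z = bil x z - bil y z"
  by (simp add: bil_def sum_subtractf algebra_simps)

lemma bil_uminus_left: "bil (- x) z = - bil x z"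
  by (simp add: bil_def sum_negf)

lemma bil_add_right: "bil z (x + y) = bil z x + bil z y"
  by (simp add: bil_sym[of z] bil_add_left)

lemma bil_scl_right: "bil z (c *\<^sub>v x) = c * bil z x"
  by (simp add: bil_sym[of z] bil_scl_left)

lemma bil_diff_right: "bil z (x - y) = bil z x - bil z y"
  by (simp add: bil_sym[of z] bil_diff_left)

lemma bil_uminus_right: "bil z (- x) = - bil z x"
  by (simp add: bil_sym[of z] bil_uminus_left)

lemmas bil_simps = bil_add_left bil_scl_left bil_diff_left bil_uminus_left
  bil_add_right bil_scl_right bil_diff_right bil_uminus_right

lemma bil_unit_right: "t \<in> S \<Longrightarrow> bil x (unit_vec t) = (\<Sum>s\<in>S. x s * B s t)"
  unfolding bil_def
  by (rule sum.cong[OF HOL.refl], subst sum.remove[OF finite_S, of t]) (auto simp: unit_vec_def)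

lemma bil_unit_unit: "s \<in> S \<Longrightarrow> t \<in> S \<Longrightarrow> bil (unit_vec s) (unit_vec t) = B s t"
  by (simp add: bil_unit_right, subst sum.remove[OF finite_S, of s]) (auto simp: unit_vec_def)

lemma bil_expand_right: "bil x y = (\<Sum>t\<in>S. y t * bil x (unit_vec t))"
proof -
  have "bil x y = (\<Sum>t\<in>S. \<Sum>s\<in>S. x s * y t * B s t)"
    unfolding bil_def by (rule sum.swap)
  also have "\<dots> = (\<Sum>t\<in>S. y t * bil x (unit_vec t))"
    by (rule sum.cong[OF HOL.refl]) (simp add: bil_unit_right sum_distrib_left mult_ac)
  finally show ?thesis .
qed

lemma reflect_add: "reflect v (x + y) = reflect v x + reflect v y"
  by (simp add: reflect_def bil_simps fun_eq_iff algebra_simps)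

lemma reflect_scl: "reflect v (c *\<^sub>v x) = c *\<^sub>v reflect v x"
  by (simp add: reflect_def bil_simps fun_eq_iff algebra_simps)

lemma bil_reflect: "bil v v = 1 \<Longrightarrow> bil (reflect v x) (reflect v y) = bil x y"
  by (simp add: reflect_def bil_simps bil_sym[of v y] algebra_simps)

lemma reflect_reflect: "bil v v = 1 \<Longrightarrow> reflect v (reflect v x) = x"
  by (simp add: reflect_def bil_simps fun_eq_iff algebra_simps)

lemma reflect_self: "bil v v = 1 \<Longrightarrow> reflect v v = - v"
  by (simp add: reflect_def fun_eq_iff)

end

text \<open>Chebyshev polynomials of the second kind, shifted by one: for \<open>c = cos \<theta>\<close> the value is
  \<open>sin (n \<theta>) / sin \<theta>\<close>. They are the coefficients of the roots of a dihedral group.\<close>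

fun cheb :: "real \<Rightarrow> nat \<Rightarrow> real" where
  "cheb c 0 = 0"
| "cheb c (Suc 0) = 1"
| "cheb c (Suc (Suc n)) = 2 * c * cheb c (Suc n) - cheb c n"

lemma cheb_sin: "cheb (cos \<theta>) n * sin \<theta> = sin (real n * \<theta>)"
proof (induction "cos \<theta>" n rule: cheb.induct)
  case (3 n)
  have "sin (real (Suc (Suc n)) * \<theta>) + sin (real n * \<theta>) = 2 * cos \<theta> * sin (real (Suc n) * \<theta>)"
  proof -
    have "real (Suc (Suc n)) * \<theta> = real (Suc n) * \<theta> + \<theta>" "real n * \<theta> = real (Suc n) * \<theta> - \<theta>"
      by (simp_all add: algebra_simps)
    then show ?thesis by (simp only: sin_add sin_diff) (simp add: algebra_simps)
  qed
  with 3 show ?case by (simp add: algebra_simps)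
qed simp_all

lemma cheb_one: "cheb 1 n = real n"
  by (induction "1::real" n rule: cheb.induct) simp_all

text \<open>The value is a quotient of sines: \<open>n pi / m\<close> stays in
  \<open>[0, pi]\<close> as long as \<open>n <= m\<close>, and \<open>sin (pi / m)\<close> is
  positive for \<open>m >= 2\<close>. For \<open>m = 0\<close> the convention
  \<open>pi / 0 = 0\<close> makes the parameter \<open>1\<close>, where the value is just
  \<open>n\<close>.\<close>

lemma cheb_nonneg:
  assumes "m = 0 \<or> n \<le> m"
  shows "0 \<le> cheb (cos (pi / real m)) n"
proof (cases "m \<le> 1")
  case True
  show ?thesis
  proof (cases "m = 0")
    case True then show ?thesis by (simp add: cheb_one)
  next
    case False
    with assms \<open>m \<le> 1\<close> have "n = 0 \<or> n = Suc 0" by auto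
    then show ?thesis by auto
  qed
next
  case False
  have s: "0 < sin (pi / real m)"
    using False by (intro sin_gt_zero) (auto simp: field_simps)
  have "0 \<le> sin (real n * (pi / real m))"
    using assms False by (intro sin_ge_zero) (auto simp: field_simps)
  then show ?thesis
    using s cheb_sin[of "pi / real m" n] by (metis linorder_not_less mult_neg_pos)
qed

lemma cheb_double_period:
  assumes "2 \<le> m"
  shows "cheb (cos (pi / real m)) (2 * m) = 0" "cheb (cos (pi / real m)) (Suc (2 * m)) = 1"
proof -
  let ?\<theta> = "pi / real m"
  have s: "0 < sin ?\<theta>"
    using assms by (intro sin_gt_zero) (auto simp: field_simps)
  have "real (2 * m) * ?\<theta> = 2 * pi" using assms by simp
  then have "cheb (cos ?\<theta>) (2 * m) * sin ?\<theta> = 0" using cheb_sin[of ?\<theta> "2*m"] by simp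
  then show "cheb (cos ?\<theta>) (2 * m) = 0" using s by simp
  have "real (Suc (2 * m)) * ?\<theta> = 2 * pi + ?\<theta>" using assms by (simp add: field_simps)
  then have "cheb (cos ?\<theta>) (Suc (2 * m)) * sin ?\<theta> = sin ?\<theta>"
    using cheb_sin[of ?\<theta> "Suc (2*m)"] by (simp add: sin_add)
  then show "cheb (cos ?\<theta>) (Suc (2 * m)) = 1" using s by simp
qed

section \<open>Products of two reflections\<close>

context gram_form
begin

text \<open>The recursion of \<open>cheb\<close> is exactly what \<open>reflect u\<close> does to
  the coefficient of \<open>u\<close>; that of \<open>v\<close> stays.\<close>

lemma dihedral_step:
  assumes "bil u u = 1" "bil v v = 1" "bil u v = - c"
  shows "reflect u (cheb c n *\<^sub>v u + cheb c (Suc n) *\<^sub>v v)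
    = cheb c (Suc (Suc n)) *\<^sub>v u + cheb c (Suc n) *\<^sub>v v"
  using assms by (simp add: reflect_def bil_simps bil_sym[of v u] fun_eq_iff algebra_simps)

lemma dihedral_pow:
  assumes "bil u u = 1" "bil v v = 1" "bil u v = - c"
  shows "((reflect u \<circ> reflect v) ^^ k) u
    = cheb c (Suc (2 * k)) *\<^sub>v u + cheb c (2 * k) *\<^sub>v v"
proof (induction k)
  case 0 then show ?case by (simp add: fun_eq_iff)
next
  case (Suc k)
  have "reflect v (cheb c (Suc (2 * k)) *\<^sub>v u + cheb c (2 * k) *\<^sub>v v)
    = cheb c (Suc (2 * k)) *\<^sub>v u + cheb c (Suc (Suc (2 * k))) *\<^sub>v v"
    using dihedral_step[of v u c "2*k"] assms by (simp add: bil_sym[of v u] add.commute)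
  then have "(reflect u \<circ> reflect v) (cheb c (Suc (2 * k)) *\<^sub>v u + cheb c (2 * k) *\<^sub>v v)
    = cheb c (Suc (Suc (Suc (2 * k)))) *\<^sub>v u + cheb c (Suc (Suc (2 * k))) *\<^sub>v v"
    by (simp only: o_apply dihedral_step[OF assms])
  with Suc.IH show ?case
    by (simp only: funpow.simps(2) o_apply mult_Suc_right add_2_eq_Suc)
qed

lemma linear_funpow:
  fixes f :: "('i \<Rightarrow> real) \<Rightarrow> 'i \<Rightarrow> real"
  assumes "\<And>x y. f (x + y) = f x + f y" "\<And>c x. f (c *\<^sub>v x) = c *\<^sub>v f x"
  shows "(f ^^ k) (x + y) = (f ^^ k) x + (f ^^ k) y" "(f ^^ k) (c *\<^sub>v x) = c *\<^sub>v (f ^^ k) x"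
proof -
  show "(f ^^ k) (x + y) = (f ^^ k) x + (f ^^ k) y" by (induction k) (simp_all only: funpow.simps o_apply id_apply assms(1))
  show "(f ^^ k) (c *\<^sub>v x) = c *\<^sub>v (f ^^ k) x" by (induction k) (simp_all only: funpow.simps o_apply id_apply assms(2))
qed

text \<open>The Chebyshev values at \<open>2 m\<close> show that the \<open>m\<close>-th power fixes
  \<open>u\<close> and \<open>v\<close>. Any other vector splits into a combination of
  \<open>u\<close>, \<open>v\<close> and a part orthogonal to both, which each reflection fixes; the
  splitting exists because the Gram determinant is \<open>sin^2 (pi / m)\<close>, nonzero for
  \<open>m >= 2\<close>.\<close>

lemma dihedral_order:
  assumes m: "2 \<le> m" and uv: "bil u u = 1" "bil v v = 1" "bil u v = - cos (pi / real m)"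
  shows "((reflect u \<circ> reflect v) ^^ m) x = x"
proof -
  let ?c = "cos (pi / real m)"
  let ?g = "reflect u \<circ> reflect v" and ?h = "reflect v \<circ> reflect u"
  have lin: "?g (x + y) = ?g x + ?g y" "?g (a *\<^sub>v x) = a *\<^sub>v ?g x" for x y a
    by (simp_all add: reflect_add reflect_scl)
  note glin = linear_funpow[of ?g, OF lin, of m]
  have gu: "(?g ^^ m) u = u"
    using dihedral_pow[OF uv, of m] cheb_double_period[OF m] by (simp add: fun_eq_iff)
  have hv: "(?h ^^ m) v = v"
    using dihedral_pow[of v u ?c m] cheb_double_period[OF m] uv
    by (simp add: bil_sym[of v u] fun_eq_iff)
  \<comment> \<open>\<open>dihedral_pow\<close> tracks only the first of the two vectors, so
    \<open>v\<close> is treated with the reflections exchanged; that product is the inverse of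
    \<open>?g\<close>.\<close>
  have inv: "(?g ^^ k) ((?h ^^ k) x) = x" for k x
  proof (induction k arbitrary: x)
    case (Suc k)
    have "(?g ^^ Suc k) ((?h ^^ Suc k) x) = (?g ^^ k) (?g (?h ((?h ^^ k) x)))"
      by (subst funpow_Suc_right) (simp only: funpow.simps(2) o_apply)
    also have "?g (?h ((?h ^^ k) x)) = (?h ^^ k) x"
      using uv by (simp add: reflect_reflect)
    finally show ?case using Suc.IH by (simp only:)
  qed simp
  have gv: "(?g ^^ m) v = v" using inv[of m v] hv by simp
  have c: "1 - ?c\<^sup>2 \<noteq> 0"
  proof -
    have "0 < sin (pi / real m)" using m by (intro sin_gt_zero) (auto simp: field_simps)
    then show ?thesis by (simp add: cos_squared_eq)
  qed
  \<comment> \<open>Cramer's rule for the coefficients of the projection of \<open>x\<close> onto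
    the plane of \<open>u\<close> and \<open>v\<close>.\<close>
  define p q where "p = (bil x u + ?c * bil x v) / (1 - ?c\<^sup>2)"
    and "q = (bil x v + ?c * bil x u) / (1 - ?c\<^sup>2)"
  define y where "y = x - (p *\<^sub>v u + q *\<^sub>v v)"
  have elim: "(b - p + q * c) * (1 - c\<^sup>2) = 0"
    if "p * (1 - c\<^sup>2) = b + c * d" "q * (1 - c\<^sup>2) = d + c * b" for b c d p q :: real
  proof -
    have "(b - p + q * c) * (1 - c\<^sup>2) = b * (1 - c\<^sup>2) - p * (1 - c\<^sup>2) + c * (q * (1 - c\<^sup>2))"
      by (simp add: algebra_simps)
    then show ?thesis unfolding that by (simp add: algebra_simps power2_eq_square)
  qed
  have pD: "p * (1 - ?c\<^sup>2) = bil x u + ?c * bil x v"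
    and qD: "q * (1 - ?c\<^sup>2) = bil x v + ?c * bil x u"
    using c by (simp_all add: p_def q_def)
  have "bil y u = bil x u - p + q * ?c" "bil y v = bil x v + p * ?c - q"
    using uv by (simp_all add: y_def bil_simps bil_sym[of v u])
  moreover have "(bil x u - p + q * ?c) * (1 - ?c\<^sup>2) = 0" "(bil x v + p * ?c - q) * (1 - ?c\<^sup>2) = 0"
    using elim[OF pD qD] elim[OF qD pD] by (simp_all add: algebra_simps)
  ultimately have "bil y u = 0" "bil y v = 0" using c by simp_all
  then have "reflect u y = y" "reflect v y = y" by (simp_all add: reflect_def fun_eq_iff)
  then have gy: "(?g ^^ k) y = y" for k
    by (induction k) (simp_all only: funpow.simps id_apply o_apply)
  have x: "x = y + (p *\<^sub>v u + q *\<^sub>v v)" by (simp add: y_def)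
  have "(?g ^^ m) x = (?g ^^ m) y + (p *\<^sub>v (?g ^^ m) u + q *\<^sub>v (?g ^^ m) v)"
    by (subst x) (simp only: glin)
  also have "\<dots> = x" unfolding gy gu gv by (simp add: y_def)
  finally show ?thesis .
qed

end

subsection \<open>The geometric representation\<close>

locale fin_coxeter =
  fixes W (structure) and S
  assumes coxeter: "coxeter_system W S" and finite_gens: "finite S"

sublocale fin_coxeter \<subseteq> group W
  using coxeter by (simp add: coxeter_system_def)

context fin_coxeter
begin

text \<open>One formula covers all cases: \<open>m = 1\<close> on the diagonal gives
  \<open>1\<close>, and \<open>m = 0\<close>, which stands for infinity, gives
  \<open>- cos 0 = - 1\<close> because division by zero yields \<open>0\<close>.\<close>

definition gram :: "'a \<Rightarrow> 'a \<Rightarrow> real"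
  where "gram s t = - cos (pi / real (cox_m W s t))"

lemma gens_closed: "s \<in> S \<Longrightarrow> s \<in> carrier W"
  using coxeter by (auto simp: coxeter_system_def)

lemma gen_ord: "s \<in> S \<Longrightarrow> ord s = 2"
  using coxeter by (simp add: coxeter_system_def)

lemma gen_sq: "s \<in> S \<Longrightarrow> s \<otimes> s = \<one>"
  using pow_ord_eq_1[of s] gens_closed[of s] gen_ord[of s] by (simp add: numeral_2_eq_2)

lemma gen_sq_left: "s \<in> S \<Longrightarrow> x \<in> carrier W \<Longrightarrow> s \<otimes> (s \<otimes> x) = x"
  by (simp add: m_assoc[symmetric] gens_closed gen_sq)

lemma gen_sq_right: "s \<in> S \<Longrightarrow> x \<in> carrier W \<Longrightarrow> x \<otimes> s \<otimes> s = x"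
  by (simp add: m_assoc gens_closed gen_sq)

lemma gen_inv: "s \<in> S \<Longrightarrow> inv s = s"
  by (simp add: inv_equality gens_closed gen_sq)

lemma cox_m_sym:
  assumes "s \<in> S" "t \<in> S" shows "cox_m W s t = cox_m W t s"
proof -
  have "inv (s \<otimes> t) = t \<otimes> s"
    using assms by (simp add: inv_mult_group gens_closed gen_inv)
  then show ?thesis
    using ord_inv[of "s \<otimes> t"] assms by (simp add: cox_m_def gens_closed)
qed

lemma cox_m_eq_1: "s \<in> S \<Longrightarrow> t \<in> S \<Longrightarrow> cox_m W s t = 1 \<longleftrightarrow> s = t"
  unfolding cox_m_def
  by (subst ord_eq_1) (auto simp: gens_closed gen_sq intro: inv_unique' dest: inv_equality simp: gen_inv)

end

sublocale fin_coxeter \<subseteq> gram_form S gram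
  by standard (simp_all add: finite_gens gram_def cox_m_sym)

context fin_coxeter
begin

lemma gram_diag: "s \<in> S \<Longrightarrow> gram s s = 1"
  using cox_m_eq_1[of s s] by (simp add: gram_def)

lemma cos_pi_div_nonneg: "0 \<le> cos (pi / real m)" if "m \<noteq> 1"
proof (cases "m = 0")
  case False
  with that have "2 \<le> m" by simp
  have "0 \<le> pi / real m" by simp
  moreover have "pi / real m \<le> pi / 2" using \<open>2 \<le> m\<close> by (intro divide_left_mono) auto
  ultimately show ?thesis using pi_ge_zero by (intro cos_ge_zero) linarith+
qed simp

lemma gram_nonpos: "s \<in> S \<Longrightarrow> t \<in> S \<Longrightarrow> s \<noteq> t \<Longrightarrow> gram s t \<le> 0"
  using cos_pi_div_nonneg[of "cox_m W s t"] cox_m_eq_1[of s t] by (simp add: gram_def)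

lemma gram_neg: "(s, t) \<in> coxeter_graph W S \<Longrightarrow> gram s t < 0"
proof -
  assume "(s, t) \<in> coxeter_graph W S"
  then consider "cox_m W s t = 0" | "3 \<le> cox_m W s t" by (auto simp: coxeter_graph_def)
  then have "0 < cos (pi / real (cox_m W s t))"
  proof cases
    case 2
    then show ?thesis by (intro cos_gt_zero) (auto simp: field_simps)
  qed simp
  then show ?thesis by (simp add: gram_def)
qed

lemma abs_gram_le: "\<bar>gram s t\<bar> \<le> 1"
  by (simp add: gram_def)

lemma unit_norm: "s \<in> S \<Longrightarrow> bil (unit_vec s) (unit_vec s) = 1"
  by (simp add: bil_unit_unit gram_diag)

section \<open>Words in the generators and their action\<close>

definition wprod :: "'a list \<Rightarrow> 'a"
  where "wprod xs = foldr (\<otimes>) xs \<one>"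

definition act :: "'a list \<Rightarrow> ('a \<Rightarrow> real) \<Rightarrow> 'a \<Rightarrow> real"
  where "act xs = foldr (\<lambda>s. reflect (unit_vec s)) xs"

lemma wprod_Nil [simp]: "wprod [] = \<one>"
  and wprod_Cons [simp]: "wprod (s # xs) = s \<otimes> wprod xs"
  by (simp_all add: wprod_def)

lemma act_Nil [simp]: "act [] x = x"
  and act_Cons [simp]: "act (s # xs) x = reflect (unit_vec s) (act xs x)"
  by (simp_all add: act_def)

lemma act_append: "act (xs @ ys) x = act xs (act ys x)"
  by (simp add: act_def)

lemma wprod_closed [simp]: "set xs \<subseteq> S \<Longrightarrow> wprod xs \<in> carrier W"
  by (induction xs) (auto simp: gens_closed)

lemma wprod_append: "set xs \<subseteq> S \<Longrightarrow> set ys \<subseteq> S \<Longrightarrow> wprod (xs @ ys) = wprod xs \<otimes> wprod ys"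
  by (induction xs) (auto simp: gens_closed m_assoc)

lemma wprod_rev: "set xs \<subseteq> S \<Longrightarrow> wprod (rev xs) = inv (wprod xs)"
  by (induction xs) (auto simp: wprod_append gens_closed inv_mult_group gen_inv)

lemma wprod_surj:
  assumes "w \<in> carrier W"
  shows "\<exists>xs. set xs \<subseteq> S \<and> wprod xs = w"
proof -
  have "w \<in> generate W S"
    using assms coxeter by (simp add: coxeter_system_def has_presentation_def)
  then show ?thesis
  proof induction
    case one
    show ?case by (intro exI[of _ "[]"]) simp
  next
    case (incl h)
    then show ?case by (intro exI[of _ "[h]"]) (simp add: gens_closed)
  next
    case (inv h)
    then show ?case by (intro exI[of _ "[h]"]) (simp add: gens_closed gen_inv)
  next
    case (eng h1 h2)
    then obtain xs ys where "set xs \<subseteq> S" "wprod xs = h1" "set ys \<subseteq> S" "wprod ys = h2" by auto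
    then show ?case by (intro exI[of _ "xs @ ys"]) (simp add: wprod_append)
  qed
qed

lemma act_rev: "set xs \<subseteq> S \<Longrightarrow> act (rev xs) (act xs x) = x"
  by (induction xs) (auto simp: act_append reflect_reflect unit_norm)

lemma act_concat_replicate:
  "act (concat (replicate k [s, t])) x = ((reflect (unit_vec s) \<circ> reflect (unit_vec t)) ^^ k) x"
  by (induction k) (simp_all add: act_append)

lemma act_relator:
  assumes "s \<in> S" "t \<in> S" "cox_m W s t \<noteq> 0"
  shows "act (concat (replicate (cox_m W s t) [s, t])) x = x"
proof (cases "s = t")
  case True
  then show ?thesis
    using assms cox_m_eq_1[of s t] by (simp add: reflect_reflect unit_norm)
next
  case False
  then have "2 \<le> cox_m W s t" using assms cox_m_eq_1[of s t] by linarith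
  then show ?thesis
    using assms dihedral_order[of "cox_m W s t" "unit_vec s" "unit_vec t" x]
    by (simp add: act_concat_replicate unit_norm bil_unit_unit gram_def)
qed

text \<open>Each generating step of the congruence preserves the action: a cancelling pair is one
  reflection applied twice, and a relator is \<open>dihedral_order\<close>. Dropping the inverse
  flags by \<open>map fst\<close> is sound since reflections are involutions.\<close>

lemma act_pres_eq:
  "pres_eq S (cox_relators W S) u v \<Longrightarrow> act (map fst u) x = act (map fst v) x"
proof (induction arbitrary: x rule: pres_eq.induct)
  case (cancel u v s b)
  then show ?case by (simp add: act_append reflect_reflect unit_norm)
next
  case (relator u v r)
  then obtain s t where st: "s \<in> S" "t \<in> S" "cox_m W s t \<noteq> 0"
    and r: "r = concat (replicate (cox_m W s t) [(s, False), (t, False)])"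
    by (auto simp: cox_relators_def)
  have "map fst r = concat (replicate (cox_m W s t) [s, t])"
    unfolding r by (simp add: map_concat map_replicate)
  then show ?case by (simp add: act_append act_relator st)
qed simp_all

text \<open>This makes the representation well defined: \<open>xs\<close> followed by the reverse of
  \<open>ys\<close> evaluates to the identity, so the presentation makes it equivalent to the empty
  word.\<close>

lemma act_cong:
  assumes "set xs \<subseteq> S" "set ys \<subseteq> S" "wprod xs = wprod ys"
  shows "act xs x = act ys x"
proof -
  let ?u = "map (\<lambda>s. (s, False)) (xs @ rev ys)"
  have v: "word_val W (map (\<lambda>s. (s, False)) zs) = wprod zs" for zs
    by (induction zs) (simp_all add: word_val_def)
  have "word_val W ?u = \<one>"
    unfolding v using assms by (simp add: wprod_append wprod_rev)
  moreover have "?u \<in> words S" using assms by auto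
  ultimately have "pres_eq S (cox_relators W S) ?u []"
    using coxeter by (simp add: coxeter_system_def has_presentation_def)
  from act_pres_eq[OF this, of "act ys x"] show ?thesis
    using assms by (simp add: act_append act_rev comp_def)
qed

definition rho :: "'a \<Rightarrow> ('a \<Rightarrow> real) \<Rightarrow> 'a \<Rightarrow> real"
  where "rho w = act (SOME xs. set xs \<subseteq> S \<and> wprod xs = w)"

lemma rho_wprod: "set xs \<subseteq> S \<Longrightarrow> rho (wprod xs) x = act xs x"
proof -
  assume xs: "set xs \<subseteq> S"
  then have "\<exists>ys. set ys \<subseteq> S \<and> wprod ys = wprod xs" by blast
  from someI_ex[OF this] show ?thesis unfolding rho_def using xs by (intro act_cong) auto
qed

lemma rho_mult:
  assumes "v \<in> carrier W" "w \<in> carrier W"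
  shows "rho (v \<otimes> w) x = rho v (rho w x)"
proof -
  obtain xs ys where "set xs \<subseteq> S" "wprod xs = v" "set ys \<subseteq> S" "wprod ys = w"
    using assms wprod_surj by metis
  then show ?thesis
    using rho_wprod[of "xs @ ys" x] rho_wprod[of xs] rho_wprod[of ys]
    by (auto simp: wprod_append act_append)
qed

lemma rho_one [simp]: "rho \<one> x = x"
  using rho_wprod[of "[]"] by simp

lemma rho_gen: "s \<in> S \<Longrightarrow> rho s x = reflect (unit_vec s) x"
  using rho_wprod[of "[s]" x] by (simp add: gens_closed)

lemma rho_inv_left [simp]: "w \<in> carrier W \<Longrightarrow> rho (inv w) (rho w x) = x"
  by (simp add: rho_mult[symmetric])

lemma rho_inv_right [simp]: "w \<in> carrier W \<Longrightarrow> rho w (rho (inv w) x) = x"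
  by (simp add: rho_mult[symmetric])

lemma rho_induct [consumes 1, case_names one step]:
  assumes "w \<in> carrier W" "P \<one>"
    "\<And>s w. s \<in> S \<Longrightarrow> w \<in> carrier W \<Longrightarrow> P w \<Longrightarrow> P (s \<otimes> w)"
  shows "P w"
proof -
  have "set xs \<subseteq> S \<Longrightarrow> P (wprod xs)" for xs
    by (induction xs) (use assms in auto)
  then show ?thesis using wprod_surj[OF assms(1)] by blast
qed

lemma rho_add: "w \<in> carrier W \<Longrightarrow> rho w (x + y) = rho w x + rho w y"
  by (induction w rule: rho_induct) (simp_all only: rho_one rho_mult gens_closed rho_gen reflect_add)

lemma rho_scl: "w \<in> carrier W \<Longrightarrow> rho w (c *\<^sub>v x) = c *\<^sub>v rho w x"
  by (induction w rule: rho_induct) (simp_all only: rho_one rho_mult gens_closed rho_gen reflect_scl)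

lemma rho_uminus: "w \<in> carrier W \<Longrightarrow> rho w (- x) = - rho w x"
proof -
  have "- y = (-1) *\<^sub>v y" for y :: "'a \<Rightarrow> real" by (simp add: fun_eq_iff)
  then show "w \<in> carrier W \<Longrightarrow> rho w (- x) = - rho w x" by (simp only: rho_scl)
qed

lemma rho_diff: "w \<in> carrier W \<Longrightarrow> rho w (x - y) = rho w x - rho w y"
  using rho_add[of w x "- y"] rho_uminus[of w y] by simp

lemma bil_rho: "w \<in> carrier W \<Longrightarrow> bil (rho w x) (rho w y) = bil x y"
  by (induction w rule: rho_induct) (simp_all add: rho_mult gens_closed rho_gen bil_reflect unit_norm)

lemma rho_outside: "w \<in> carrier W \<Longrightarrow> i \<notin> S \<Longrightarrow> rho w x i = x i"
  by (induction w rule: rho_induct)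
     (auto simp: rho_mult gens_closed rho_gen reflect_def unit_vec_def)

end

subsection \<open>Positivity of roots\<close>

text \<open>Words grow at the front, so a nonempty one always ends in \<open>t\<close>, the letter
  that acts first on vectors.\<close>

fun alt :: "'a \<Rightarrow> 'a \<Rightarrow> nat \<Rightarrow> 'a list" where
  "alt s t 0 = []"
| "alt s t (Suc n) = (if even n then t else s) # alt s t n"

lemma length_alt [simp]: "length (alt s t n) = n"
  by (induction n) auto

lemma set_alt: "s \<in> A \<Longrightarrow> t \<in> A \<Longrightarrow> set (alt s t n) \<subseteq> A"
  by (induction n) auto

lemma alt_snoc: "alt t s (Suc n) = alt s t n @ [s]"
  by (induction n) auto

lemma alt_add: "\<exists>xs. alt s t (n + m) = xs @ alt s t m \<and> length xs = n \<and> set xs \<subseteq> {s, t}"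
proof (induction n)
  case (Suc n)
  then obtain xs where "alt s t (n + m) = xs @ alt s t m" "length xs = n" "set xs \<subseteq> {s, t}" by blast
  then show ?case
    by (intro exI[of _ "(if even (n + m) then t else s) # xs"]) auto
qed simp

context fin_coxeter
begin

definition len :: "'a \<Rightarrow> nat"
  where "len w = (LEAST n. \<exists>xs. set xs \<subseteq> S \<and> length xs = n \<and> wprod xs = w)"

lemma len_le: "set xs \<subseteq> S \<Longrightarrow> len (wprod xs) \<le> length xs"
  unfolding len_def by (intro Least_le) auto

lemma reduced_word:
  assumes "w \<in> carrier W"
  shows "\<exists>xs. set xs \<subseteq> S \<and> length xs = len w \<and> wprod xs = w"
proof -
  have "\<exists>n xs. set xs \<subseteq> S \<and> length xs = n \<and> wprod xs = w"
    using wprod_surj[OF assms] by auto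
  from LeastI_ex[OF this] show ?thesis unfolding len_def .
qed

lemma len_mult_word:
  assumes "v \<in> carrier W" "set xs \<subseteq> S"
  shows "len (v \<otimes> wprod xs) \<le> len v + length xs"
proof -
  obtain ys where "set ys \<subseteq> S" "length ys = len v" "wprod ys = v"
    using reduced_word[OF assms(1)] by blast
  then show ?thesis using len_le[of "ys @ xs"] assms by (simp add: wprod_append)
qed

lemma wprod_alt:
  assumes "s \<in> S" "t \<in> S"
  shows "wprod (alt s t (2 * k)) = (s \<otimes> t) [^] k"
proof (induction k)
  case (Suc k)
  have p: "(s \<otimes> t) [^] k \<in> carrier W" using assms by (simp add: gens_closed)
  have "wprod (alt s t (2 * Suc k)) = s \<otimes> (t \<otimes> (s \<otimes> t) [^] k)" using Suc by simp
  also have "\<dots> = (s \<otimes> t) \<otimes> (s \<otimes> t) [^] k" using assms p by (simp add: m_assoc gens_closed)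
  also have "\<dots> = (s \<otimes> t) [^] Suc k" using assms by (simp only: nat_pow_Suc2 gens_closed m_closed)
  finally show ?case .
qed simp

text \<open>For \<open>m = 2 k\<close> the two sides are \<open>(s t)^k\<close> and its inverse,
  equal because \<open>(s t)^m = 1\<close>; the odd case reduces to the same relation after moving
  one letter. For \<open>m = 0\<close> both words are empty.\<close>

lemma braid:
  assumes st: "s \<in> S" "t \<in> S" and m: "m = cox_m W s t"
  shows "wprod (alt s t m) = wprod (alt t s m)"
proof -
  let ?p = "s \<otimes> t"
  have pc: "?p \<in> carrier W" using st by (simp add: gens_closed)
  have pm: "?p [^] m = \<one>" unfolding m cox_m_def using pc by (rule pow_ord_eq_1)
  have ts: "(t \<otimes> s) [^] k = inv (?p [^] k)" for k :: nat
  proof -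
    have "t \<otimes> s = inv ?p" using st by (simp add: inv_mult_group gens_closed gen_inv)
    then show ?thesis using pc by (simp add: nat_pow_inv)
  qed
  show ?thesis
  proof (cases "even m")
    case True
    then obtain k where k: "m = 2 * k" by blast
    have "?p [^] k \<otimes> ?p [^] k = \<one>"
      using pm pc by (simp add: k nat_pow_mult mult_2)
    then show ?thesis
      unfolding k wprod_alt[OF st] wprod_alt[OF st(2,1)] ts
      using pc by (metis inv_equality nat_pow_closed)
  next
    case False
    then obtain k where k: "m = Suc (2 * k)" by (auto elim: oddE)
    have "(?p \<otimes> ?p [^] k) \<otimes> ?p [^] k = ?p [^] m"
      using pc by (simp only: k mult_2 nat_pow_Suc2 nat_pow_mult[symmetric] m_assoc nat_pow_closed)
    then have "?p \<otimes> ?p [^] k = inv (?p [^] k)"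
      using pm pc by (metis inv_equality nat_pow_closed m_closed)
    moreover have "s \<otimes> (?p \<otimes> ?p [^] k) = t \<otimes> ?p [^] k"
      using st pc by (simp add: m_assoc gens_closed gen_sq_left)
    ultimately show ?thesis
      unfolding k using wprod_alt[OF st, of k] wprod_alt[OF st(2,1), of k] by (simp add: ts)
  qed
qed

text \<open>Each further letter leaves one coefficient alone and advances the Chebyshev index of the
  other by two.\<close>

lemma act_alt:
  assumes "s \<in> S" "t \<in> S"
  defines "c \<equiv> cos (pi / real (cox_m W s t))"
  shows "act (alt s t k) (unit_vec s) =
    (if even k then cheb c (Suc k) *\<^sub>v unit_vec s + cheb c k *\<^sub>v unit_vec t
     else cheb c k *\<^sub>v unit_vec s + cheb c (Suc k) *\<^sub>v unit_vec t)"
proof (induction k)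
  case 0
  show ?case by (simp add: fun_eq_iff)
next
  case (Suc k)
  have b: "bil (unit_vec s) (unit_vec s) = 1" "bil (unit_vec t) (unit_vec t) = 1"
    "bil (unit_vec s) (unit_vec t) = - c" "bil (unit_vec t) (unit_vec s) = - c"
    using assms by (simp_all add: unit_norm bil_unit_unit gram_def cox_m_sym)
  show ?case
  proof (cases "even k")
    case True
    have "act (alt s t (Suc k)) (unit_vec s)
        = reflect (unit_vec t) (cheb c k *\<^sub>v unit_vec t + cheb c (Suc k) *\<^sub>v unit_vec s)"
      using Suc.IH True by (simp only: alt.simps act_Cons if_True add.commute)
    also have "\<dots> = cheb c (Suc k) *\<^sub>v unit_vec s + cheb c (Suc (Suc k)) *\<^sub>v unit_vec t"
      by (simp only: dihedral_step[OF b(2,1,4), of k] add.commute)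
    finally show ?thesis using True by (simp only: even_Suc if_False simp_thms)
  next
    case False
    have "act (alt s t (Suc k)) (unit_vec s)
        = reflect (unit_vec s) (cheb c k *\<^sub>v unit_vec s + cheb c (Suc k) *\<^sub>v unit_vec t)"
      using Suc.IH False by (simp only: alt.simps act_Cons if_False)
    also have "\<dots> = cheb c (Suc (Suc k)) *\<^sub>v unit_vec s + cheb c (Suc k) *\<^sub>v unit_vec t"
      by (rule dihedral_step[OF b(1,2,3), of k])
    finally show ?thesis using False by (simp only: even_Suc if_True simp_thms)
  qed
qed

text \<open>The element is written as \<open>v u\<close> with lengths adding up and \<open>u\<close> the longest possible
  alternating word in \<open>s\<close> and the last letter \<open>t\<close> of a reduced word; then both \<open>v s\<close> and \<open>v t\<close>
  are longer than \<open>v\<close>.\<close>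

lemma rho_unit_nonneg:
  assumes "w \<in> carrier W" "s \<in> S" "len w \<le> len (w \<otimes> s)"
  shows "is_nonneg (rho w (unit_vec s))"
  using assms
proof (induction "len w" arbitrary: w s rule: less_induct)
  case less
  note s = \<open>s \<in> S\<close> and w = \<open>w \<in> carrier W\<close>
  show ?case
  proof (cases "w = \<one>")
    case False
    obtain xs where xs: "set xs \<subseteq> S" "length xs = len w" "wprod xs = w"
      using reduced_word[OF w] by blast
    with False have "xs \<noteq> []" by auto
    then obtain ys t where ys: "xs = ys @ [t]" by (metis append_butlast_last_id)
    have t: "t \<in> S" using xs ys by auto
    have wt: "w = wprod ys \<otimes> t" using xs ys by (simp add: wprod_append gens_closed)
    have lys: "len (wprod ys) + 1 \<le> len w" using len_le[of ys] xs ys by simp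
    have "s \<noteq> t"
    proof
      assume "s = t"
      then have "w \<otimes> s = wprod ys" unfolding wt using t xs ys by (simp add: gen_sq_right)
      with lys less.prems(3) show False by simp
    qed
    define P where "P k \<longleftrightarrow> (\<exists>v\<in>carrier W. w = v \<otimes> wprod (alt s t k) \<and> len v + k = len w)" for k
    have "len w \<le> len (wprod ys) + 1"
      using len_mult_word[of "wprod ys" "[t]"] xs ys wt t by (simp add: gens_closed)
    then have "P 1" unfolding P_def using xs ys wt lys t
      by (intro bexI[of _ "wprod ys"]) (auto simp: gens_closed)
    moreover have "\<forall>k. P k \<longrightarrow> k \<le> len w" by (auto simp: P_def)
    ultimately obtain k where k: "P k" "1 \<le> k" "\<And>j. P j \<Longrightarrow> j \<le> k"
      by (metis GreatestI_nat Greatest_le_nat)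
    then obtain v where v: "v \<in> carrier W" "w = v \<otimes> wprod (alt s t k)" "len v + k = len w"
      by (auto simp: P_def)
    have alt_S: "set (alt s t j) \<subseteq> S" for j using set_alt[OF s t] .
    obtain j where j: "k = Suc j" using k(2) by (cases k) auto
    \<comment> \<open>\<open>y\<close> is the first letter of the alternating word and
      \<open>x\<close> the one that would be prepended next. For \<open>y\<close> the length bound
      comes from \<open>len v + k = len w\<close>, for \<open>x\<close> from the maximality of
      \<open>k\<close>.\<close>
    define y x where "y = (if even j then t else s)" and "x = (if even k then t else s)"
    have yx: "y \<in> S" "x \<in> S" "{x, y} = {s, t}" using s t j by (auto simp: x_def y_def)
    have "len v \<le> len (v \<otimes> y)"
    proof -
      have "w = (v \<otimes> y) \<otimes> wprod (alt s t j)"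
        using v(1,2) yx alt_S by (simp add: j y_def m_assoc gens_closed)
      then have "len w \<le> len (v \<otimes> y) + j"
        using len_mult_word[of "v \<otimes> y" "alt s t j"] v yx alt_S by (simp add: gens_closed)
      then show ?thesis using v(3) j by linarith
    qed
    moreover have "len v \<le> len (v \<otimes> x)"
    proof (rule ccontr)
      assume neg: "\<not> ?thesis"
      have vx: "v \<otimes> x \<in> carrier W" using v yx by (simp add: gens_closed)
      have "w = (v \<otimes> x) \<otimes> wprod (alt s t (Suc k))"
        using v(1,2) yx alt_S
        by (simp add: m_assoc gens_closed gen_sq_left x_def[symmetric])
      moreover from this have "len w \<le> len (v \<otimes> x) + Suc k"
        using len_mult_word[OF vx alt_S[of "Suc k"]] by (simp only: length_alt)
      ultimately have "P (Suc k)" unfolding P_def using vx neg v(3)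
        by (intro bexI[of _ "v \<otimes> x"]) auto
      then show False using k(3) by fastforce
    qed
    moreover have "len v < len w" using v(3) k(2) by simp
    ultimately have "is_nonneg (rho v (unit_vec y))" "is_nonneg (rho v (unit_vec x))"
      using less.hyps v(1) yx by blast+
    then have nn: "is_nonneg (rho v (unit_vec s))" "is_nonneg (rho v (unit_vec t))"
      using yx(3) by (metis insertE insertI1 insert_commute singletonD)+
    define m where "m = cox_m W s t"
    \<comment> \<open>If \<open>k >= m\<close>, the braid relation rewrites the last
      \<open>m\<close> letters so that they end in \<open>s\<close>; then \<open>w s\<close> would
      be shorter than \<open>w\<close>. The bound keeps both Chebyshev coefficients
      nonnegative.\<close>
    have km: "k < m \<or> m = 0"
    proof (rule ccontr)
      assume "\<not> ?thesis"
      then obtain i where i: "k = i + m" "m \<noteq> 0" by (metis add.commute le_Suc_ex not_less)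
      then obtain n where n: "m = Suc n" by (cases m) auto
      obtain zs where zs: "alt s t k = zs @ alt s t m" "length zs = i" "set zs \<subseteq> {s, t}"
        using alt_add[of s t i m] i by auto
      have zS: "set zs \<subseteq> S" using zs s t by auto
      have "wprod (alt s t k) = wprod zs \<otimes> wprod (alt t s m)"
        using zs zS alt_S braid[OF s t, of m] by (simp add: wprod_append m_def)
      also have "\<dots> = wprod (zs @ alt s t n) \<otimes> s"
        unfolding n alt_snoc using zS alt_S s
        by (simp add: wprod_append m_assoc gens_closed)
      finally have "w \<otimes> s = v \<otimes> wprod (zs @ alt s t n)"
        using v(1,2) zS alt_S s by (simp add: m_assoc gens_closed gen_sq_right gen_sq del: wprod_append)
      then have "len (w \<otimes> s) \<le> len v + (i + n)"
        using len_mult_word[of v "zs @ alt s t n"] v zS alt_S zs by simp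
      then show False using less.prems(3) v(3) i n by linarith
    qed
    define c where "c = cos (pi / real m)"
    have ch: "0 \<le> cheb c k" "0 \<le> cheb c (Suc k)"
      unfolding c_def using km by (auto intro!: cheb_nonneg)
    have "rho w (unit_vec s) = rho v (act (alt s t k) (unit_vec s))"
      using v alt_S by (simp add: rho_mult rho_wprod)
    then show ?thesis
      using ch nn v(1) by (simp add: act_alt[OF s t] m_def[symmetric] c_def[symmetric] rho_add rho_scl
          is_nonneg_comb del: cheb.simps)
  qed simp
qed

subsection \<open>Roots\<close>

definition roots :: "('a \<Rightarrow> real) set"
  where "roots = {rho w (unit_vec s) | w s. w \<in> carrier W \<and> s \<in> S}"

definition posroots :: "('a \<Rightarrow> real) set"
  where "posroots = {x \<in> roots. is_nonneg x}"

lemma unit_root: "s \<in> S \<Longrightarrow> unit_vec s \<in> posroots"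
  unfolding posroots_def roots_def using rho_one[of "unit_vec s"] one_closed by force

lemma posroot_root: "x \<in> posroots \<Longrightarrow> x \<in> roots"
  and posroot_nonneg: "x \<in> posroots \<Longrightarrow> is_nonneg x"
  by (simp_all add: posroots_def)

lemma rho_root: "x \<in> roots \<Longrightarrow> w \<in> carrier W \<Longrightarrow> rho w x \<in> roots"
  unfolding roots_def using rho_mult m_closed by (smt (verit, best) mem_Collect_eq)

lemma root_norm: "x \<in> roots \<Longrightarrow> bil x x = 1"
  by (auto simp: roots_def bil_rho unit_norm)

lemma uminus_root:
  assumes "x \<in> roots" shows "- x \<in> roots"
proof -
  obtain w s where "w \<in> carrier W" "s \<in> S" "x = rho w (unit_vec s)"
    using assms by (auto simp: roots_def)
  then have "- x = rho (w \<otimes> s) (unit_vec s)"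
    by (simp add: rho_mult gens_closed rho_gen reflect_self unit_norm rho_uminus)
  then show ?thesis
    unfolding roots_def using \<open>w \<in> carrier W\<close> \<open>s \<in> S\<close> gens_closed by blast
qed

text \<open>The reflection in \<open>w e_s\<close> is the conjugate \<open>w s w^-1\<close>, by
  invariance of the form.\<close>

lemma root_reflection:
  assumes "x \<in> roots" shows "\<exists>r\<in>carrier W. \<forall>y. rho r y = reflect x y"
proof -
  obtain w s where ws: "w \<in> carrier W" "s \<in> S" "x = rho w (unit_vec s)"
    using assms by (auto simp: roots_def)
  have "rho (w \<otimes> s \<otimes> inv w) y = reflect x y" for y
  proof -
    have "rho (w \<otimes> s \<otimes> inv w) y = rho w (reflect (unit_vec s) (rho (inv w) y))"
      using ws by (simp add: rho_mult gens_closed rho_gen)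
    also have "\<dots> = y - (2 * bil (rho (inv w) y) (unit_vec s)) *\<^sub>v x"
      using ws by (simp add: reflect_def rho_diff rho_scl)
    also have "bil (rho (inv w) y) (unit_vec s) = bil (rho w (rho (inv w) y)) x"
      unfolding ws(3) by (rule bil_rho[symmetric]) (rule ws)
    finally show ?thesis unfolding reflect_def using ws(1) by (simp only: rho_inv_right)
  qed
  then show ?thesis using ws by (intro bexI[of _ "w \<otimes> s \<otimes> inv w"]) (auto simp: gens_closed)
qed

lemma reflect_root: "x \<in> roots \<Longrightarrow> y \<in> roots \<Longrightarrow> reflect x y \<in> roots"
  using root_reflection[of x] rho_root[of y] by metis

lemma root_outside:
  assumes "x \<in> roots" "i \<notin> S" shows "x i = 0"
proof -
  obtain w s where "w \<in> carrier W" "s \<in> S" "x = rho w (unit_vec s)"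
    using assms by (auto simp: roots_def)
  then show ?thesis using rho_outside[of w i] assms(2) by (auto simp: unit_vec_def)
qed

text \<open>Writing the root as \<open>w e_s\<close>, one of \<open>w\<close> and \<open>w s\<close>
  satisfies the length condition of \<open>rho_unit_nonneg\<close>, and the two send
  \<open>e_s\<close> to opposite vectors.\<close>

lemma root_cases:
  assumes "x \<in> roots" shows "x \<in> posroots \<or> - x \<in> posroots"
proof -
  obtain w s where ws: "w \<in> carrier W" "s \<in> S" "x = rho w (unit_vec s)"
    using assms by (auto simp: roots_def)
  show ?thesis
  proof (cases "len w \<le> len (w \<otimes> s)")
    case True
    then show ?thesis using rho_unit_nonneg[OF ws(1,2)] ws(3) assms by (simp add: posroots_def)
  next
    case False
    have "is_nonneg (rho (w \<otimes> s) (unit_vec s))"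
      using False ws by (intro rho_unit_nonneg) (auto simp: gens_closed gen_sq_right)
    moreover have "rho (w \<otimes> s) (unit_vec s) = - x"
      using ws by (simp add: rho_mult gens_closed rho_gen reflect_self unit_norm rho_uminus)
    ultimately show ?thesis using uminus_root[OF assms] by (simp add: posroots_def)
  qed
qed

lemma posroot_uminus: "x \<in> posroots \<Longrightarrow> - x \<notin> posroots"
proof
  assume "x \<in> posroots" "- x \<in> posroots"
  then have "x = 0" by (auto simp: posroots_def is_nonneg_def fun_eq_iff intro: antisym)
  moreover have "bil x x = 1" using \<open>x \<in> posroots\<close> by (simp add: root_norm posroot_root)
  ultimately show False by (simp add: bil_def)
qed

lemma root_posI:
  assumes "x \<in> roots" "0 < x i" shows "x \<in> posroots"
proof (rule ccontr)
  assume "x \<notin> posroots"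
  then have "- x \<in> posroots" using root_cases assms by blast
  then have "0 \<le> (- x) i" unfolding posroots_def is_nonneg_def by blast
  then show False using assms by simp
qed

text \<open>Faithfulness in a strong form: for nontrivial \<open>w\<close>, the simple root of the
  last letter of a reduced word is sent to a negative root.\<close>

lemma eq_one_if_positive:
  assumes w: "w \<in> carrier W" and pos: "\<And>s. s \<in> S \<Longrightarrow> rho w (unit_vec s) \<in> posroots"
  shows "w = \<one>"
proof (rule ccontr)
  assume "w \<noteq> \<one>"
  obtain xs where xs: "set xs \<subseteq> S" "length xs = len w" "wprod xs = w"
    using reduced_word[OF w] by blast
  with \<open>w \<noteq> \<one>\<close> have "xs \<noteq> []" by auto
  then obtain ys s where ys: "xs = ys @ [s]" by (metis append_butlast_last_id)
  have s: "s \<in> S" and yS: "set ys \<subseteq> S" using xs ys by auto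
  let ?v = "wprod ys"
  have w_eq: "w = ?v \<otimes> s" using xs ys by (simp add: wprod_append gens_closed)
  have "len ?v \<le> len (?v \<otimes> s)" using len_le[OF yS] xs ys w_eq by simp
  then have "is_nonneg (rho ?v (unit_vec s))" using yS s by (intro rho_unit_nonneg) auto
  moreover have "rho ?v (unit_vec s) = - rho w (unit_vec s)"
    using yS s by (simp add: w_eq rho_mult gens_closed rho_gen reflect_self unit_norm rho_uminus)
  ultimately have "- rho w (unit_vec s) \<in> posroots"
    using uminus_root[OF posroot_root[OF pos[OF s]]] by (simp add: posroots_def)
  then show False using posroot_uminus[OF pos[OF s]] by blast
qed

lemma eq_if_rho_unit_eq:
  assumes "v \<in> carrier W" "w \<in> carrier W" "\<And>s. s \<in> S \<Longrightarrow> rho v (unit_vec s) = rho w (unit_vec s)"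
  shows "v = w"
proof -
  have "inv v \<otimes> w = \<one>"
    using assms by (intro eq_one_if_positive) (simp_all add: rho_mult assms(3)[symmetric] unit_root)
  then show ?thesis using assms by (metis inv_closed inv_equality inv_inv)
qed

text \<open>\<open>s\<close> changes only the coordinate at \<open>s\<close>. A positive root
  supported at \<open>s\<close> alone equals the simple root by normalisation; any other keeps a
  positive coordinate elsewhere, and one positive coordinate decides the sign of a root.\<close>

lemma simple_reflection_pos:
  assumes x: "x \<in> posroots" and s: "s \<in> S" and ne: "x \<noteq> unit_vec s"
  shows "rho s x \<in> posroots"
proof -
  have nn: "0 \<le> x i" for i using posroot_nonneg[OF x] by (simp add: is_nonneg_def)
  have "\<exists>i. i \<noteq> s \<and> 0 < x i"
  proof (rule ccontr)
    assume "\<not> ?thesis"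
    then have "x i = 0" if "i \<noteq> s" for i using nn that by (meson antisym_conv1 not_less)
    then have xe: "x = x s *\<^sub>v unit_vec s" by (auto simp: fun_eq_iff unit_vec_def)
    then have "bil x x = (x s)\<^sup>2"
      using s by (metis bil_scl_left bil_scl_right mult.right_neutral power2_eq_square unit_norm)
    then have "(x s)\<^sup>2 = 1" using root_norm[OF posroot_root[OF x]] by simp
    then have "x s = 1" using nn[of s] by (simp add: power2_eq_1_iff)
    then have "x = unit_vec s" using xe by (simp add: fun_eq_iff)
    then show False using ne by blast
  qed
  then obtain i where i: "i \<noteq> s" "0 < x i" by blast
  then have "0 < rho s x i" using s by (simp add: rho_gen reflect_def unit_vec_def)
  then show ?thesis
    using rho_root[OF posroot_root[OF x]] s gens_closed root_posI by blast
qed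

section \<open>Inversion sets\<close>

definition inversions :: "'a \<Rightarrow> ('a \<Rightarrow> real) set"
  where "inversions w = {x \<in> posroots. - rho w x \<in> posroots}"

text \<open>\<open>v w^-1\<close> keeps simple roots positive: \<open>y = w^-1 e_s\<close> or its
  negative is positive, and the common inversion set decides the sign of \<open>v y\<close> just as
  it decides that of \<open>w y = e_s\<close>.\<close>

lemma inversions_inj:
  assumes "v \<in> carrier W" "w \<in> carrier W" "inversions v = inversions w"
  shows "v = w"
proof -
  have "v \<otimes> inv w = \<one>"
  proof (rule eq_one_if_positive)
    fix s assume s: "s \<in> S"
    let ?y = "rho (inv w) (unit_vec s)"
    have wy: "rho w ?y = unit_vec s" using assms by simp
    have yr: "?y \<in> roots" using s assms by (simp add: rho_root posroot_root unit_root)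
    have vr: "rho v ?y \<in> roots" using yr assms by (simp add: rho_root)
    have "rho v ?y \<in> posroots"
    proof (cases "?y \<in> posroots")
      case True
      then have "?y \<notin> inversions w"
        using wy posroot_uminus[OF unit_root[OF s]] by (simp add: inversions_def)
      then have "- rho v ?y \<notin> posroots" using True assms(3) by (auto simp: inversions_def)
      then show ?thesis using root_cases[OF vr] by blast
    next
      case False
      then have ny: "- ?y \<in> posroots" using root_cases[OF yr] by blast
      then have "- ?y \<in> inversions w"
        using wy assms(2) unit_root[OF s] by (simp add: inversions_def rho_uminus)
      then have "- ?y \<in> inversions v" using assms(3) by simp
      then show ?thesis using assms(1) by (simp add: inversions_def rho_uminus)
    qed
    then show "rho (v \<otimes> inv w) (unit_vec s) \<in> posroots" using assms by (simp add: rho_mult)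
  qed (use assms in simp)
  then show ?thesis using assms by (metis inv_closed inv_equality inv_inv)
qed

lemma finite_if_inversions_in:
  assumes "finite Z" shows "finite {w \<in> carrier W. inversions w \<subseteq> Z}"
proof (rule inj_on_finite[of inversions _ "Pow Z"])
  show "inj_on inversions {w \<in> carrier W. inversions w \<subseteq> Z}"
    using inversions_inj by (intro inj_onI) blast
qed (use assms in auto)

end

subsection \<open>Discreteness of the root system\<close>

context gram_form
begin

definition height :: "('a \<Rightarrow> real) \<Rightarrow> real"
  where "height x = (\<Sum>s\<in>S. x s)"

definition norm1 :: "('a \<Rightarrow> real) \<Rightarrow> real"
  where "norm1 x = (\<Sum>s\<in>S. \<bar>x s\<bar>)"

lemma height_add: "height (x + y) = height x + height y"
  and height_diff: "height (x - y) = height x - height y"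
  and height_scl: "height (c *\<^sub>v x) = c * height x"
  and height_uminus: "height (- x) = - height x"
  by (simp_all add: height_def sum.distrib sum_subtractf sum_distrib_left sum_negf)

lemma height_unit: "s \<in> S \<Longrightarrow> height (unit_vec s) = 1"
  unfolding height_def unit_vec_def by (subst sum.remove[OF finite_S, of s]) auto

lemma norm1_unit: "s \<in> S \<Longrightarrow> norm1 (unit_vec s) = 1"
  unfolding norm1_def unit_vec_def by (subst sum.remove[OF finite_S, of s]) auto

lemma norm1_nonneg: "0 \<le> norm1 x"
  by (simp add: norm1_def sum_nonneg)

lemma abs_height_le: "\<bar>height x\<bar> \<le> norm1 x"
  by (simp add: height_def norm1_def sum_abs)

lemma norm1_of_nonneg: "is_nonneg x \<Longrightarrow> norm1 x = height x"
  by (simp add: is_nonneg_def norm1_def height_def)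

lemma height_nonneg: "is_nonneg x \<Longrightarrow> 0 \<le> height x"
  by (simp add: is_nonneg_def height_def sum_nonneg)

lemma coord_le_height: "is_nonneg x \<Longrightarrow> s \<in> S \<Longrightarrow> x s \<le> height x"
  unfolding height_def is_nonneg_def by (rule member_le_sum) (auto simp: finite_S)

lemma abs_bil_le:
  assumes "\<And>s t. \<bar>B s t\<bar> \<le> 1"
  shows "\<bar>bil x y\<bar> \<le> norm1 x * norm1 y"
proof -
  have "\<bar>bil x y\<bar> \<le> (\<Sum>s\<in>S. \<Sum>t\<in>S. \<bar>x s * y t * B s t\<bar>)"
    unfolding bil_def by (rule order_trans[OF sum_abs], rule sum_mono, rule sum_abs)
  also have "\<dots> \<le> (\<Sum>s\<in>S. \<Sum>t\<in>S. \<bar>x s\<bar> * \<bar>y t\<bar>)"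
    using assms by (intro sum_mono) (auto simp: abs_mult intro!: mult_left_le)
  also have "\<dots> = norm1 x * norm1 y" by (simp add: norm1_def sum_product)
  finally show ?thesis .
qed

lemma bil_nonpos_of_nonneg:
  assumes "\<And>s. s \<in> S \<Longrightarrow> bil v (unit_vec s) \<le> 0" "is_nonneg x"
  shows "bil v x \<le> 0"
  unfolding bil_expand_right[of v x]
  using assms by (intro sum_nonpos mult_nonneg_nonpos) (auto simp: is_nonneg_def)

text \<open>Pigeonhole on a grid: the coordinates on \<open>S\<close> lie in \<open>[0, M]\<close>,
  so finitely many cells of mesh \<open>e\<close> cover the infinite set.\<close>

lemma close_pair:
  assumes inf: "infinite A" and d: "0 < d"
    and A: "\<And>x. x \<in> A \<Longrightarrow> is_nonneg x" "\<And>x i. x \<in> A \<Longrightarrow> i \<notin> S \<Longrightarrow> x i = 0"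
      "\<And>x. x \<in> A \<Longrightarrow> height x \<le> M"
  shows "\<exists>x\<in>A. \<exists>y\<in>A. x \<noteq> y \<and> norm1 (y - x) \<le> d"
proof -
  \<comment> \<open>The \<open>+ 1\<close> keeps the denominator positive when \<open>S\<close> is
    empty; \<open>card S\<close> coordinate differences of size \<open>e\<close> sum to at most
    \<open>d\<close>.\<close>
  define e where "e = d / (real (card S) + 1)"
  have e: "0 < e" using d by (simp add: e_def)
  define f where "f x = (\<lambda>s\<in>S. floor (x s / e))" for x
  have "f ` A \<subseteq> (S \<rightarrow>\<^sub>E {0..floor (M / e)})"
  proof (clarify, rule PiE_I)
    fix x s assume x: "x \<in> A" and s: "s \<in> S"
    have "0 \<le> x s" "x s \<le> M"
      using A(1)[OF x] coord_le_height[OF A(1)[OF x] s] A(3)[OF x] by (auto simp: is_nonneg_def)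
    then show "f x s \<in> {0..floor (M / e)}" using e s by (simp add: f_def floor_mono divide_right_mono)
  qed (simp add: f_def)
  moreover have "finite (S \<rightarrow>\<^sub>E {0..floor (M / e)})" by (intro finite_PiE finite_S) simp
  ultimately have "finite (f ` A)" by (rule finite_subset)
  then have "\<not> inj_on f A" using inf finite_imageD by blast
  then obtain x y where xy: "x \<in> A" "y \<in> A" "x \<noteq> y" "f x = f y" by (auto simp: inj_on_def)
  have "\<bar>(y - x) s\<bar> \<le> e" if s: "s \<in> S" for s
  proof -
    have "floor (x s / e) = floor (y s / e)" using xy(4) s by (metis f_def restrict_apply')
    then have "\<bar>y s / e - x s / e\<bar> \<le> 1" by linarith
    then have "\<bar>y s - x s\<bar> / e \<le> 1" using e by (simp add: diff_divide_distrib[symmetric])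
    then show ?thesis using e by (simp add: divide_le_eq)
  qed
  then have "norm1 (y - x) \<le> real (card S) * e"
    unfolding norm1_def by (intro sum_bounded_above) auto
  also have "\<dots> \<le> d" using d by (simp add: e_def divide_le_eq mult.commute)
  finally show ?thesis using xy by blast
qed

end

context fin_coxeter
begin

text \<open>Evaluating both reflections at \<open>x\<close> shows that \<open>x\<close> is a
  multiple of \<open>y\<close>; normalisation leaves a sign, which positivity decides.\<close>

lemma posroot_eq_if_reflect_eq:
  assumes x: "x \<in> posroots" and y: "y \<in> posroots" and eq: "\<And>z. reflect x z = reflect y z"
  shows "x = y"
proof -
  have n: "bil x x = 1" "bil y y = 1" using x y by (simp_all add: root_norm posroot_root)
  have "- x = reflect y x" using eq[of x] reflect_self[OF n(1)] by simp
  then have "2 *\<^sub>v x = (2 * bil x y) *\<^sub>v y"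
    by (simp add: reflect_def fun_eq_iff)
  then have xy: "x = bil x y *\<^sub>v y" by (simp add: fun_eq_iff)
  then have "bil x x = bil x y * bil x y" using n(2) by (metis bil_scl_right)
  then have "bil x y = 1 \<or> bil x y = - 1" using n(1) by (simp add: square_eq_1_iff)
  then show ?thesis
  proof
    assume "bil x y = - 1"
    then have "x = - y" using xy by (simp add: fun_eq_iff)
    then show ?thesis using x y posroot_uminus by blast
  qed (use xy in \<open>simp add: fun_eq_iff\<close>)
qed

text \<open>The product of two reflections in roots that are very close to each other moves every simple
  root so little that its image has positive height; such a product must be trivial.\<close>

lemma finite_posroots_height_le: "finite {x \<in> posroots. height x \<le> M}"
proof (rule ccontr)
  define A where "A = {x \<in> posroots. height x \<le> M}"
  define K where "K = max M 1"
  assume "infinite {x \<in> posroots. height x \<le> M}"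
  then have inf: "infinite A" by (simp add: A_def)
  have K: "1 \<le> K" "M \<le> K" by (simp_all add: K_def)
  \<comment> \<open>\<open>d * (4 K + 4 K^3)\<close> bounds the sum of the three error terms in the
    height of the image below; it is less than \<open>1\<close>, the height of a simple
    root.\<close>
  define d where "d = 1 / (4 * K + 4 * K * K * K + 1)"
  have den: "0 < 4 * K + 4 * K * K * K + 1" using K by (simp add: add_pos_pos)
  have d: "0 < d" "d * (4 * K + 4 * K * K * K) < 1"
    using den by (simp_all add: d_def field_simps)
  obtain x y where xy: "x \<in> A" "y \<in> A" "x \<noteq> y" and close: "norm1 (y - x) \<le> d"
  proof -
    have "is_nonneg x" "height x \<le> M" "i \<notin> S \<Longrightarrow> x i = 0" if "x \<in> A" for x i
      using that by (simp_all add: A_def posroots_def) (rule root_outside, blast)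
    then show thesis using close_pair[OF inf d(1), of M] that by blast
  qed
  have x: "x \<in> posroots" and y: "y \<in> posroots" using xy by (auto simp: A_def)
  have nx: "norm1 x \<le> K" and ny: "norm1 y \<le> K"
    using xy K by (auto simp: A_def norm1_of_nonneg posroot_nonneg)
  define z where "z = y - x"
  have y_eq: "y = x + z" by (simp add: z_def)
  obtain r r' where r: "r \<in> carrier W" "\<And>u. rho r u = reflect x u"
    and r': "r' \<in> carrier W" "\<And>u. rho r' u = reflect y u"
    using root_reflection x y posroot_root by meson
  have bx: "bil x x = 1" using x by (simp add: root_norm posroot_root)
  have "r \<otimes> r' = \<one>"
  proof (rule eq_one_if_positive)
    fix s assume s: "s \<in> S"
    let ?u = "rho (r \<otimes> r') (unit_vec s)"
    let ?e = "unit_vec s"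
    \<comment> \<open>Expansion in the small vector \<open>z\<close>: every term except
      \<open>?e\<close> carries a factor \<open>z\<close>, since for \<open>z = 0\<close> the two
      reflections cancel.\<close>
    have u: "?u = ?e + (2 * bil ?e z) *\<^sub>v x - (2 * bil ?e y) *\<^sub>v z + (4 * bil ?e y * bil z x) *\<^sub>v x"
    proof -
      have "?u = reflect x (reflect y ?e)" using r r' by (simp add: rho_mult)
      also have "\<dots> = ?e + (2 * bil ?e z) *\<^sub>v x - (2 * bil ?e y) *\<^sub>v z + (4 * bil ?e y * bil z x) *\<^sub>v x"
        by (simp add: reflect_def y_eq bil_simps bx fun_eq_iff algebra_simps)
      finally show ?thesis .
    qed
    have h: "height ?u = 1 + 2 * bil ?e z * height x - 2 * bil ?e y * height z
        + 4 * bil ?e y * bil z x * height x"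
      unfolding u by (simp add: height_add height_diff height_scl height_unit s)
    note ab = abs_bil_le[of _ _, OF abs_gram_le]
    have nz: "norm1 z \<le> d" using close by (simp add: z_def)
    have e: "norm1 ?e = 1" using s by (rule norm1_unit)
    have b1: "\<bar>bil ?e z\<bar> \<le> d" using ab[of ?e z] e nz by simp
    have b2: "\<bar>bil ?e y\<bar> \<le> K" using ab[of ?e y] e ny by simp
    have b3: "\<bar>bil z x\<bar> \<le> d * K"
      using ab[of z x] mult_mono[OF nz nx] norm1_nonneg[of x] d(1) by linarith
    have b4: "\<bar>height x\<bar> \<le> K" "\<bar>height z\<bar> \<le> d"
      using abs_height_le[of x] abs_height_le[of z] nx nz by linarith+
    have "\<bar>bil ?e z * height x\<bar> \<le> d * K"
      unfolding abs_mult using b1 b4 d by (intro mult_mono) auto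
    moreover have "\<bar>bil ?e y * height z\<bar> \<le> K * d"
      unfolding abs_mult using b2 b4 K by (intro mult_mono) auto
    moreover have "\<bar>bil ?e y * bil z x * height x\<bar> \<le> K * (d * K) * K"
      unfolding abs_mult using b2 b3 b4 K d by (intro mult_mono) auto
    moreover have "2 * (d * K) + 2 * (K * d) + 4 * (K * (d * K) * K) < 1"
      using d(2) by (simp add: algebra_simps)
    ultimately have "0 < height ?u" unfolding h by linarith
    moreover have "?u \<in> roots"
      using r r' s by (simp add: rho_root posroot_root unit_root)
    ultimately show "?u \<in> posroots"
      using root_cases[of ?u] height_nonneg[of "- ?u"] by (auto simp: height_uminus posroot_nonneg)
  qed (use r r' in simp)
  then have "rho r (rho r' u) = u" for u using r r' by (metis rho_mult rho_one)
  then have "reflect x u = reflect y u" for u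
    using r r' bx by (metis reflect_reflect)
  then show False using posroot_eq_if_reflect_eq[OF x y] xy(3) by blast
qed

lemma finite_roots_height_le: "finite {z \<in> roots. \<bar>height z\<bar> \<le> K}"
proof (rule finite_subset)
  show "{z \<in> roots. \<bar>height z\<bar> \<le> K} \<subseteq> {z \<in> posroots. height z \<le> K} \<union> uminus ` {z \<in> posroots. height z \<le> K}"
  proof
    fix z assume z: "z \<in> {z \<in> roots. \<bar>height z\<bar> \<le> K}"
    then consider "z \<in> posroots" | "- z \<in> posroots" using root_cases by blast
    then show "z \<in> {z \<in> posroots. height z \<le> K} \<union> uminus ` {z \<in> posroots. height z \<le> K}"
    proof cases
      case 2
      have "z = - (- z)" by simp
      moreover have "height (- z) \<le> K" using z by (simp add: height_uminus abs_le_iff)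
      ultimately show ?thesis using 2 by blast
    qed (use z in auto)
  qed
qed (intro finite_UnI finite_imageI finite_posroots_height_le)

text \<open>Along a word that makes \<open>x\<close> negative, consider the letter at which this
  first happens. If the image of \<open>y\<close> is negative just before, changing its sign gives
  the pair. Otherwise the image of \<open>x\<close> is the simple root of that letter, and the image
  of \<open>y\<close>, being different, stays positive when the letter acts.\<close>

lemma flip_sign:
  assumes x: "x \<in> posroots" and y: "y \<in> posroots" and ne: "x \<noteq> y"
  shows "\<exists>x'\<in>posroots. \<exists>y'\<in>posroots. bil x' y' = - bil x y"
proof -
  have main: "- rho w x \<in> posroots \<longrightarrow> (\<exists>x'\<in>posroots. \<exists>y'\<in>posroots. bil x' y' = - bil x y)"
    if "w \<in> carrier W" for w
    using that
  proof (induction w rule: rho_induct)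
    case one
    then show ?case using posroot_uminus[OF x] by (simp only: rho_one simp_thms)
  next
    case (step s w)
    have wr: "rho w x \<in> roots" "rho w y \<in> roots"
      using x y step by (simp_all add: rho_root posroot_root)
    consider "- rho w x \<in> posroots" | "rho w x \<in> posroots" "- rho w y \<in> posroots"
      | "rho w x \<in> posroots" "rho w y \<in> posroots"
      using root_cases wr by blast
    then show ?case
    proof cases
      case 2
      then have "bil (rho w x) (- rho w y) = - bil x y" using step by (simp add: bil_simps bil_rho)
      then show ?thesis using 2 by blast
    next
      case 3
      show ?thesis
      proof
        assume neg: "- rho (s \<otimes> w) x \<in> posroots"
        have "rho s (rho w x) \<notin> posroots"
          using neg posroot_uminus step by (auto simp: rho_mult gens_closed)
        then have "rho w x = unit_vec s" using simple_reflection_pos 3 step by blast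
        moreover have "rho w x \<noteq> rho w y" using ne step by (metis rho_inv_left)
        ultimately have "rho s (rho w y) \<in> posroots" using simple_reflection_pos 3 step by metis
        moreover have "bil (- rho (s \<otimes> w) x) (rho s (rho w y)) = - bil x y"
          using step by (simp add: bil_simps bil_rho rho_mult gens_closed)
        ultimately show "\<exists>x'\<in>posroots. \<exists>y'\<in>posroots. bil x' y' = - bil x y" using neg by blast
      qed
    qed (use step in blast)
  qed
  obtain v s where vs: "v \<in> carrier W" "s \<in> S" "x = rho v (unit_vec s)"
    using posroot_root[OF x] by (auto simp: roots_def)
  have "rho (s \<otimes> inv v) x = - unit_vec s"
    using vs by (simp add: rho_mult gens_closed rho_gen reflect_self unit_norm)
  then show ?thesis
    using main[of "s \<otimes> inv v"] vs unit_root by (simp add: gens_closed)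
qed

text \<open>\<open>flip_sign\<close> turns the lower bound for distinct positive roots into an upper
  bound; passing to negative roots only changes signs.\<close>

lemma abs_bil_root_le:
  assumes "\<And>x y. x \<in> posroots \<Longrightarrow> y \<in> posroots \<Longrightarrow> - 1 \<le> bil x y"
    and "x \<in> roots" "y \<in> roots"
  shows "\<bar>bil x y\<bar> \<le> 1"
proof -
  have pos: "\<bar>bil x y\<bar> \<le> 1" if "x \<in> posroots" "y \<in> posroots" for x y
  proof (cases "x = y")
    case True
    then show ?thesis using that by (simp add: root_norm posroot_root)
  next
    case False
    then show ?thesis using flip_sign[OF that] assms(1)[OF that] assms(1) by force
  qed
  have "\<bar>bil x y\<bar> \<le> 1" if "x \<in> posroots" "y \<in> roots" for x y
    using root_cases[OF that(2)] pos[OF that(1), of y] pos[OF that(1), of "- y"]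
    by (auto simp: bil_simps)
  then show ?thesis
    using root_cases[OF assms(2)] assms(3)
    by (metis abs_minus_cancel bil_uminus_left)
qed

end

subsection \<open>Pairs of roots spanning a generic hyperbolic plane\<close>

context fin_coxeter
begin

text \<open>\<open>v\<close> certifies that the plane is usable: a vector of negative norm in the
  cone of the two roots and in the negative of the closed fundamental chamber. It is kept as an
  argument so that its support can be enlarged.\<close>

definition good_pair :: "('a \<Rightarrow> real) \<Rightarrow> ('a \<Rightarrow> real) \<Rightarrow> ('a \<Rightarrow> real) \<Rightarrow> bool"
  where "good_pair x y v \<longleftrightarrow> x \<in> posroots \<and> y \<in> posroots \<and>
    (\<exists>a b. 0 \<le> a \<and> 0 \<le> b \<and> v = a *\<^sub>v x + b *\<^sub>v y) \<and>
    (\<forall>s\<in>S. bil v (unit_vec s) \<le> 0) \<and> bil v v < 0"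

lemma good_pair_nonpos: "good_pair x y v \<Longrightarrow> is_nonneg z \<Longrightarrow> bil v z \<le> 0"
  by (rule bil_nonpos_of_nonneg) (auto simp: good_pair_def)

text \<open>The inequality \<open>a^2 + b^2 < 2 a b c\<close> forces \<open>a, b > 0\<close> and,
  against \<open>2 a b <= a^2 + b^2\<close>, also \<open>c > 1\<close>. The bounds relating
  \<open>a\<close> and \<open>b\<close> are the chamber condition tested on \<open>x\<close> and
  \<open>y\<close>.\<close>

lemma good_pairD:
  assumes "good_pair x y v"
  obtains a b c where "0 < a" "0 < b" "v = a *\<^sub>v x + b *\<^sub>v y" "bil x y = - c" "1 < c"
    "a \<le> b * c" "b \<le> a * c" "bil x x = 1" "bil y y = 1" "x \<in> posroots" "y \<in> posroots"
proof -
  from assms obtain a b where ab: "0 \<le> a" "0 \<le> b" "v = a *\<^sub>v x + b *\<^sub>v y"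
    and xy: "x \<in> posroots" "y \<in> posroots" and neg: "bil v v < 0" by (auto simp: good_pair_def)
  define c where "c = - bil x y"
  have n: "bil x x = 1" "bil y y = 1" using xy by (simp_all add: root_norm posroot_root)
  have q: "a\<^sup>2 + b\<^sup>2 - 2 * (a * b * c) < 0"
    using neg unfolding ab(3)
    by (simp add: bil_simps n bil_sym[of y x] c_def power2_eq_square algebra_simps)
  have "a \<noteq> 0" "b \<noteq> 0" using q zero_le_power2[of a] zero_le_power2[of b] by auto
  then have ab': "0 < a" "0 < b" using ab by auto
  have "1 < c"
  proof (rule ccontr)
    assume "\<not> 1 < c"
    then have "a * b * c \<le> a * b" using ab' by (simp add: mult_left_le)
    moreover have "0 \<le> a\<^sup>2 + b\<^sup>2 - 2 * (a * b)"
      using zero_le_power2[of "a - b"] by (simp add: power2_eq_square algebra_simps)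
    ultimately show False using q by linarith
  qed
  moreover have "bil v x \<le> 0" "bil v y \<le> 0"
    using good_pair_nonpos[OF assms] xy posroot_nonneg by blast+
  then have "a \<le> b * c" "b \<le> a * c"
    unfolding ab(3) by (simp_all add: bil_simps n bil_sym[of y x] c_def)
  ultimately show thesis using that[of a b c] ab' ab n xy by (simp add: c_def)
qed

text \<open>A pair of positive roots with form value less than \<open>-1\<close> and minimal total height spans a
  plane meeting the (negative of the) fundamental chamber.\<close>

lemma good_pair_exists:
  assumes "x \<in> posroots" "y \<in> posroots" "bil x y < - 1"
  shows "\<exists>x y v. good_pair x y v"
proof -
  define P where "P = {(x, y). x \<in> posroots \<and> y \<in> posroots \<and> bil x y < - 1}"
  define h where "h p = height (fst p) + height (snd p)" for p :: "('a \<Rightarrow> real) \<times> ('a \<Rightarrow> real)"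
  \<comment> \<open>Pairs no taller than the given one: a finite set, so a pair of minimal total
    height exists.\<close>
  define Q where "Q = {p \<in> P. h p \<le> h (x, y)}"
  have pos: "0 \<le> height z" if "z \<in> posroots" for z using that by (simp add: height_nonneg posroot_nonneg)
  have "Q \<subseteq> {z \<in> posroots. height z \<le> h (x, y)} \<times> {z \<in> posroots. height z \<le> h (x, y)}"
    using pos by (fastforce simp: Q_def P_def h_def)
  then have "finite Q"
    by (rule finite_subset) (intro finite_cartesian_product finite_posroots_height_le)
  moreover have "(x, y) \<in> Q" using assms by (simp add: Q_def P_def)
  ultimately obtain p where p: "p \<in> Q" "\<And>q. q \<in> Q \<Longrightarrow> \<not> h q < h p"
    using ex_is_arg_min_if_finite[of Q h] by (auto simp: is_arg_min_def)
  obtain u v where uv: "p = (u, v)" by (cases p)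
  have u: "u \<in> posroots" "v \<in> posroots" "bil u v < - 1" using p(1) uv by (auto simp: Q_def P_def)
  have n: "bil u u = 1" "bil v v = 1" using u by (simp_all add: root_norm posroot_root)
  have "bil (u + v) (unit_vec s) \<le> 0" if s: "s \<in> S" for s
  proof (rule ccontr)
    assume "\<not> ?thesis"
    then have gt: "0 < bil u (unit_vec s) + bil v (unit_vec s)" by (simp add: bil_simps)
    \<comment> \<open>If one of them were the simple root, the sum in \<open>gt\<close> would be
      \<open>1 + bil u v < 0\<close>.\<close>
    have "u \<noteq> unit_vec s" "v \<noteq> unit_vec s"
      using gt u(3) n by (auto simp: bil_sym[of u "unit_vec s"] bil_sym[of v "unit_vec s"])
    then have r: "rho s u \<in> posroots" "rho s v \<in> posroots"
      using simple_reflection_pos u s by blast+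
    have "bil (rho s u) (rho s v) < - 1" using u(3) s by (simp add: bil_rho gens_closed)
    moreover have hr: "h (rho s u, rho s v) < h p"
      using gt by (simp add: h_def uv rho_gen s reflect_def height_diff height_scl height_unit)
    ultimately have "(rho s u, rho s v) \<in> Q" using r p(1) by (simp add: Q_def P_def)
    then show False using p(2) hr by blast
  qed
  moreover have "bil (u + v) (u + v) < 0" using u(3) n by (simp add: bil_simps bil_sym[of v u])
  moreover have "u + v = 1 *\<^sub>v u + 1 *\<^sub>v v" by (simp add: fun_eq_iff)
  ultimately have "good_pair u v (u + v)"
    unfolding good_pair_def using u zero_le_one by blast
  then show ?thesis by blast
qed

text \<open>The orbit of a simple root \<open>s\<close> under the dihedral group of the plane contains roots
  \<open>s + p x + q y\<close> whose planar parts grow towards either isotropic line, so a vector of the plane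
  with nonpositive form values on \<open>x\<close> and \<open>y\<close> lies between two such planar parts.\<close>

lemma orbit_growth:
  assumes x: "x \<in> roots" and y: "y \<in> roots" and e: "e \<in> roots"
    and c: "bil x y = - c" "1 < c"
    and p0: "bil x e = - p0" "0 \<le> p0" and q0: "bil y e = - q0" "0 \<le> q0" and pq: "0 < p0 + q0"
  shows "\<exists>p q p' q'. e + p *\<^sub>v x + q *\<^sub>v y \<in> roots \<and> e + p' *\<^sub>v x + q' *\<^sub>v y \<in> roots
    \<and> 0 \<le> q \<and> 0 \<le> p' \<and> c * q \<le> p \<and> c * p' \<le> q' \<and> M \<le> p \<and> M \<le> q'"
proof -
  \<comment> \<open>Dominance of one coefficient with ratio at least \<open>c\<close>. Reflecting in
    the root with the smaller coefficient exchanges the two kinds and multiplies the lower bound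
    \<open>K\<close> by \<open>c\<close>, so alternating reflections give geometric growth.\<close>
  define typX where "typX K \<longleftrightarrow> (\<exists>p q. e + p *\<^sub>v x + q *\<^sub>v y \<in> roots \<and> 0 \<le> q \<and> c * q \<le> p \<and> K \<le> p)" for K
  define typY where "typY K \<longleftrightarrow> (\<exists>p q. e + p *\<^sub>v x + q *\<^sub>v y \<in> roots \<and> 0 \<le> p \<and> c * p \<le> q \<and> K \<le> q)" for K
  have n: "bil x x = 1" "bil y y = 1" using x y by (simp_all add: root_norm)
  have s: "bil y x = - c" "bil e x = - p0" "bil e y = - q0"
    using c p0 q0 by (simp_all add: bil_sym[of y x] bil_sym[of e])
  have rx: "reflect x (e + p *\<^sub>v x + q *\<^sub>v y) = e + (2 * p0 - p + 2 * c * q) *\<^sub>v x + q *\<^sub>v y" for p q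
    by (simp add: reflect_def bil_simps n s fun_eq_iff algebra_simps)
  have ry: "reflect y (e + p *\<^sub>v x + q *\<^sub>v y) = e + p *\<^sub>v x + (2 * q0 - q + 2 * c * p) *\<^sub>v y" for p q
    by (simp add: reflect_def bil_simps n s c fun_eq_iff algebra_simps)
  have key: "c * u \<le> 2 * w - v + 2 * c * u" if "0 \<le> v" "c * v \<le> u" "0 \<le> w" for u v w
  proof -
    have "1 * v \<le> c * v" using that c by (intro mult_right_mono) auto
    then have "v \<le> u" "0 \<le> u" using that by linarith+
    moreover have "1 * u \<le> c * u" using \<open>0 \<le> u\<close> c by (intro mult_right_mono) auto
    ultimately show ?thesis using that by linarith
  qed
  have XY: "typY (c * K)" if X: "typX K" for K
  proof -
    obtain p q where pq: "e + p *\<^sub>v x + q *\<^sub>v y \<in> roots" "0 \<le> q" "c * q \<le> p" "K \<le> p"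
      using X by (auto simp: typX_def)
    have "0 \<le> c * q" using pq c by simp
    then have "0 \<le> p" using pq by linarith
    moreover have "c * K \<le> c * p" using pq c by simp
    moreover have "e + p *\<^sub>v x + (2 * q0 - q + 2 * c * p) *\<^sub>v y \<in> roots"
      using reflect_root[OF y pq(1)] by (simp only: ry)
    ultimately show ?thesis unfolding typY_def using key[OF pq(2,3) q0(2)] order_trans by blast
  qed
  have YX: "typX (c * K)" if Y: "typY K" for K
  proof -
    obtain p q where pq: "e + p *\<^sub>v x + q *\<^sub>v y \<in> roots" "0 \<le> p" "c * p \<le> q" "K \<le> q"
      using Y by (auto simp: typY_def)
    have "0 \<le> c * p" using pq c by simp
    then have "0 \<le> q" using pq by linarith
    moreover have "c * K \<le> c * q" using pq c by simp
    moreover have "e + (2 * p0 - p + 2 * c * q) *\<^sub>v x + q *\<^sub>v y \<in> roots"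
      using reflect_root[OF x pq(1)] by (simp only: rx)
    ultimately show ?thesis unfolding typX_def using key[OF pq(2,3) p0(2)] order_trans by blast
  qed
  have e0: "e + 0 *\<^sub>v x + 0 *\<^sub>v y \<in> roots" using e by (simp add: scl_def plus_fun_def)
  have "\<exists>K>0. typX K"
  proof (cases "0 < p0")
    case True
    have "typX (2 * p0)" unfolding typX_def
      using reflect_root[OF x e0] p0 by (intro exI[of _ "2 * p0"] exI[of _ 0]) (simp only: rx, simp)
    then show ?thesis using True by (intro exI[of _ "2 * p0"]) simp
  next
    case False
    then have q: "0 < q0" using p0 pq by linarith
    have "typY (2 * q0)" unfolding typY_def
      using reflect_root[OF y e0] q0 by (intro exI[of _ "2 * q0"] exI[of _ 0]) (simp only: ry, simp)
    then have "typX (c * (2 * q0))" by (rule YX)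
    then show ?thesis using q c by (intro exI[of _ "c * (2 * q0)"]) simp
  qed
  then obtain K where K: "0 < K" "typX K" by blast
  have grow: "typX (c ^ (2 * n) * K)" for n
  proof (induction n)
    case (Suc n)
    have "c ^ (2 * Suc n) * K = c * (c * (c ^ (2 * n) * K))" by simp
    then show ?case using YX[OF XY[OF Suc]] by metis
  qed (use K in simp)
  obtain n where n: "\<bar>M\<bar> / K < c ^ n" using real_arch_pow[OF c(2)] by blast
  have M: "\<bar>M\<bar> \<le> c ^ (2 * n) * K"
  proof -
    have "c ^ n \<le> c ^ (2 * n)" using c by (intro power_increasing) auto
    then have "\<bar>M\<bar> / K \<le> c ^ (2 * n)" using n by linarith
    then show ?thesis using K by (simp add: divide_le_eq)
  qed
  have M2: "\<bar>M\<bar> \<le> c * (c ^ (2 * n) * K)"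
  proof -
    have "1 * (c ^ (2 * n) * K) \<le> c * (c ^ (2 * n) * K)" using c K by (intro mult_right_mono) auto
    then show ?thesis using M by linarith
  qed
  obtain p q where 1: "e + p *\<^sub>v x + q *\<^sub>v y \<in> roots" "0 \<le> q" "c * q \<le> p" "c ^ (2 * n) * K \<le> p"
    using grow[of n] by (auto simp: typX_def)
  obtain p' q' where 2: "e + p' *\<^sub>v x + q' *\<^sub>v y \<in> roots" "0 \<le> p'" "c * p' \<le> q'"
      "c * (c ^ (2 * n) * K) \<le> q'"
    using XY[OF grow[of n]] by (auto simp: typY_def)
  have "M \<le> p" "M \<le> q'" using 1(4) 2(4) M M2 by linarith+
  then show ?thesis using 1 2 by blast
qed

text \<open>The two roots from \<open>orbit_growth\<close> have coordinate \<open>1\<close> at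
  \<open>s\<close>, hence are positive. As \<open>v\<close> is a combination of their planar parts
  with coefficients \<mu>, \<nu> >= 0, the vector \<open>v + (\<mu> + \<nu>) e_s\<close> lies in
  their cone. It meets the chamber and norm conditions once \<open>r = \<mu> + \<nu>\<close> is
  below \<open>d = - bil v e_s\<close>, which is why the orbit has to grow.\<close>

lemma good_pair_extend:
  assumes g: "good_pair x y v" and s: "s \<in> S" and v0: "v s = 0" and vs: "bil v (unit_vec s) < 0"
  shows "\<exists>x' y' r. 0 < r \<and> good_pair x' y' (v + r *\<^sub>v unit_vec s)"
proof -
  from g obtain a b c where ab: "0 < a" "0 < b" "v = a *\<^sub>v x + b *\<^sub>v y"
    and c: "bil x y = - c" "1 < c" and abc: "a \<le> b * c" "b \<le> a * c"
    and xy: "x \<in> posroots" "y \<in> posroots" using good_pairD by metis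
  let ?e = "unit_vec s"
  have nn: "0 \<le> x i" "0 \<le> y i" for i using xy posroot_nonneg by (auto simp: is_nonneg_def)
  have "a * x s + b * y s = 0" using v0 by (simp add: ab(3))
  moreover have "0 \<le> a * x s" "0 \<le> b * y s" using ab nn by simp_all
  ultimately have "a * x s = 0" "b * y s = 0" by linarith+
  then have zero: "x s = 0" "y s = 0" using ab by auto
  have neg: "bil z ?e \<le> 0" if "\<And>i. 0 \<le> z i" "z s = 0" for z
    unfolding bil_unit_right[OF s]
    using that gram_nonpos[OF _ s] by (intro sum_nonpos) (metis mult_nonneg_nonpos mult_zero_left order_refl)
  define p0 q0 where "p0 = - bil x ?e" and "q0 = - bil y ?e"
  have pq0: "0 \<le> p0" "0 \<le> q0" using neg nn zero by (simp_all add: p0_def q0_def)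
  define d where "d = - bil v ?e"
  have d: "d = a * p0 + b * q0" "0 < d" using vs by (simp_all add: d_def ab(3) bil_simps p0_def q0_def)
  then have "0 < p0 + q0" using pq0 by (cases "p0 = 0"; cases "q0 = 0") auto
  \<comment> \<open>Comparing coefficients will give \<open>r * M <= a + b\<close>, and this
    \<open>M\<close> then forces \<open>r < d\<close>.\<close>
  define M where "M = (a + b) / d + 1"
  have M: "0 < M" using ab d by (simp add: M_def add_nonneg_pos)
  obtain p q p' q' where x': "?e + p *\<^sub>v x + q *\<^sub>v y \<in> roots"
    and y': "?e + p' *\<^sub>v x + q' *\<^sub>v y \<in> roots"
    and pq: "0 \<le> q" "0 \<le> p'" "c * q \<le> p" "c * p' \<le> q'" "M \<le> p" "M \<le> q'"
    using orbit_growth[of x y ?e c p0 q0 M] xy posroot_root unit_root[OF s] c pq0 \<open>0 < p0 + q0\<close>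
    by (auto simp: p0_def q0_def)
  \<comment> \<open>The determinant of the two planar parts; it is positive because they lie in
    opposite dominance sectors of ratio \<open>c > 1\<close>.\<close>
  define D where "D = p * q' - p' * q"
  have pp: "0 < p" "0 < q'" using pq M by linarith+
  have "0 < D"
  proof -
    have "p' * q \<le> (q' / c) * (p / c)"
      using pq c pp by (intro mult_mono) (simp_all add: pos_le_divide_eq mult.commute)
    also have "\<dots> = (p * q') / (c * c)" by simp
    also have "\<dots> < p * q'"
    proof -
      have "1 < c * c" using c by (simp add: less_1_mult)
      then show ?thesis using pp by (simp add: divide_less_eq)
    qed
    finally show ?thesis by (simp add: D_def)
  qed
  \<comment> \<open>Cramer's rule for writing \<open>(a, b)\<close> in terms of
    \<open>(p, q)\<close> and \<open>(p', q')\<close>.\<close>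
  define \<mu> \<nu> where "\<mu> = (a * q' - b * p') / D" and "\<nu> = (b * p - a * q) / D"
  have "b * p' \<le> a * q'"
  proof -
    have "b * p' \<le> (a * c) * p'" using abc pq by (intro mult_right_mono) auto
    also have "\<dots> \<le> a * q'" using pq ab by (simp add: mult.assoc)
    finally show ?thesis .
  qed
  then have \<mu>: "0 \<le> \<mu>" using \<open>0 < D\<close> by (simp add: \<mu>_def)
  have "a * q \<le> b * p"
  proof -
    have "a * q \<le> (b * c) * q" using abc pq by (intro mult_right_mono) auto
    also have "\<dots> \<le> b * p" using pq ab by (simp add: mult.assoc)
    finally show ?thesis .
  qed
  then have \<nu>: "0 \<le> \<nu>" using \<open>0 < D\<close> by (simp add: \<nu>_def)
  have solve: "\<mu> * p + \<nu> * p' = a" "\<mu> * q + \<nu> * q' = b"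
  proof -
    have "\<mu> * p + \<nu> * p' = ((a * q' - b * p') * p + (b * p - a * q) * p') / D"
      by (simp add: \<mu>_def \<nu>_def add_divide_distrib)
    also have "(a * q' - b * p') * p + (b * p - a * q) * p' = a * D" by (simp add: D_def algebra_simps)
    finally show "\<mu> * p + \<nu> * p' = a" using \<open>0 < D\<close> by simp
    have "\<mu> * q + \<nu> * q' = ((a * q' - b * p') * q + (b * p - a * q) * q') / D"
      by (simp add: \<mu>_def \<nu>_def add_divide_distrib)
    also have "(a * q' - b * p') * q + (b * p - a * q) * q' = b * D" by (simp add: D_def algebra_simps)
    finally show "\<mu> * q + \<nu> * q' = b" using \<open>0 < D\<close> by simp
  qed
  define r where "r = \<mu> + \<nu>"
  have "0 < r"
  proof -
    have "\<mu> \<noteq> 0 \<or> \<nu> \<noteq> 0" using solve(1) ab by auto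
    then show ?thesis using \<mu> \<nu> by (auto simp: r_def)
  qed
  have "r < d"
  proof -
    have "\<mu> * M + \<nu> * M \<le> \<mu> * p + \<nu> * q'" using \<mu> \<nu> pq by (intro add_mono mult_left_mono) auto
    moreover have "0 \<le> \<nu> * p'" "0 \<le> \<mu> * q" using \<mu> \<nu> pq by simp_all
    ultimately have "r * M \<le> a + b" using solve by (simp add: r_def distrib_right)
    moreover have "d * ((a + b) / d) = a + b" using d(2) by simp
    then have "d * M = a + b + d" unfolding M_def by (subst distrib_left) simp
    then have "a + b < d * M" using d(2) by linarith
    ultimately show ?thesis using M mult_less_cancel_right_pos[of M r d] by linarith
  qed
  define x1 y1 where "x1 = ?e + p *\<^sub>v x + q *\<^sub>v y" and "y1 = ?e + p' *\<^sub>v x + q' *\<^sub>v y"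
  have "x1 s = 1" "y1 s = 1" by (simp_all add: x1_def y1_def zero unit_vec_def)
  then have pos: "x1 \<in> posroots" "y1 \<in> posroots"
    using x' y' root_posI[of _ s] by (simp_all add: x1_def y1_def)
  let ?v = "v + r *\<^sub>v ?e"
  have "?v = \<mu> *\<^sub>v x1 + \<nu> *\<^sub>v y1"
    unfolding ab(3) r_def x1_def y1_def solve[symmetric] by (simp add: fun_eq_iff algebra_simps)
  moreover have "bil ?v (unit_vec t) \<le> 0" if t: "t \<in> S" for t
  proof (cases "t = s")
    case True
    then show ?thesis using \<open>r < d\<close> s by (simp add: bil_simps unit_norm d_def)
  next
    case False
    have "bil v (unit_vec t) \<le> 0" using g t by (simp add: good_pair_def)
    moreover have "r * gram s t \<le> 0" using \<open>0 < r\<close> gram_nonpos[OF s t] False by (simp add: mult_nonneg_nonpos)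
    ultimately show ?thesis using s t by (simp add: bil_simps bil_unit_unit)
  qed
  moreover have "bil ?v ?v < 0"
  proof -
    have "bil ?v ?v = bil v v - 2 * (r * d) + r * r"
      using s by (simp add: bil_simps unit_norm bil_sym[of ?e v] d_def algebra_simps)
    moreover have "r * r < r * d" using \<open>0 < r\<close> \<open>r < d\<close> by simp
    moreover have "0 < r * d" using \<open>0 < r\<close> d by simp
    moreover have "bil v v < 0" using g by (simp add: good_pair_def)
    ultimately show ?thesis by linarith
  qed
  ultimately have "good_pair x1 y1 ?v" unfolding good_pair_def using pos \<mu> \<nu> by blast
  then show ?thesis using \<open>0 < r\<close> by blast
qed

end

section \<open>Consequences of irreducibility\<close>

locale irred_coxeter = fin_coxeter +
  assumes connected: "s \<in> S \<Longrightarrow> t \<in> S \<Longrightarrow> (s, t) \<in> (coxeter_graph W S)\<^sup>*"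
begin

lemma edge_leaving:
  assumes "s \<in> A" "A \<subseteq> S" "t \<in> S - A"
  shows "\<exists>u\<in>A. \<exists>v\<in>S - A. (u, v) \<in> coxeter_graph W S"
proof (rule ccontr)
  assume no: "\<not> ?thesis"
  have "(s, t) \<in> (coxeter_graph W S)\<^sup>*" using assms connected by auto
  then have "t \<in> A"
  proof induction
    case (step y z)
    then have "z \<in> S" by (auto simp: coxeter_graph_def)
    then show ?case using step no by blast
  qed (use assms in simp)
  then show False using assms by simp
qed

text \<open>Take \<open>v\<close> of maximal support. If a vertex is missing, connectedness gives an
  edge from the support to some \<open>z\<close> outside; that edge makes \<open>bil v e_z\<close>
  strictly negative, so \<open>good_pair_extend\<close> would enlarge the support.\<close>

lemma good_pair_full_support:
  assumes "good_pair x y v"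
  shows "\<exists>x y v. good_pair x y v \<and> (\<forall>s\<in>S. 0 < v s)"
proof -
  define P where "P v \<longleftrightarrow> (\<exists>x y. good_pair x y v)" for v
  define supp where "supp v = {s \<in> S. 0 < v s}" for v :: "'a \<Rightarrow> real"
  have "P v" using assms by (auto simp: P_def)
  moreover have "\<forall>v. P v \<longrightarrow> card (supp v) < Suc (card S)"
    using finite_gens by (auto simp: supp_def less_Suc_eq_le intro!: card_mono)
  ultimately obtain v where v: "P v" and max: "\<And>u. P u \<Longrightarrow> card (supp u) \<le> card (supp v)"
    using ex_has_greatest_nat[of P v "\<lambda>v. card (supp v)"] by blast
  obtain x y where g: "good_pair x y v" using v by (auto simp: P_def)
  have nn: "0 \<le> v i" for i
    using g posroot_nonneg is_nonneg_comb unfolding good_pair_def is_nonneg_def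
    by (smt (verit, best) plus_fun_apply scl_apply mult_nonneg_nonneg)
  have out: "v i = 0" if "i \<in> S" "i \<notin> supp v" for i
    using that nn[of i] by (auto simp: supp_def)
  have "supp v \<noteq> {}"
  proof
    assume "supp v = {}"
    then have "bil v v = 0" using out by (simp add: bil_def)
    then show False using g by (simp add: good_pair_def)
  qed
  moreover have "supp v = S"
  proof (rule ccontr)
    assume "supp v \<noteq> S"
    then obtain t where t: "t \<in> S - supp v" by (auto simp: supp_def)
    obtain s where "s \<in> supp v" using \<open>supp v \<noteq> {}\<close> by blast
    then obtain u z where uz: "u \<in> supp v" "z \<in> S - supp v" "(u, z) \<in> coxeter_graph W S"
      using edge_leaving[of s "supp v" t] t by (auto simp: supp_def)
    have u: "u \<in> S" "0 < v u" and z: "z \<in> S" using uz by (auto simp: supp_def)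
    have vz: "v z = 0" using out uz by blast
    have "bil v (unit_vec z) = v u * gram u z + (\<Sum>i\<in>S - {u}. v i * gram i z)"
      unfolding bil_unit_right[OF z] by (rule sum.remove[OF finite_gens u(1)])
    also have "(\<Sum>i\<in>S - {u}. v i * gram i z) \<le> 0"
    proof (rule sum_nonpos)
      fix i assume "i \<in> S - {u}"
      then show "v i * gram i z \<le> 0"
        using nn[of i] gram_nonpos[of i z] z vz by (cases "i = z") (auto simp: mult_nonneg_nonpos)
    qed
    moreover have "v u * gram u z < 0" using u gram_neg[OF uz(3)] by (simp add: mult_pos_neg)
    ultimately have "bil v (unit_vec z) < 0" by linarith
    then obtain x' y' r where r: "0 < r" "good_pair x' y' (v + r *\<^sub>v unit_vec z)"
      using good_pair_extend[OF g z vz] by blast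
    have "insert z (supp v) \<subseteq> supp (v + r *\<^sub>v unit_vec z)"
      using z vz r(1) by (auto simp: supp_def unit_vec_def)
    then have "card (insert z (supp v)) \<le> card (supp (v + r *\<^sub>v unit_vec z))"
      using finite_gens by (intro card_mono) (auto simp: supp_def)
    moreover have "card (insert z (supp v)) = Suc (card (supp v))"
      using uz finite_gens by (simp add: supp_def)
    moreover have "card (supp (v + r *\<^sub>v unit_vec z)) \<le> card (supp v)"
      using r(2) by (intro max) (auto simp: P_def)
    ultimately show False by linarith
  qed
  ultimately show ?thesis using g by (auto simp: supp_def)
qed

text \<open>The identity behind this bound is
  \<open>B(x,x) = \<Sum>\<^sub>i (x\<^sub>i\<^sup>2 / v\<^sub>i) (Bv)\<^sub>i - 1/2 \<Sum>\<^sub>i\<^sub>j B\<^sub>i\<^sub>j v\<^sub>i v\<^sub>j (x\<^sub>i / v\<^sub>i - x\<^sub>j / v\<^sub>j)\<^sup>2\<close>; its first sum vanishes here, so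
  the ratios \<open>x\<^sub>i / v\<^sub>i\<close> differ by a bounded amount along each edge of the Coxeter graph.\<close>

lemma finite_orthogonal_roots:
  assumes v: "\<And>s. s \<in> S \<Longrightarrow> 0 < v s" and neg: "\<And>s. s \<in> S \<Longrightarrow> bil v (unit_vec s) \<le> 0"
    and ne: "bil v v \<noteq> 0"
  shows "finite {x \<in> posroots. bil v x = 0}"
proof -
  define Z where "Z = {x \<in> posroots. bil v x = 0}"
  have nn: "0 \<le> x i" if "x \<in> Z" for x i
    using that posroot_nonneg by (auto simp: Z_def is_nonneg_def)
  \<comment> \<open>\<open>bil v x = 0\<close> is a sum of terms of one sign, so every term
    vanishes.\<close>
  have supp: "x s * bil v (unit_vec s) = 0" if x: "x \<in> Z" and s: "s \<in> S" for x s
  proof -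
    have "(\<Sum>t\<in>S. - (x t * bil v (unit_vec t))) = 0"
      using x by (simp add: Z_def bil_expand_right[of v x] sum_negf)
    moreover have "0 \<le> - (x t * bil v (unit_vec t))" if "t \<in> S" for t
      using nn[OF x] neg[OF that] by (simp add: mult_nonneg_nonpos)
    then have "(\<Sum>t\<in>S. - (x t * bil v (unit_vec t))) = 0
        \<longleftrightarrow> (\<forall>t\<in>S. - (x t * bil v (unit_vec t)) = 0)"
      by (rule sum_nonneg_eq_0_iff[OF finite_gens])
    ultimately show ?thesis using s by (metis neg_equal_0_iff_equal)
  qed
  \<comment> \<open>At \<open>k\<close> every root in \<open>Z\<close> has coordinate
    \<open>0\<close>; this starts the walk along the graph that bounds all other
    coordinates.\<close>
  obtain k where k: "k \<in> S" "bil v (unit_vec k) \<noteq> 0"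
    using ne unfolding bil_expand_right[of v v] by (metis (no_types, lifting) mult_zero_right sum.neutral)
  have edge: "(x i / v i - x j / v j)\<^sup>2 \<le> 2 / (- gram i j * (v i * v j))"
    if x: "x \<in> Z" and ij: "(i, j) \<in> coxeter_graph W S" for x i j
  proof -
    define u where "u i = x i / v i" for i
    \<comment> \<open>Summed over all \<open>i\<close>, \<open>j\<close> these nonnegative terms
      give \<open>2 * bil x x = 2\<close>, so each is at most \<open>2\<close>.\<close>
    define F where "F i j = - gram i j * (v i * v j) * (u i - u j)\<^sup>2" for i j
    have ijS: "i \<in> S" "j \<in> S" using ij by (auto simp: coxeter_graph_def)
    have xu: "x i = u i * v i" if "i \<in> S" for i using v[OF that] by (simp add: u_def)
    have F_nonneg: "0 \<le> F i j" if "i \<in> S" "j \<in> S" for i j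
    proof (cases "i = j")
      case False
      then have "0 \<le> - gram i j" using gram_nonpos that by simp
      then show ?thesis unfolding F_def using v that by (intro mult_nonneg_nonneg) (auto simp: less_imp_le)
    qed (simp add: F_def)
    have "(\<Sum>i\<in>S. \<Sum>j\<in>S. F i j)
      = 2 * (\<Sum>i\<in>S. \<Sum>j\<in>S. x i * x j * gram i j) - (\<Sum>i\<in>S. \<Sum>j\<in>S. u i * x i * v j * gram j i)
        - (\<Sum>i\<in>S. \<Sum>j\<in>S. u j * x j * v i * gram i j)"
      unfolding sum_distrib_left sum_subtractf[symmetric]
    proof (rule sum.cong[OF HOL.refl], rule sum.cong[OF HOL.refl])
      fix i j assume "i \<in> S" "j \<in> S"
      then have "x i = u i * v i" "x j = u j * v j" "gram j i = gram i j"
        using xu B_sym by auto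
      then show "F i j = 2 * (x i * x j * gram i j) - u i * x i * v j * gram j i - u j * x j * v i * gram i j"
        by (simp add: F_def power2_eq_square algebra_simps)
    qed
    also have "(\<Sum>i\<in>S. \<Sum>j\<in>S. u j * x j * v i * gram i j) = (\<Sum>j\<in>S. \<Sum>i\<in>S. u j * x j * v i * gram i j)"
      by (rule sum.swap)
    also have z: "(\<Sum>j\<in>S. \<Sum>i\<in>S. u j * x j * v i * gram i j) = 0"
    proof (rule sum.neutral, rule ballI)
      fix j assume j: "j \<in> S"
      have "(\<Sum>i\<in>S. u j * x j * v i * gram i j) = u j * (x j * bil v (unit_vec j))"
        by (simp add: bil_unit_right[OF j] sum_distrib_left mult.assoc)
      then show "(\<Sum>i\<in>S. u j * x j * v i * gram i j) = 0" using supp[OF x j] by simp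
    qed
    also have "(\<Sum>i\<in>S. \<Sum>j\<in>S. x i * x j * gram i j) = 1"
      using x root_norm[of x] by (simp add: bil_def Z_def posroot_root)
    finally have "(\<Sum>i\<in>S. \<Sum>j\<in>S. F i j) = 2" using z by simp
    moreover have "F i j \<le> (\<Sum>j\<in>S. F i j)"
      using ijS F_nonneg by (intro member_le_sum) (auto simp: finite_gens)
    moreover have "(\<Sum>j\<in>S. F i j) \<le> (\<Sum>i\<in>S. \<Sum>j\<in>S. F i j)"
      using ijS F_nonneg by (intro member_le_sum[where f = "\<lambda>i. \<Sum>j\<in>S. F i j"]) (auto simp: finite_gens intro!: sum_nonneg)
    ultimately have "F i j \<le> 2" by linarith
    moreover have "0 < - gram i j * (v i * v j)"
      using gram_neg[OF ij] v ijS by (intro mult_pos_pos) auto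
    ultimately show ?thesis
      unfolding F_def u_def by (subst pos_le_divide_eq) (simp_all only: mult.commute)
  qed
  have "\<exists>C. \<forall>x\<in>Z. x i / v i \<le> C" if i: "i \<in> S" for i
  proof -
    have "(k, i) \<in> (coxeter_graph W S)\<^sup>*" using k i connected by blast
    then show ?thesis
    proof induction
      case base
      have "x k / v k \<le> 0" if "x \<in> Z" for x using supp[OF that k(1)] k(2) by simp
      then show ?case by blast
    next
      case (step i j)
      then obtain C where C: "\<And>x. x \<in> Z \<Longrightarrow> x i / v i \<le> C" by blast
      let ?K = "2 / (- gram i j * (v i * v j))"
      have "x j / v j \<le> C + (?K + 1)" if x: "x \<in> Z" for x
      proof -
        let ?t = "x j / v j - x i / v i"
        have "?t\<^sup>2 \<le> ?K" using edge[OF x step(2)] by (simp add: power2_commute)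
        moreover have "t \<le> t\<^sup>2 + 1" for t :: real
          using zero_le_power2[of "t - 1 / 2"] by (simp add: power2_eq_square algebra_simps)
        then have "?t \<le> ?t\<^sup>2 + 1" .
        ultimately show ?thesis using C[OF x] by linarith
      qed
      then show ?case by blast
    qed
  qed
  then obtain C where C: "\<And>i x. i \<in> S \<Longrightarrow> x \<in> Z \<Longrightarrow> x i / v i \<le> C i" by metis
  have "height x \<le> (\<Sum>i\<in>S. C i * v i)" if "x \<in> Z" for x
    unfolding height_def using C[OF _ that] v by (intro sum_mono) (simp add: pos_divide_le_eq)
  then have "Z \<subseteq> {x \<in> posroots. height x \<le> (\<Sum>i\<in>S. C i * v i)}" by (auto simp: Z_def)
  then show ?thesis using finite_posroots_height_le finite_subset unfolding Z_def by blast
qed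

text \<open>An element fixing \<open>x\<close> and \<open>y\<close> fixes \<open>v\<close>. If it
  inverts a positive root \<open>z\<close>, then \<open>bil v z\<close> and \<open>- bil v z\<close>
  are both nonpositive, so all inversions lie in the finite set of positive roots orthogonal to
  \<open>v\<close>.\<close>

lemma finite_common_stabiliser:
  assumes g: "good_pair x y v" and v: "\<And>s. s \<in> S \<Longrightarrow> 0 < v s"
  shows "finite {w \<in> carrier W. rho w x = x \<and> rho w y = y}"
proof -
  define Z where "Z = {z \<in> posroots. bil v z = 0}"
  have "finite Z" unfolding Z_def
    using g by (intro finite_orthogonal_roots v) (auto simp: good_pair_def)
  moreover have "inversions w \<subseteq> Z" if w: "w \<in> carrier W" "rho w x = x" "rho w y = y" for w
  proof
    fix z assume z: "z \<in> inversions w"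
    obtain a b where ab: "v = a *\<^sub>v x + b *\<^sub>v y" using g by (auto simp: good_pair_def)
    have "rho w v = v" unfolding ab using w by (simp only: rho_add rho_scl)
    then have eq: "bil v (rho w z) = bil v z" using bil_rho[OF w(1), of v z] by simp
    have "bil v z \<le> 0" "bil v (- rho w z) \<le> 0"
      using z good_pair_nonpos[OF g] posroot_nonneg unfolding inversions_def by blast+
    then show "z \<in> Z" using z eq by (simp add: bil_simps Z_def inversions_def)
  qed
  then have "{w \<in> carrier W. rho w x = x \<and> rho w y = y} \<subseteq> {w \<in> carrier W. inversions w \<subseteq> Z}"
    by blast
  ultimately show ?thesis using finite_if_inversions_in[of Z] finite_subset by blast
qed

end

subsection \<open>Subgroups of finite index\<close>

context group
begin

lemma finite_rcosetsI:
  assumes H: "subgroup H G" and R: "finite R" "R \<subseteq> carrier G"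
    and cover: "\<And>w. w \<in> carrier G \<Longrightarrow> \<exists>r\<in>R. \<exists>h\<in>H. w = h \<otimes> r"
  shows "finite (rcosets H)"
proof (rule finite_subset)
  show "rcosets H \<subseteq> (\<lambda>r. H #> r) ` R"
  proof
    fix C assume "C \<in> rcosets H"
    then obtain w where w: "w \<in> carrier G" "C = H #> w" by (auto simp: RCOSETS_def)
    obtain r h where "r \<in> R" "h \<in> H" "w = h \<otimes> r" using cover[OF w(1)] by blast
    moreover from this have "w \<in> H #> r" by (auto simp: r_coset_def)
    ultimately show "C \<in> (\<lambda>r. H #> r) ` R" using repr_independence[OF _ _ H] R(2) w(2) by blast
  qed
qed (use R in simp)

lemma finite_rcosetsE:
  assumes "finite (rcosets H)" "subgroup H G"
  obtains R where "finite R" "R \<subseteq> carrier G" "\<And>w. w \<in> carrier G \<Longrightarrow> \<exists>r\<in>R. \<exists>h\<in>H. w = h \<otimes> r"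
proof -
  have "\<exists>r. r \<in> carrier G \<and> C = H #> r" if "C \<in> rcosets H" for C
    using that by (auto simp: RCOSETS_def)
  then obtain f where f: "\<And>C. C \<in> rcosets H \<Longrightarrow> f C \<in> carrier G \<and> C = H #> f C" by metis
  show thesis
  proof (rule that)
    show "finite (f ` (rcosets H))" using assms by simp
    show "f ` (rcosets H) \<subseteq> carrier G" using f by blast
    fix w assume w: "w \<in> carrier G"
    then have C: "H #> w \<in> rcosets H" by (auto simp: RCOSETS_def)
    have "w \<in> H #> f (H #> w)" using rcos_self[OF w assms(2)] f[OF C] by simp
    then show "\<exists>r\<in>f ` (rcosets H). \<exists>h\<in>H. w = h \<otimes> r" using C by (auto simp: r_coset_def)
  qed
qed

lemma finite_rcosets_trans:
  assumes K: "subgroup K G" and H: "subgroup H G" "finite (rcosets H)"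
    and F: "finite F" "F \<subseteq> carrier G" and cover: "\<And>h. h \<in> H \<Longrightarrow> \<exists>f\<in>F. \<exists>k\<in>K. h = k \<otimes> f"
  shows "finite (rcosets K)"
proof -
  obtain R where R: "finite R" "R \<subseteq> carrier G" "\<And>w. w \<in> carrier G \<Longrightarrow> \<exists>r\<in>R. \<exists>h\<in>H. w = h \<otimes> r"
    using finite_rcosetsE[OF H(2,1)] by blast
  show ?thesis
  proof (rule finite_rcosetsI[OF K])
    show "finite ((\<lambda>(f, r). f \<otimes> r) ` (F \<times> R))" using F R by simp
    show "(\<lambda>(f, r). f \<otimes> r) ` (F \<times> R) \<subseteq> carrier G" using F R by auto
    fix w assume "w \<in> carrier G"
    then obtain r h where rh: "r \<in> R" "h \<in> H" "w = h \<otimes> r" using R(3) by blast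
    obtain f k where fk: "f \<in> F" "k \<in> K" "h = k \<otimes> f" using cover[OF rh(2)] by blast
    have "w = k \<otimes> (f \<otimes> r)"
      using rh fk R(2) F(2) subgroup.subset[OF K] by (auto simp: m_assoc subset_iff)
    then show "\<exists>z\<in>(\<lambda>(f, r). f \<otimes> r) ` (F \<times> R). \<exists>k\<in>K. w = k \<otimes> z"
      using rh fk by (intro bexI[of _ "f \<otimes> r"] bexI[of _ k]) auto
  qed
qed

text \<open>Pigeonhole: two powers of \<open>g\<close> share a coset of \<open>H\<close>.\<close>

lemma pow_in_finite_index:
  assumes H: "subgroup H G" "finite (rcosets H)" and g: "g \<in> carrier G"
  shows "\<exists>n>0. g [^] (n::nat) \<in> H"
proof -
  have "(\<lambda>n::nat. H #> g [^] n) ` UNIV \<subseteq> rcosets H" using g by (auto simp: RCOSETS_def)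
  then have "\<not> inj (\<lambda>n::nat. H #> g [^] n)" using H(2) by (metis finite_imageD finite_subset infinite_UNIV_nat)
  then obtain i j :: nat where ij: "i < j" "H #> g [^] i = H #> g [^] j"
    unfolding inj_def by (metis linorder_neqE_nat)
  have "g [^] j \<in> H #> g [^] i" using ij(2) rcos_self[of "g [^] j"] H(1) g by simp
  then obtain h where h: "h \<in> H" "g [^] j = h \<otimes> g [^] i" by (auto simp: r_coset_def)
  have "g [^] (j - i) \<otimes> g [^] i = h \<otimes> g [^] i"
    using ij(1) g h(2) by (simp add: nat_pow_mult)
  then have "g [^] (j - i) = h" using g h(1) subgroup.subset[OF H(1)] by (auto simp: subset_iff)
  then show ?thesis using ij(1) h(1) by (intro exI[of _ "j - i"]) simp
qed

lemma image_iso: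
  assumes "group P" "h \<in> hom P G" "inj_on h (carrier P)"
  shows "subgroup (h ` carrier P) G" "G\<lparr>carrier := h ` carrier P\<rparr> \<cong> P"
proof -
  interpret group_hom P G h
    using assms(1,2) by (simp add: group_hom_def group_hom_axioms_def is_group)
  show "subgroup (h ` carrier P) G" by (rule img_is_subgroup)
  have "h \<in> iso P (G\<lparr>carrier := h ` carrier P\<rparr>)"
    using assms by (auto simp: iso_def hom_def bij_betw_def)
  then show "G\<lparr>carrier := h ` carrier P\<rparr> \<cong> P"
    using group.iso_sym[OF assms(1)] is_isoI by blast
qed

lemma affine_groupI:
  fixes d :: nat
  assumes "infinite (carrier G)" "1 \<le> d"
    and h: "h \<in> hom (product_group {..<d} (\<lambda>_. integer_group)) G"
      "inj_on h (carrier (product_group {..<d} (\<lambda>_. integer_group)))"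
    and fin: "finite (rcosets (h ` carrier (product_group {..<d} (\<lambda>_. integer_group))))"
  shows "affine_group G"
proof -
  let ?P = "product_group {..<d} (\<lambda>_. integer_group)"
  have "group ?P" by simp
  note iso = image_iso[OF this h]
  show ?thesis
    unfolding affine_group_def finite_index_subgroup_def
    using assms(1,2) fin iso by blast
qed

end

subsection \<open>The axis of a product of two reflections\<close>

locale hyperbolic_axis = fin_coxeter +
  fixes x y :: "'a \<Rightarrow> real" and c :: real
  assumes x_root: "x \<in> roots" and y_root: "y \<in> roots"
    and bil_xy: "bil x y = - c" and c_gt_1: "1 < c"
    and finite_fix: "finite {w \<in> carrier W. rho w x = x \<and> rho w y = y}"
begin

text \<open>The larger root of \<open>t^2 - 2 c t + 1\<close>, which makes \<open>lam x + y\<close>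
  and \<open>x + lam y\<close> isotropic; \<open>lam^2\<close> is the factor by which
  \<open>g\<close> stretches the first of them.\<close>

definition lam :: real where "lam = c + sqrt (c\<^sup>2 - 1)"

definition ep where "ep = lam *\<^sub>v x + y"

definition em where "em = x + lam *\<^sub>v y"

definition g where "g = (SOME r. r \<in> carrier W \<and> (\<forall>z. rho r z = reflect x (reflect y z)))"

lemma g_closed: "g \<in> carrier W" and rho_g: "rho g z = reflect x (reflect y z)"
proof -
  obtain r r' where "r \<in> carrier W" "\<And>u. rho r u = reflect x u"
    and "r' \<in> carrier W" "\<And>u. rho r' u = reflect y u"
    using root_reflection x_root y_root by meson
  then have "\<exists>r. r \<in> carrier W \<and> (\<forall>z. rho r z = reflect x (reflect y z))"
    by (intro exI[of _ "r \<otimes> r'"]) (simp add: rho_mult)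
  from someI_ex[OF this] show "g \<in> carrier W" "rho g z = reflect x (reflect y z)"
    by (simp_all add: g_def)
qed

lemma lam_gt_1: "1 < lam"
  using c_gt_1 real_sqrt_ge_zero[of "c\<^sup>2 - 1"] one_less_power[of c 2]
  unfolding lam_def by linarith

lemma lam_sq: "lam * lam = 2 * c * lam - 1"
proof -
  have "0 \<le> c\<^sup>2 - 1" using c_gt_1 by (simp add: one_less_power less_imp_le)
  then have "(lam - c)\<^sup>2 = c\<^sup>2 - 1" by (simp add: lam_def)
  then show ?thesis by (simp add: power2_eq_square algebra_simps)
qed

lemma xy_norm: "bil x x = 1" "bil y y = 1" "bil y x = - c"
  using root_norm x_root y_root bil_xy by (simp_all add: bil_sym[of y x])

lemma bil_axis: "bil ep ep = 0" "bil em em = 0" "bil ep em \<noteq> 0"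
proof -
  show "bil ep ep = 0" "bil em em = 0"
    using lam_sq by (simp_all add: ep_def em_def bil_simps xy_norm bil_xy algebra_simps)
  have "bil ep em = 2 * lam - c * (lam * lam + 1)"
    by (simp add: ep_def em_def bil_simps xy_norm bil_xy algebra_simps)
  also have "\<dots> = 2 * lam * (1 - c * c)" unfolding lam_sq by (simp add: algebra_simps)
  finally have "bil ep em = 2 * lam * (1 - c * c)" .
  moreover have "1 < c * c" using c_gt_1 by (simp add: less_1_mult)
  ultimately show "bil ep em \<noteq> 0" using lam_gt_1 by simp
qed

lemma rho_g_ep: "rho g ep = (lam * lam) *\<^sub>v ep"
proof -
  have "reflect y ep = lam *\<^sub>v x + (lam * lam) *\<^sub>v y"
    unfolding lam_sq by (simp add: reflect_def ep_def bil_simps xy_norm bil_xy fun_eq_iff algebra_simps)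
  then have "rho g ep = reflect x (lam *\<^sub>v x + (lam * lam) *\<^sub>v y)" by (simp only: rho_g)
  also have "\<dots> = (lam * (2 * c * lam - 1)) *\<^sub>v x + (lam * lam) *\<^sub>v y"
    by (simp add: reflect_def bil_simps xy_norm bil_xy fun_eq_iff algebra_simps)
  finally show ?thesis unfolding lam_sq[symmetric] by (simp add: ep_def fun_eq_iff algebra_simps)
qed

lemma rho_g_em: "rho g em = (1 / (lam * lam)) *\<^sub>v em"
proof -
  define \<mu> where "\<mu> = 1 / lam"
  have \<mu>: "\<mu> * lam = 1" using lam_gt_1 by (simp add: \<mu>_def)
  have c: "2 * c = lam + \<mu>"
  proof -
    have "(2 * c) * lam = (lam + \<mu>) * lam" using lam_sq \<mu> by (simp add: algebra_simps)
    then show ?thesis using lam_gt_1 by simp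
  qed
  have 1: "reflect y em = x + \<mu> *\<^sub>v y"
  proof -
    have "reflect y em = x + (2 * c - lam) *\<^sub>v y"
      by (simp add: reflect_def em_def bil_simps xy_norm bil_xy fun_eq_iff algebra_simps)
    then show ?thesis by (simp add: c)
  qed
  have "reflect x (x + \<mu> *\<^sub>v y) = (2 * c * \<mu> - 1) *\<^sub>v x + \<mu> *\<^sub>v y"
    by (simp add: reflect_def bil_simps xy_norm bil_xy fun_eq_iff algebra_simps)
  also have "2 * c * \<mu> - 1 = \<mu> * \<mu>" unfolding c using \<mu> by (simp add: algebra_simps)
  also have "(\<mu> * \<mu>) *\<^sub>v x + \<mu> *\<^sub>v y = (\<mu> * \<mu>) *\<^sub>v em"
  proof -
    have "\<mu> * \<mu> * lam = \<mu>" by (simp add: mult.assoc \<mu>)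
    moreover have "(\<mu> * \<mu>) *\<^sub>v em = (\<mu> * \<mu>) *\<^sub>v x + (\<mu> * \<mu> * lam) *\<^sub>v y"
      by (simp add: em_def fun_eq_iff algebra_simps)
    ultimately show ?thesis by (simp only:)
  qed
  finally have "rho g em = (\<mu> * \<mu>) *\<^sub>v em" unfolding rho_g 1 .
  then show ?thesis by (simp add: \<mu>_def)
qed

lemma rho_g_orth:
  assumes "bil z ep = 0" "bil z em = 0" shows "rho g z = z"
proof -
  have e: "lam * bil z x + bil z y = 0" "bil z x + lam * bil z y = 0"
    using assms by (simp_all add: ep_def em_def bil_simps)
  have "lam * (bil z x + lam * bil z y) = (lam * bil z x + bil z y) + (lam * lam - 1) * bil z y"
    by (simp add: algebra_simps)
  then have "(lam * lam - 1) * bil z y = 0" using e by simp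
  moreover have "1 < lam * lam" using lam_gt_1 by (simp add: less_1_mult)
  ultimately have "bil z y = 0" by simp
  then have "bil z x = 0" using e(2) by simp
  then have "reflect x z = z" "reflect y z = z"
    using \<open>bil z y = 0\<close> by (simp_all add: reflect_def fun_eq_iff)
  then show ?thesis by (simp only: rho_g)
qed

text \<open>The two lines are not exchanged. Inverse factors are automatic when both lines are
  preserved, as \<open>bil ep em\<close> is nonzero and invariant; so the single number
  \<open>chi w\<close> describes the action on the plane.\<close>

definition axis_stab where
  "axis_stab = {w \<in> carrier W. \<exists>a. a \<noteq> 0 \<and> rho w ep = a *\<^sub>v ep \<and> rho w em = (1 / a) *\<^sub>v em}"

lemma axis_stabI:
  "w \<in> carrier W \<Longrightarrow> a \<noteq> 0 \<Longrightarrow> rho w ep = a *\<^sub>v ep \<Longrightarrow> rho w em = (1 / a) *\<^sub>v em \<Longrightarrow> w \<in> axis_stab"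
  by (auto simp: axis_stab_def)

definition chi where "chi w = bil (rho w ep) em / bil ep em"

lemma chi_eq: "rho w ep = a *\<^sub>v ep \<Longrightarrow> chi w = a"
  using bil_axis(3) by (simp add: chi_def bil_simps)

lemma axis_stabD:
  assumes "w \<in> axis_stab"
  shows "w \<in> carrier W" "chi w \<noteq> 0" "rho w ep = chi w *\<^sub>v ep" "rho w em = (1 / chi w) *\<^sub>v em"
  using assms chi_eq by (auto simp: axis_stab_def)

lemma axis_stab_mult:
  assumes "v \<in> axis_stab" "w \<in> axis_stab"
  shows "v \<otimes> w \<in> axis_stab" "chi (v \<otimes> w) = chi v * chi w"
proof -
  note v = axis_stabD[OF assms(1)] and w = axis_stabD[OF assms(2)]
  have e: "rho (v \<otimes> w) ep = (chi v * chi w) *\<^sub>v ep" "rho (v \<otimes> w) em = (1 / (chi v * chi w)) *\<^sub>v em"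
    using v(1) w(1) by (simp_all only: rho_mult v(3,4) w(3,4) rho_scl scl_scl) (simp_all add: mult.commute)
  show "chi (v \<otimes> w) = chi v * chi w" by (rule chi_eq[OF e(1)])
  show "v \<otimes> w \<in> axis_stab" by (rule axis_stabI[OF _ _ e]) (use v w in simp_all)
qed

lemma axis_stab_inv:
  assumes "w \<in> axis_stab"
  shows "inv w \<in> axis_stab" "chi (inv w) = 1 / chi w"
proof -
  note w = axis_stabD[OF assms]
  have "ep = rho (inv w) (chi w *\<^sub>v ep)" "em = rho (inv w) ((1 / chi w) *\<^sub>v em)"
    using w by (metis rho_inv_left)+
  then have "ep = chi w *\<^sub>v rho (inv w) ep" "em = (1 / chi w) *\<^sub>v rho (inv w) em"
    using w(1) by (simp_all add: rho_scl)
  then have e: "rho (inv w) ep = (1 / chi w) *\<^sub>v ep" "rho (inv w) em = chi w *\<^sub>v em"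
    using w(2) by (simp_all add: fun_eq_iff field_simps)
  show "chi (inv w) = 1 / chi w" by (rule chi_eq[OF e(1)])
  show "inv w \<in> axis_stab" unfolding axis_stab_def using e w(1,2)
    by (auto intro!: exI[of _ "1 / chi w"])
qed

lemma axis_stab_subgroup: "subgroup axis_stab W"
proof (rule subgroupI)
  show "axis_stab \<noteq> {}"
    unfolding axis_stab_def by (auto intro!: exI[of _ "\<one>"] exI[of _ "1::real"] simp: fun_eq_iff)
qed (auto simp: axis_stab_mult axis_stab_inv dest: axis_stabD(1))

lemma axis_stab_pow:
  "w \<in> axis_stab \<Longrightarrow> w [^] (n::nat) \<in> axis_stab \<and> chi (w [^] n) = chi w ^ n"
proof (induction n)
  case 0
  have "\<one> \<in> axis_stab" using axis_stab_subgroup by (rule subgroup.one_closed)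
  moreover have "chi \<one> = 1" using bil_axis by (simp add: chi_def)
  ultimately show ?case by simp
qed (simp add: axis_stab_mult)

lemma g_axis_stab: "g \<in> axis_stab" "chi g = lam * lam"
proof -
  show "chi g = lam * lam" by (rule chi_eq[OF rho_g_ep])
  show "g \<in> axis_stab"
    unfolding axis_stab_def using g_closed rho_g_ep rho_g_em lam_gt_1
    by (auto intro!: exI[of _ "lam * lam"])
qed

lemma chi_g_gt_1: "1 < chi g"
  unfolding g_axis_stab(2) using lam_gt_1 by (simp add: less_1_mult)

text \<open>Up to the factor \<open>lam^2 - 1\<close>, \<open>x\<close> and \<open>y\<close> are
  combinations of \<open>ep\<close> and \<open>em\<close>, so bounds on \<open>chi w\<close> and its
  inverse bound the heights of \<open>w x\<close> and \<open>w y\<close>. Finitely many roots have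
  such heights, and elements with the same two images lie in one coset of the finite group fixing
  \<open>x\<close> and \<open>y\<close>.\<close>

lemma finite_chi_bounded: "finite {w \<in> axis_stab. \<bar>chi w\<bar> \<le> K \<and> \<bar>1 / chi w\<bar> \<le> K}"
proof -
  define F where "F = {w \<in> axis_stab. \<bar>chi w\<bar> \<le> K \<and> \<bar>1 / chi w\<bar> \<le> K}"
  define D where "D = lam * lam - 1"
  have D: "0 < D" using lam_gt_1 by (simp add: D_def less_1_mult)
  have xe: "D *\<^sub>v x = lam *\<^sub>v ep - em" and ye: "D *\<^sub>v y = lam *\<^sub>v em - ep"
    by (simp_all add: ep_def em_def D_def fun_eq_iff algebra_simps)
  define C where "C = (lam * K * (\<bar>height ep\<bar> + \<bar>height em\<bar>) + K * (\<bar>height ep\<bar> + \<bar>height em\<bar>)) / D"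
  define R where "R = {z \<in> roots. \<bar>height z\<bar> \<le> C}"
  have finR: "finite R" unfolding R_def by (rule finite_roots_height_le)
  have bound: "\<bar>height (rho w u)\<bar> \<le> C"
    if w: "w \<in> F" and u: "D *\<^sub>v u = lam *\<^sub>v ep - em \<or> D *\<^sub>v u = lam *\<^sub>v em - ep" for w u
  proof -
    have wE: "w \<in> axis_stab" and k: "\<bar>chi w\<bar> \<le> K" "\<bar>1 / chi w\<bar> \<le> K" using w by (auto simp: F_def)
    have K: "0 \<le> K" using k(1) by linarith
    note e = axis_stabD[OF wE]
    have "D * height (rho w u) = height (rho w (D *\<^sub>v u))" using e(1) by (simp add: rho_scl height_scl)
    moreover have "height (rho w (lam *\<^sub>v ep - em)) = lam * height (rho w ep) - height (rho w em)"
      "height (rho w (lam *\<^sub>v em - ep)) = lam * height (rho w em) - height (rho w ep)"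
      by (simp_all only: rho_diff[OF e(1)] rho_scl[OF e(1)] height_diff height_scl)
    moreover have "height (rho w ep) = chi w * height ep" "height (rho w em) = 1 / chi w * height em"
    by (simp_all only: e(3,4) height_scl)
  ultimately have cases: "D * height (rho w u) = lam * (chi w * height ep) - 1 / chi w * height em
      \<or> D * height (rho w u) = lam * (1 / chi w * height em) - chi w * height ep"
      using u by metis
    let ?p = "\<bar>height ep\<bar>" and ?m = "\<bar>height em\<bar>"
    have 1: "\<bar>chi w * height ep\<bar> \<le> K * ?p" and 2: "\<bar>1 / chi w * height em\<bar> \<le> K * ?m"
      unfolding abs_mult
      by (rule mult_right_mono[OF k(1) abs_ge_zero], rule mult_right_mono[OF k(2) abs_ge_zero])
    have 3: "\<bar>lam * t\<bar> \<le> lam * s" if "\<bar>t\<bar> \<le> s" for s t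
      using that lam_gt_1 by (simp add: abs_mult)
    have 4: "0 \<le> K * ?p" "0 \<le> K * ?m" "0 \<le> lam * (K * ?p)" "0 \<le> lam * (K * ?m)"
      using K lam_gt_1 by simp_all
    have "C * D = lam * (K * ?p) + lam * (K * ?m) + K * ?p + K * ?m"
    proof -
      have "C * D = lam * K * (?p + ?m) + K * (?p + ?m)" using D by (simp add: C_def)
      then show ?thesis by (simp add: algebra_simps)
    qed
    moreover have "\<bar>D * height (rho w u)\<bar> \<le> lam * (K * ?p) + lam * (K * ?m) + K * ?p + K * ?m"
      using cases 3[OF 1] 3[OF 2] 1 2 4 by linarith
    ultimately have "\<bar>height (rho w u)\<bar> * D \<le> C * D" using D by (simp add: abs_mult mult.commute)
    then show ?thesis using D by simp
  qed
  have F_carrier: "F \<subseteq> carrier W" using axis_stabD(1) by (auto simp: F_def)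
  have "F \<subseteq> (\<Union>p\<in>R \<times> R. {w \<in> F. (rho w x, rho w y) = p})"
  proof
    fix w assume w: "w \<in> F"
    have "rho w x \<in> R" "rho w y \<in> R"
      using bound[OF w, of x] bound[OF w, of y] xe ye rho_root[of _ w] x_root y_root F_carrier w
      by (auto simp only: R_def mem_Collect_eq subset_iff)
    then show "w \<in> (\<Union>p\<in>R \<times> R. {w \<in> F. (rho w x, rho w y) = p})" using w by blast
  qed
  moreover have "finite {w \<in> F. (rho w x, rho w y) = p}" for p
  proof (cases "{w \<in> F. (rho w x, rho w y) = p} = {}")
    case False
    then obtain v where v: "v \<in> F" "(rho v x, rho v y) = p" by blast
    have "{w \<in> F. (rho w x, rho w y) = p} \<subseteq> (\<lambda>u. v \<otimes> u) ` {w \<in> carrier W. rho w x = x \<and> rho w y = y}"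
    proof
      fix w assume w: "w \<in> {w \<in> F. (rho w x, rho w y) = p}"
      have vw: "v \<in> carrier W" "w \<in> carrier W" using v w F_carrier by auto
      have "rho w x = rho v x" "rho w y = rho v y" using v w by auto
      then have "rho (inv v \<otimes> w) x = x" "rho (inv v \<otimes> w) y = y" using vw by (simp_all add: rho_mult)
      moreover have "w = v \<otimes> (inv v \<otimes> w)" using vw by (simp add: m_assoc[symmetric])
      ultimately show "w \<in> (\<lambda>u. v \<otimes> u) ` {w \<in> carrier W. rho w x = x \<and> rho w y = y}"
        using vw by blast
    qed
    then show ?thesis using finite_fix finite_surj by blast
  next
    case True
    then show ?thesis by (simp only: finite.emptyI)
  qed
  then have "finite (\<Union>p\<in>R \<times> R. {w \<in> F. (rho w x, rho w y) = p})"
    using finR by (intro finite_UN_I finite_cartesian_product)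
  ultimately have "finite F" by (rule finite_subset)
  then show ?thesis by (simp add: F_def)
qed

text \<open>\<open>w\<close> preserves the eigenspaces of \<open>h = g^n\<close> for
  \<open>A > 1\<close> and \<open>1 / A\<close>, and these are the two lines: an eigenvector is
  orthogonal to the isotropic vector \<open>e\<close> with the same eigenvalue, and subtracting a
  multiple of \<open>e\<close> makes it orthogonal to both, hence fixed by \<open>h\<close>, hence
  zero. This works for degenerate forms too.\<close>

lemma centraliser_subset:
  assumes n: "0 < n" and w: "w \<in> carrier W" and comm: "w \<otimes> g [^] (n::nat) = g [^] n \<otimes> w"
  shows "w \<in> axis_stab"
proof -
  define h where "h = g [^] n"
  define A where "A = chi g ^ n"
  have A: "1 < A" using chi_g_gt_1 n by (simp add: A_def one_less_power)
  have hE: "h \<in> axis_stab" "chi h = A" using axis_stab_pow[OF g_axis_stab(1)] by (simp_all add: h_def A_def)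
  note h = axis_stabD[OF hE(1), unfolded hE(2)]
  have horth: "rho h z = z" if "bil z ep = 0" "bil z em = 0" for z
    unfolding h_def by (induction n) (simp_all add: rho_mult g_closed rho_g_orth that)
  have eigen: "\<exists>t. z = t *\<^sub>v e" if z: "rho h z = b *\<^sub>v z" and b: "0 < b" "b \<noteq> 1"
    and e: "rho h e = b *\<^sub>v e" "bil e e = 0" and e': "bil e' e \<noteq> 0"
    and ee: "{e, e'} = {ep, em}" for z e e' b
  proof -
    have "bil z e = bil (rho h z) (rho h e)" using h(1) by (simp add: bil_rho)
    also have "\<dots> = (b * b) * bil z e" unfolding z e(1) by (simp add: bil_simps)
    finally have "(b * b - 1) * bil z e = 0" by (simp add: algebra_simps)
    moreover have "b * b \<noteq> 1" using b square_eq_1_iff[of b] by auto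
    ultimately have ze: "bil z e = 0" by simp
    define t where "t = bil z e' / bil e' e"
    define u where "u = z - t *\<^sub>v e"
    have "bil u e = 0" "bil u e' = 0"
      using ze e(2) e' by (simp_all add: u_def bil_simps t_def bil_sym[of e e'])
    then have "bil u ep = 0 \<and> bil u em = 0" using ee by (auto simp: doubleton_eq_iff)
    then have "rho h u = u" using horth by blast
    moreover have "rho h u = b *\<^sub>v u"
      unfolding u_def using h(1) z e(1) by (simp add: rho_diff rho_scl fun_eq_iff algebra_simps)
    ultimately have "u i = b * u i" for i by (metis scl_apply)
    then have "(b - 1) * u i = 0" for i by (metis diff_self left_diff_distrib mult_1)
    then have "u = 0" using b(2) by (simp add: fun_eq_iff)
    then have "z = t *\<^sub>v e" by (simp add: u_def)
    then show ?thesis by blast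
  qed
  have comm': "rho h (rho w z) = rho w (rho h z)" for z
    using comm h(1) w by (simp add: h_def[symmetric] rho_mult[symmetric])
  have "\<exists>a. rho w ep = a *\<^sub>v ep"
    using eigen[of "rho w ep" A ep em] A h w bil_axis comm'[of ep] by (simp add: rho_scl bil_sym[of em ep])
  then obtain a where a: "rho w ep = a *\<^sub>v ep" by blast
  have "\<exists>a. rho w em = a *\<^sub>v em"
    using eigen[of "rho w em" "1 / A" em ep] A h w bil_axis comm'[of em]
    by (simp add: rho_scl insert_commute)
  then obtain b where b: "rho w em = b *\<^sub>v em" by blast
  have "bil ep em = bil (rho w ep) (rho w em)" using w by (simp add: bil_rho)
  also have "\<dots> = (a * b) * bil ep em" unfolding a b by (simp add: bil_simps)
  finally have ab: "a * b = 1" using bil_axis(3) by simp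
  then have "a \<noteq> 0" by auto
  moreover from this have "b = 1 / a" using ab by (simp add: eq_divide_eq mult.commute)
  ultimately show ?thesis unfolding axis_stab_def using a b w by blast
qed

lemma between_powers:
  fixes L t :: real
  assumes "1 < L" "1 \<le> t"
  shows "\<exists>j::nat. L ^ j \<le> t \<and> t < L ^ Suc j"
proof -
  have "\<exists>n. t < L ^ n" using real_arch_pow[OF assms(1)] .
  define n where "n = (LEAST n. t < L ^ n)"
  have n: "t < L ^ n" unfolding n_def using \<open>\<exists>n. t < L ^ n\<close> by (rule LeastI_ex)
  then obtain j where j: "n = Suc j" using assms(2) by (cases n) auto
  have "\<not> t < L ^ j" using not_less_Least[of j "\<lambda>n. t < L ^ n"] by (simp add: n_def[symmetric] j)
  then show ?thesis using n j by (intro exI[of _ j]) auto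
qed

text \<open>Division with remainder by powers of \<open>g\<close>, measured by \<open>chi\<close>;
  the remainders form a finite set by \<open>finite_chi_bounded\<close>.\<close>

lemma axis_coset_rep:
  assumes a: "a \<in> axis_stab" "1 \<le> \<bar>chi a\<bar>"
  shows "\<exists>j::nat. inv (g [^] j) \<otimes> a \<in> {w \<in> axis_stab. \<bar>chi w\<bar> \<le> chi g \<and> \<bar>1 / chi w\<bar> \<le> chi g}
    \<and> chi g ^ j \<le> \<bar>chi a\<bar>"
proof -
  obtain j where j: "chi g ^ j \<le> \<bar>chi a\<bar>" "\<bar>chi a\<bar> < chi g ^ Suc j"
    using between_powers[OF chi_g_gt_1 a(2)] by blast
  have gj: "g [^] j \<in> axis_stab" "chi (g [^] j) = chi g ^ j"
    using axis_stab_pow[OF g_axis_stab(1)] by auto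
  let ?w = "inv (g [^] j) \<otimes> a"
  have w: "?w \<in> axis_stab" "chi ?w = chi a / chi g ^ j"
    using axis_stab_mult axis_stab_inv gj a(1) by auto
  have p: "0 < chi g ^ j" using chi_g_gt_1 by simp
  have e: "\<bar>chi ?w\<bar> = \<bar>chi a\<bar> / chi g ^ j" using p by (simp add: w(2))
  have "\<bar>chi ?w\<bar> \<le> chi g" unfolding e using j(2) p by (simp add: pos_divide_le_eq)
  moreover have "1 \<le> \<bar>chi ?w\<bar>" unfolding e using j(1) p by (simp add: pos_le_divide_eq)
  then have "\<bar>1 / chi ?w\<bar> \<le> 1" by (simp add: abs_divide divide_le_eq)
  then have "\<bar>1 / chi ?w\<bar> \<le> chi g" using chi_g_gt_1 by linarith
  ultimately show ?thesis using w j(1) by blast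
qed

text \<open>The powers of \<open>a\<close> have finitely many remainders modulo powers of
  \<open>g\<close>. Two equal remainders make the quotient of two powers of \<open>a\<close> a power
  of \<open>g\<close>, and \<open>|chi a| > 1\<close> makes its exponent positive.\<close>

lemma common_power:
  assumes a: "a \<in> axis_stab" and gt: "1 < \<bar>chi a\<bar>"
  shows "\<exists>k i. 0 < k \<and> 0 < i \<and> a [^] (k::nat) = g [^] (i::nat)"
proof -
  define F where "F = {w \<in> axis_stab. \<bar>chi w\<bar> \<le> chi g \<and> \<bar>1 / chi w\<bar> \<le> chi g}"
  have ap: "a [^] n \<in> axis_stab" "\<bar>chi (a [^] n)\<bar> = \<bar>chi a\<bar> ^ n" for n :: nat
    using axis_stab_pow[OF a] by (simp_all add: power_abs)
  have "\<exists>j. inv (g [^] (j::nat)) \<otimes> a [^] n \<in> F" for n :: nat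
    using axis_coset_rep[OF ap(1)[of n]] ap(2)[of n] gt by (auto simp: F_def)
  then obtain j :: "nat \<Rightarrow> nat" where j: "\<And>n. inv (g [^] j n) \<otimes> a [^] n \<in> F" by metis
  have "finite F" unfolding F_def by (rule finite_chi_bounded)
  then have "\<not> inj (\<lambda>n::nat. inv (g [^] j n) \<otimes> a [^] n)"
    using j by (metis (no_types, lifting) finite_imageD finite_subset image_subsetI infinite_UNIV_nat)
  then obtain m n where mn: "m < n" "inv (g [^] j m) \<otimes> a [^] m = inv (g [^] j n) \<otimes> a [^] n"
    unfolding inj_def by (metis linorder_neqE_nat)
  have ac: "a \<in> carrier W" using a axis_stabD(1) by blast
  have "g [^] j n \<otimes> (inv (g [^] j m) \<otimes> a [^] m) = a [^] n"
    unfolding mn(2) using ac g_closed by (simp add: m_assoc[symmetric])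
  also have "a [^] n = a [^] (n - m) \<otimes> a [^] m" using mn(1) ac by (simp add: nat_pow_mult)
  finally have "(g [^] j n \<otimes> inv (g [^] j m)) \<otimes> a [^] m = a [^] (n - m) \<otimes> a [^] m"
    using ac g_closed by (simp add: m_assoc)
  then have eq: "g [^] j n \<otimes> inv (g [^] j m) = a [^] (n - m)"
    using ac g_closed by simp
  have gp: "g [^] i \<in> axis_stab" "chi (g [^] i) = chi g ^ i" for i :: nat
    using axis_stab_pow[OF g_axis_stab(1)] by auto
  have "chi (a [^] (n - m)) = chi g ^ j n / chi g ^ j m"
    unfolding eq[symmetric] using axis_stab_mult(2) axis_stab_inv gp by auto
  moreover have "1 < \<bar>chi (a [^] (n - m))\<bar>" unfolding ap(2) using gt mn(1) by (simp add: one_less_power)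
  ultimately have "chi g ^ j m < chi g ^ j n"
    using chi_g_gt_1 by (simp add: less_divide_eq)
  then have jm: "j m < j n" using chi_g_gt_1 by (simp add: power_strict_increasing_iff)
  have "g [^] j n = g [^] (j n - j m) \<otimes> g [^] j m" using jm g_closed by (simp add: nat_pow_mult)
  then have "g [^] (j n - j m) = a [^] (n - m)"
    unfolding eq[symmetric] using g_closed by (simp add: m_assoc)
  then show ?thesis using jm mn(1) by (intro exI[of _ "n - m"] exI[of _ "j n - j m"]) simp
qed

lemma centraliser_axis:
  assumes "p \<in> axis_stab" "1 < \<bar>chi p\<bar>" "q \<in> carrier W" "p \<otimes> q = q \<otimes> p"
  shows "q \<in> axis_stab"
proof -
  obtain k i where ki: "0 < i" "p [^] (k::nat) = g [^] (i::nat)"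
    using common_power[OF assms(1,2)] by blast
  have pc: "p \<in> carrier W" using assms axis_stabD(1) by blast
  have "q \<otimes> p [^] k = p [^] k \<otimes> q"
  proof (induction k)
    case (Suc k)
    then show ?case using assms(3,4) pc
      by (metis m_assoc nat_pow_Suc nat_pow_closed)
  qed (use assms in simp)
  then show ?thesis using centraliser_subset[OF ki(1) assms(3)] ki(2) by simp
qed

text \<open>\<open>p\<close> pulls all of \<open>Q\<close> into the stabiliser. As \<open>Q\<close>
  is infinite and only finitely many elements have \<open>|chi| = 1\<close>, some element of
  \<open>Q\<close> has \<open>|chi| > 1\<close>, after inversion if necessary, and the same argument
  with exchanged roles pulls in \<open>P\<close>.\<close>

lemma commuting_in_axis_stab:
  assumes P: "subgroup P W" and Q: "subgroup Q W" "infinite Q"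
    and comm: "\<And>p q. p \<in> P \<Longrightarrow> q \<in> Q \<Longrightarrow> p \<otimes> q = q \<otimes> p"
    and p: "p \<in> P" "p \<in> axis_stab" "1 < \<bar>chi p\<bar>"
  shows "P \<subseteq> axis_stab" "Q \<subseteq> axis_stab"
proof -
  show QE: "Q \<subseteq> axis_stab"
    using centraliser_axis[OF p(2,3)] comm[OF p(1)] subgroup.subset[OF Q(1)] by blast
  have "\<not> Q \<subseteq> {w \<in> axis_stab. \<bar>chi w\<bar> \<le> 1 \<and> \<bar>1 / chi w\<bar> \<le> 1}"
    using finite_chi_bounded[of 1] Q(2) finite_subset by blast
  then obtain q where q: "q \<in> Q" "1 < \<bar>chi q\<bar> \<or> 1 < \<bar>1 / chi q\<bar>" using QE by force
  have "\<exists>q\<in>Q. 1 < \<bar>chi q\<bar>"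
  proof (cases "1 < \<bar>chi q\<bar>")
    case False
    then have "1 < \<bar>chi (inv q)\<bar>" using q QE axis_stab_inv(2) by auto
    then show ?thesis using subgroup.m_inv_closed[OF Q(1) q(1)] by blast
  qed (use q in blast)
  then obtain q' where q': "q' \<in> Q" "1 < \<bar>chi q'\<bar>" by blast
  show "P \<subseteq> axis_stab"
  proof
    fix r assume r: "r \<in> P"
    show "r \<in> axis_stab"
      using centraliser_axis[of q' r] q' QE r comm[OF r q'(1)] subgroup.subset[OF P] by auto
  qed
qed

text \<open>The powers of \<open>g\<close> form an infinite cyclic group since
  \<open>chi g > 1\<close>, and division with remainder shows that it has finite index in the
  stabiliser.\<close>

lemma affine_if_axis_stab_finite_index:
  assumes inf: "infinite (carrier W)" and fin: "finite (rcosets axis_stab)"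
  shows "affine_group W"
proof -
  let ?P = "product_group {..<1::nat} (\<lambda>_. integer_group)"
  define h where "h f = g [^] (f 0 :: int)" for f :: "nat \<Rightarrow> int"
  have hom: "h \<in> hom ?P W"
    using g_closed by (auto simp: hom_def h_def int_pow_mult)
  have inj_pow: "i = 0" if "g [^] (i::int) = \<one>" for i
  proof (rule ccontr)
    assume "i \<noteq> 0"
    obtain n where n: "i = int n \<or> i = - int n" by (metis int_cases2)
    then have "g [^] n = \<one>"
      using that g_closed by (auto simp: int_pow_int int_pow_neg_int)
    then have "chi g ^ n = 1"
      using axis_stab_pow[OF g_axis_stab(1), of n] bil_axis by (simp add: chi_def)
    moreover have "1 < chi g ^ n" using chi_g_gt_1 \<open>i \<noteq> 0\<close> n by (intro one_less_power) auto
    ultimately show False by simp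
  qed
  have inj: "inj_on h (carrier ?P)"
  proof (rule inj_onI)
    fix f f' assume f: "f \<in> carrier ?P" "f' \<in> carrier ?P" "h f = h f'"
    have "g [^] (f 0 - f' 0) = \<one>"
      using f(3) g_closed by (simp add: int_pow_diff h_def)
    then have "f 0 = f' 0" using inj_pow by fastforce
    then show "f = f'" using f(1,2) by (intro PiE_ext[of f "{..<1}" _ f']) auto
  qed
  have img: "g [^] (i::int) \<in> h ` carrier ?P" for i
    by (intro image_eqI[of _ _ "\<lambda>j\<in>{..<1}. i"]) (auto simp: h_def)
  have K: "subgroup (h ` carrier ?P) W"
    by (rule image_iso(1)[OF _ hom inj]) simp
  define F where "F = {w \<in> axis_stab. \<bar>chi w\<bar> \<le> chi g \<and> \<bar>1 / chi w\<bar> \<le> chi g}"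
  have finF: "finite F" unfolding F_def by (rule finite_chi_bounded)
  have "finite (rcosets (h ` carrier ?P))"
  proof (rule finite_rcosets_trans[OF K axis_stab_subgroup fin finF])
    show "F \<subseteq> carrier W" using axis_stabD(1) by (auto simp: F_def)
    fix a assume a: "a \<in> axis_stab"
    have ac: "a \<in> carrier W" using a axis_stabD(1) by blast
    show "\<exists>f\<in>F. \<exists>k\<in>h ` carrier ?P. a = k \<otimes> f"
    proof (cases "1 \<le> \<bar>chi a\<bar>")
      case True
      then obtain j :: nat where j: "inv (g [^] j) \<otimes> a \<in> F"
        using axis_coset_rep[OF a] by (auto simp: F_def)
      have "a = g [^] (int j) \<otimes> (inv (g [^] j) \<otimes> a)"
        using ac g_closed by (simp add: int_pow_int m_assoc[symmetric])
      then show ?thesis using j img by blast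
    next
      case False
      \<comment> \<open>Here \<open>a\<close> contracts \<open>ep\<close>, so it is multiplied by a
        nonnegative power of \<open>g\<close>. Passing to \<open>inv a\<close> would put the power
        of \<open>g\<close> on the wrong side of the remainder.\<close>
      define t where "t = 1 / \<bar>chi a\<bar>"
      have a0: "0 < \<bar>chi a\<bar>" using axis_stabD(2)[OF a] by simp
      have "1 \<le> t" using False a0 by (simp add: t_def le_divide_eq)
      then obtain j where j: "chi g ^ j \<le> t" "t < chi g ^ Suc j"
        using between_powers[OF chi_g_gt_1] by blast
      have p: "0 < chi g ^ j" "0 < chi g" using chi_g_gt_1 by simp_all
      let ?w = "g [^] j \<otimes> a"
      have w: "?w \<in> axis_stab" "\<bar>chi ?w\<bar> = chi g ^ j * \<bar>chi a\<bar>"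
        using axis_stab_mult axis_stab_pow[OF g_axis_stab(1)] a p by (auto simp: abs_mult)
      have "\<bar>chi ?w\<bar> \<le> 1" unfolding w(2) using j(1) a0 by (simp add: t_def le_divide_eq)
      then have 1: "\<bar>chi ?w\<bar> \<le> chi g" using chi_g_gt_1 by linarith
      have "1 < chi g * (chi g ^ j * \<bar>chi a\<bar>)" using j(2) a0 by (simp add: t_def divide_less_eq mult_ac)
      then have "\<bar>1 / chi ?w\<bar> \<le> chi g"
        using p a0 unfolding abs_divide abs_one w(2) by (subst pos_divide_le_eq) auto
      then have "?w \<in> F" using w 1 by (simp add: F_def)
      moreover have "a = g [^] (- int j) \<otimes> ?w"
        using ac g_closed by (simp add: int_pow_neg_int m_assoc[symmetric])
      ultimately show ?thesis using img by blast
    qed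
  qed
  then show ?thesis using affine_groupI[OF inf _ hom inj] by simp
qed

end

subsection \<open>Bounded root systems\<close>

lemma (in group) finite_rcosets_if_finite_image:
  assumes N: "subgroup N G" and fin: "finite (f ` carrier G)"
    and eq: "\<And>v w. v \<in> carrier G \<Longrightarrow> w \<in> carrier G \<Longrightarrow> f v = f w \<Longrightarrow> v \<otimes> inv w \<in> N"
  shows "finite (rcosets N)"
proof (rule finite_rcosetsI[OF N])
  let ?R = "inv_into (carrier G) f ` f ` carrier G"
  show "finite ?R" using fin by simp
  show "?R \<subseteq> carrier G" by (auto intro: inv_into_into)
  fix w assume w: "w \<in> carrier G"
  let ?r = "inv_into (carrier G) f (f w)"
  have r: "?r \<in> carrier G" "f ?r = f w" using w by (auto intro: inv_into_into f_inv_into_f)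
  have "w \<otimes> inv ?r \<in> N" using eq[OF w r(1)] r(2) by simp
  moreover have "w = (w \<otimes> inv ?r) \<otimes> ?r" using w r by (simp add: m_assoc)
  ultimately show "\<exists>r\<in>?R. \<exists>h\<in>N. w = h \<otimes> r" using w by blast
qed

section \<open>Linear functionals and the fundamental chamber\<close>

context fin_coxeter
begin

text \<open>A linear functional given by its values on the simple roots. For a degenerate form
  \<open>height\<close> need not be represented by a vector, so functionals take the place of
  vectors here.\<close>

definition ev :: "('a \<Rightarrow> real) \<Rightarrow> ('a \<Rightarrow> real) \<Rightarrow> real"
  where "ev c z = (\<Sum>s\<in>S. z s * c s)"

lemma ev_reflect:
  assumes s: "s \<in> S"
  shows "ev c (rho s z) = ev (\<lambda>t. c t - 2 * gram t s * c s) z"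
proof -
  have u: "(\<Sum>t\<in>S. unit_vec s t * c t) = c s"
    using finite_gens s by (subst sum.remove[of _ s]) (auto simp: unit_vec_def)
  have "ev c (rho s z) = (\<Sum>t\<in>S. z t * c t) - 2 * bil z (unit_vec s) * (\<Sum>t\<in>S. unit_vec s t * c t)"
    by (simp add: ev_def rho_gen s reflect_def sum_subtractf sum_distrib_left algebra_simps)
  also have "\<dots> = (\<Sum>t\<in>S. z t * c t) - (\<Sum>t\<in>S. 2 * (z t * gram t s) * c s)"
    unfolding u bil_unit_right[OF s] by (simp add: sum_distrib_left sum_distrib_right mult.assoc)
  also have "\<dots> = ev (\<lambda>t. c t - 2 * gram t s * c s) z"
    by (simp add: ev_def sum_subtractf[symmetric] algebra_simps)
  finally show ?thesis .
qed

lemma ev_unit: "s \<in> S \<Longrightarrow> ev c (unit_vec s) = c s"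
  unfolding ev_def using finite_gens by (subst sum.remove[of _ s]) (auto simp: unit_vec_def)

text \<open>Descent on the number of positive roots with negative value: a reflection
  \<open>s\<close> with \<open>c s < 0\<close> keeps the positive roots other than
  \<open>e_s\<close> positive, and the value at \<open>e_s\<close> changes sign.\<close>

lemma move_to_chamber:
  assumes "finite {z \<in> posroots. ev c z < 0}"
  shows "\<exists>w\<in>carrier W. \<exists>c'. (\<forall>z. ev c (rho w z) = ev c' z) \<and> (\<forall>s\<in>S. 0 \<le> c' s)"
  using assms
proof (induction "card {z \<in> posroots. ev c z < 0}" arbitrary: c rule: less_induct)
  case less
  show ?case
  proof (cases "\<forall>s\<in>S. 0 \<le> c s")
    case True
    then show ?thesis by (intro bexI[of _ \<one>] exI[of _ c]) simp_all
  next
    case False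
    then obtain s where s: "s \<in> S" "c s < 0" by force
    define c1 where "c1 = (\<lambda>t. c t - 2 * gram t s * c s)"
    have c1: "ev c (rho s z) = ev c1 z" for z unfolding c1_def by (rule ev_reflect[OF s(1)])
    let ?A = "{z \<in> posroots. ev c z < 0}" and ?B = "{z \<in> posroots. ev c1 z < 0}"
    have sC: "s \<in> carrier W" using s gens_closed by blast
    have inj: "inj_on (rho s) ?B"
      using rho_inv_left[OF sC] by (metis inj_onI)
    have "rho s ` ?B \<subseteq> ?A - {unit_vec s}"
    proof
      fix y assume "y \<in> rho s ` ?B"
      then obtain z where z: "z \<in> posroots" "ev c1 z < 0" "y = rho s z" by blast
      have "c1 s = - c s" using s by (simp add: c1_def gram_diag)
      then have ne: "z \<noteq> unit_vec s" using z(2) s ev_unit[OF s(1), of c1] by auto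
      have "y \<in> posroots" unfolding z(3) by (rule simple_reflection_pos[OF z(1) s(1) ne])
      moreover have "y \<noteq> unit_vec s"
      proof
        assume "y = unit_vec s"
        then have "z = - unit_vec s"
          using z(3) rho_inv_left[OF sC, of z] s(1)
          by (simp only: gen_inv rho_gen reflect_self unit_norm)
        then show False using z(1) unit_root[OF s(1)] posroot_uminus by blast
      qed
      ultimately show "y \<in> ?A - {unit_vec s}" using z c1 by auto
    qed
    moreover have "unit_vec s \<in> ?A" using s unit_root ev_unit by simp
    ultimately have sub: "rho s ` ?B \<subset> ?A" by blast
    have "finite ?B" using less.prems sub inj by (meson finite_imageD finite_subset psubset_imp_subset)
    moreover have "card ?B < card ?A"
      using psubset_card_mono[OF less.prems sub] card_image[OF inj] by simp
    ultimately obtain w c' where w: "w \<in> carrier W" "\<forall>z. ev c1 (rho w z) = ev c' z" "\<forall>s\<in>S. 0 \<le> c' s"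
      using less.hyps by blast
    have "ev c (rho (s \<otimes> w) z) = ev c' z" for z
      using w sC c1 by (simp add: rho_mult)
    then show ?thesis using w sC by (intro bexI[of _ "s \<otimes> w"] exI[of _ c']) auto
  qed
qed

text \<open>If \<open>|bil x y| < 1\<close>, some functional
  \<open>height + a bil x + b bil y\<close> vanishes on \<open>x\<close> and \<open>y\<close>. It
  differs from \<open>height\<close> by a bounded amount on roots, so it is nonpositive on only
  finitely many positive roots. Moved into the chamber, its zeros are the roots supported on a
  subset \<open>I\<close> of \<open>S\<close>, a finite set; so every value other than
  \<open>1\<close> and \<open>-1\<close> already occurs inside one of finitely many finite sets of
  roots.\<close>

lemma finite_bil_values:
  assumes bound: "\<And>x y. x \<in> roots \<Longrightarrow> y \<in> roots \<Longrightarrow> \<bar>bil x y\<bar> \<le> 1"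
  shows "finite {bil x y | x y. x \<in> roots \<and> y \<in> roots}"
proof -
  define RI where "RI I = {z \<in> roots. \<forall>i\<in>S - I. z i = 0}" for I
  define V where "V = {1, -1} \<union> (\<Union>I\<in>{I \<in> Pow S. finite (RI I)}. (\<lambda>(x, y). bil x y) ` (RI I \<times> RI I))"
  have "finite V" unfolding V_def using finite_gens by (intro finite_UnI finite_UN_I) auto
  moreover have "bil x y \<in> V" if x: "x \<in> roots" and y: "y \<in> roots" for x y
  proof (cases "bil x y = 1 \<or> bil x y = - 1")
    case False
    define t where "t = bil x y"
    have t: "0 < 1 - t * t"
    proof -
      have "\<bar>t\<bar> < 1" using bound[OF x y] False by (auto simp: t_def)
      then have "t\<^sup>2 < 1" by (simp add: abs_square_less_1)
      then show ?thesis by (simp add: power2_eq_square)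
    qed
    \<comment> \<open>The solution of \<open>ev c x = ev c y = 0\<close>; \<open>t * t < 1\<close>
      makes the system regular.\<close>
    define a b where "a = (t * height y - height x) / (1 - t * t)"
      and "b = (t * height x - height y) / (1 - t * t)"
    have aD: "a * (1 - t * t) = t * height y - height x" and bD: "b * (1 - t * t) = t * height x - height y"
      using t by (simp_all add: a_def b_def)
    define c where "c s = 1 + a * bil x (unit_vec s) + b * bil y (unit_vec s)" for s
    have ev_c: "ev c z = height z + a * bil x z + b * bil y z" for z
      by (simp add: ev_def c_def height_def bil_expand_right[of _ z] sum.distrib sum_distrib_left algebra_simps)
    have zero: "ev c x = 0" "ev c y = 0"
    proof -
      have n: "bil x x = 1" "bil y y = 1" "bil y x = t" "bil x y = t"
        using x y by (simp_all add: root_norm t_def bil_sym[of y x])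
      have "ev c x * (1 - t * t) = height x * (1 - t * t) + a * (1 - t * t) + b * (1 - t * t) * t"
        unfolding ev_c n by (simp add: algebra_simps)
      also have "\<dots> = 0" unfolding aD bD by (simp add: algebra_simps)
      finally show "ev c x = 0" using t by simp
      have "ev c y * (1 - t * t) = height y * (1 - t * t) + a * (1 - t * t) * t + b * (1 - t * t)"
        unfolding ev_c n by (simp add: algebra_simps)
      also have "\<dots> = 0" unfolding aD bD by (simp add: algebra_simps)
      finally show "ev c y = 0" using t by simp
    qed
    have "{z \<in> posroots. ev c z \<le> 0} \<subseteq> {z \<in> posroots. height z \<le> \<bar>a\<bar> + \<bar>b\<bar>}"
    proof clarify
      fix z assume z: "z \<in> posroots" "ev c z \<le> 0"
      have "\<bar>a * bil x z\<bar> \<le> \<bar>a\<bar>" "\<bar>b * bil y z\<bar> \<le> \<bar>b\<bar>"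
        unfolding abs_mult using bound x y posroot_root[OF z(1)] by (simp_all add: mult_left_le)
      then show "height z \<le> \<bar>a\<bar> + \<bar>b\<bar>" using z(2) unfolding ev_c by linarith
    qed
    then have fin: "finite {z \<in> posroots. ev c z \<le> 0}"
      using finite_posroots_height_le finite_subset by blast
    then have "finite {z \<in> posroots. ev c z < 0}" by (rule rev_finite_subset) auto
    then obtain w c' where w: "w \<in> carrier W" "\<And>z. ev c (rho w z) = ev c' z" "\<And>s. s \<in> S \<Longrightarrow> 0 \<le> c' s"
      using move_to_chamber by blast
    define I where "I = {s \<in> S. c' s = 0}"
    have ev_uminus: "ev c (- z) = - ev c z" for c z by (simp add: ev_def sum_negf)
    \<comment> \<open>In the chamber the value at a positive root is a sum of nonnegative terms, so
      it vanishes only if the root is supported on \<open>I\<close>.\<close>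
    have I_zero: "z \<in> RI I" if z: "z \<in> roots" "ev c' z = 0" for z
    proof -
      have pos: "z i = 0" if z: "z \<in> posroots" "ev c' z = 0" and i: "i \<in> S - I" for z i
      proof -
        have "z i * c' i = 0"
          using z w(3) i posroot_nonneg[OF z(1)] sum_nonneg_eq_0_iff[OF finite_gens, of "\<lambda>s. z s * c' s"]
          by (auto simp: ev_def is_nonneg_def)
        then show ?thesis using i by (auto simp: I_def)
      qed
      show ?thesis
        using root_cases[OF z(1)] pos[of z] pos[of "- z"] z by (auto simp: RI_def ev_uminus)
    qed
    have "finite (RI I)"
    proof -
      have "{z \<in> roots. ev c z = 0} \<subseteq> {z \<in> posroots. ev c z \<le> 0} \<union> uminus ` {z \<in> posroots. ev c z \<le> 0}"
      proof
        fix z assume z: "z \<in> {z \<in> roots. ev c z = 0}"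
        then consider "z \<in> posroots" | "- z \<in> posroots" using root_cases by blast
        then show "z \<in> {z \<in> posroots. ev c z \<le> 0} \<union> uminus ` {z \<in> posroots. ev c z \<le> 0}"
        proof cases
          case 2
          have "z = - (- z)" by simp
          moreover have "- z \<in> {z \<in> posroots. ev c z \<le> 0}" using 2 z by (simp add: ev_uminus)
          ultimately show ?thesis by blast
        qed (use z in auto)
      qed
      then have f: "finite {z \<in> roots. ev c z = 0}" using fin by (simp add: finite_subset)
      have "RI I \<subseteq> rho (inv w) ` {z \<in> roots. ev c z = 0}"
      proof
        fix z assume z: "z \<in> RI I"
        have "ev c' z = 0" unfolding ev_def
          using z by (intro sum.neutral) (auto simp: RI_def I_def)
        then have "ev c (rho w z) = 0" using w by simp
        moreover have "rho w z \<in> roots" using z w rho_root by (auto simp: RI_def)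
        moreover have "z = rho (inv w) (rho w z)" using w by (simp only: rho_inv_left)
        ultimately show "z \<in> rho (inv w) ` {z \<in> roots. ev c z = 0}" by blast
      qed
      then show ?thesis using f finite_surj by blast
    qed
    moreover have "rho (inv w) x \<in> RI I" "rho (inv w) y \<in> RI I"
      using w x y zero rho_root by (auto intro!: I_zero simp: w(2)[symmetric])
    moreover have "bil x y = bil (rho (inv w) x) (rho (inv w) y)" using w by (simp add: bil_rho)
    moreover have "I \<in> Pow S" by (auto simp: I_def)
    ultimately have "bil x y \<in> (\<lambda>(x, y). bil x y) ` (RI I \<times> RI I)" "I \<in> {I \<in> Pow S. finite (RI I)}"
      by (auto intro!: image_eqI[of _ _ "(rho (inv w) x, rho (inv w) y)"])
    then show ?thesis unfolding V_def by blast
  qed (auto simp: V_def)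
  ultimately show ?thesis by (elim rev_finite_subset) blast
qed

section \<open>The radical and the group of translations\<close>

definition radical :: "('a \<Rightarrow> real) set"
  where "radical = {z. \<forall>t\<in>S. bil z (unit_vec t) = 0}"

lemma radical_bil: "z \<in> radical \<Longrightarrow> bil z v = 0"
  unfolding bil_expand_right[of z v] by (simp add: radical_def)

lemma rho_radical:
  assumes z: "z \<in> radical" and w: "w \<in> carrier W" shows "rho w z = z"
  using w
proof (induction w rule: rho_induct)
  case (step s w)
  have "reflect (unit_vec s) z = z" using z step by (simp add: reflect_def radical_bil fun_eq_iff)
  then show ?case using step by (simp only: rho_mult gens_closed rho_gen)
qed simp

definition transl_group :: "'a set"
  where "transl_group = {w \<in> carrier W. \<forall>s\<in>S. rho w (unit_vec s) - unit_vec s \<in> radical}"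

text \<open>The matrix of \<open>w - 1\<close>, flattened to a vector indexed by pairs, so that
  translations become points of one real vector space.\<close>

definition disp :: "'a \<Rightarrow> 'a \<times> 'a \<Rightarrow> real"
  where "disp w = (\<lambda>(s, t). if s \<in> S then (rho w (unit_vec s) - unit_vec s) t else 0)"

lemma transl_groupD:
  assumes "w \<in> transl_group"
  shows "w \<in> carrier W" "s \<in> S \<Longrightarrow> rho w (unit_vec s) - unit_vec s \<in> radical"
  using assms by (auto simp: transl_group_def)

lemma radical_add: "y \<in> radical \<Longrightarrow> z \<in> radical \<Longrightarrow> y + z \<in> radical"
  and radical_uminus: "y \<in> radical \<Longrightarrow> - y \<in> radical"
  by (simp_all add: radical_def bil_simps)

lemma translation_mult:
  assumes v: "v \<in> transl_group" and w: "w \<in> transl_group"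
  shows "v \<otimes> w \<in> transl_group" "disp (v \<otimes> w) = disp v + disp w"
proof -
  have vw: "v \<in> carrier W" "w \<in> carrier W" using v w transl_groupD by auto
  have e: "rho (v \<otimes> w) (unit_vec s) - unit_vec s
      = (rho v (unit_vec s) - unit_vec s) + (rho w (unit_vec s) - unit_vec s)" if s: "s \<in> S" for s
  proof -
    let ?r = "rho w (unit_vec s) - unit_vec s"
    have "rho v ?r = ?r" using rho_radical transl_groupD(2)[OF w s] vw by blast
    then have "rho v (rho w (unit_vec s)) = rho v (unit_vec s) + ?r"
      using rho_diff[OF vw(1), of "rho w (unit_vec s)" "unit_vec s"] by (simp add: algebra_simps)
    then show ?thesis using vw by (simp add: rho_mult)
  qed
  have "rho (v \<otimes> w) (unit_vec s) - unit_vec s \<in> radical" if s: "s \<in> S" for s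
    unfolding e[OF s] by (intro radical_add transl_groupD(2) v w s)
  then show "v \<otimes> w \<in> transl_group"
    unfolding transl_group_def using m_closed[OF vw] by blast
  show "disp (v \<otimes> w) = disp v + disp w" using e by (auto simp: disp_def fun_eq_iff)
qed

lemma disp_one: "disp \<one> = 0"
  by (auto simp: disp_def fun_eq_iff)

lemma translation_inv:
  assumes w: "w \<in> transl_group"
  shows "inv w \<in> transl_group" "disp (inv w) = - disp w"
proof -
  have wc: "w \<in> carrier W" using w transl_groupD by auto
  have e: "rho (inv w) (unit_vec s) - unit_vec s = - (rho w (unit_vec s) - unit_vec s)" if s: "s \<in> S" for s
  proof -
    let ?r = "rho w (unit_vec s) - unit_vec s"
    have "rho (inv w) ?r = ?r" using rho_radical transl_groupD(2)[OF w s] wc by blast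
    moreover have "rho (inv w) ?r = unit_vec s - rho (inv w) (unit_vec s)"
      using wc by (simp add: rho_diff)
    ultimately have "unit_vec s - rho (inv w) (unit_vec s) = ?r" by metis
    then show ?thesis by (metis minus_diff_eq)
  qed
  have "rho (inv w) (unit_vec s) - unit_vec s \<in> radical" if s: "s \<in> S" for s
    unfolding e[OF s] by (intro radical_uminus transl_groupD(2) w s)
  then show "inv w \<in> transl_group"
    unfolding transl_group_def using inv_closed[OF wc] by blast
  show "disp (inv w) = - disp w" using e by (auto simp: disp_def fun_eq_iff)
qed

lemma transl_group_subgroup: "subgroup transl_group W"
proof (rule subgroupI)
  show "transl_group \<noteq> {}"
    by (auto simp: transl_group_def radical_def bil_simps intro!: exI[of _ "\<one>"])
qed (auto simp: translation_mult translation_inv dest: transl_groupD(1))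

lemma disp_inj:
  assumes v: "v \<in> transl_group" and w: "w \<in> transl_group" and eq: "disp v = disp w"
  shows "v = w"
proof (rule eq_if_rho_unit_eq)
  fix s assume s: "s \<in> S"
  have "disp v (s, t) = disp w (s, t)" for t using eq by simp
  then show "rho v (unit_vec s) = rho w (unit_vec s)" using s by (simp add: disp_def fun_eq_iff)
qed (use v w transl_groupD in auto)

lemma disp_outside:
  assumes w: "w \<in> transl_group" and p: "p \<notin> S \<times> S" shows "disp w p = 0"
proof (cases p)
  case (Pair s t)
  then show ?thesis using p rho_outside[OF transl_groupD(1)[OF w], of t "unit_vec s"]
    by (auto simp: disp_def)
qed

text \<open>A bounded displacement bounds the heights of the images of the simple roots, and these
  images determine the element.\<close>

lemma finite_bounded_translations: "finite {w \<in> transl_group. \<forall>p. \<bar>disp w p\<bar> \<le> C p}"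
proof -
  define F where "F = {w \<in> transl_group. \<forall>p. \<bar>disp w p\<bar> \<le> C p}"
  define R where "R s = {z \<in> roots. \<bar>height z\<bar> \<le> (\<Sum>t\<in>S. C (s, t)) + 1}" for s
  define f where "f w = (\<lambda>s\<in>S. rho w (unit_vec s))" for w
  have "f ` F \<subseteq> PiE S R"
  proof (clarify, rule PiE_I)
    fix w s assume w: "w \<in> F" and s: "s \<in> S"
    have wt: "w \<in> transl_group" using w by (simp add: F_def)
    have "\<bar>height (rho w (unit_vec s)) - 1\<bar> = \<bar>\<Sum>t\<in>S. disp w (s, t)\<bar>"
      using s height_unit[OF s] by (simp add: disp_def height_def sum_subtractf)
    also have "\<dots> \<le> (\<Sum>t\<in>S. C (s, t))"
      using w by (intro order_trans[OF sum_abs] sum_mono) (simp add: F_def)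
    finally have "\<bar>height (rho w (unit_vec s))\<bar> \<le> (\<Sum>t\<in>S. C (s, t)) + 1" by linarith
    then show "f w s \<in> R s"
      using s transl_groupD(1)[OF wt] by (simp add: f_def R_def rho_root posroot_root unit_root)
  qed (simp add: f_def)
  moreover have "finite (PiE S R)"
    unfolding R_def by (intro finite_PiE finite_gens finite_roots_height_le)
  ultimately have "finite (f ` F)" by (rule finite_subset)
  moreover have "inj_on f F"
  proof (rule inj_onI)
    fix v w assume vw: "v \<in> F" "w \<in> F" "f v = f w"
    have "rho v (unit_vec s) = rho w (unit_vec s)" if "s \<in> S" for s
      using fun_cong[OF vw(3), of s] that by (simp add: f_def)
    moreover have "v \<in> carrier W" "w \<in> carrier W" using vw transl_groupD(1) by (auto simp: F_def)
    ultimately show "v = w" using eq_if_rho_unit_eq by blast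
  qed
  ultimately show ?thesis unfolding F_def[symmetric] by (rule finite_imageD)
qed

text \<open>Modulo the radical an element is determined by the form values between images of simple
  roots and simple roots, and \<open>finite_bil_values\<close> leaves finitely many such
  matrices.\<close>

lemma finite_index_translations:
  assumes bound: "\<And>x y. x \<in> roots \<Longrightarrow> y \<in> roots \<Longrightarrow> \<bar>bil x y\<bar> \<le> 1"
  shows "finite (rcosets transl_group)"
proof (rule finite_rcosets_if_finite_image[OF transl_group_subgroup])
  define V where "V = {bil x y | x y. x \<in> roots \<and> y \<in> roots}"
  \<comment> \<open>The inverse is taken so that equal matrices yield
    \<open>v \<otimes> inv w\<close>, as right cosets demand.\<close>
  define f where "f w = (\<lambda>s\<in>S. \<lambda>t\<in>S. bil (rho (inv w) (unit_vec s)) (unit_vec t))" for w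
  have V: "finite V" unfolding V_def by (rule finite_bil_values[OF bound])
  have "f ` carrier W \<subseteq> (S \<rightarrow>\<^sub>E (S \<rightarrow>\<^sub>E V))"
    using rho_root unit_root posroot_root by (fastforce simp: f_def V_def)
  moreover have "finite (S \<rightarrow>\<^sub>E (S \<rightarrow>\<^sub>E V))" using finite_gens V by (intro finite_PiE) auto
  ultimately show "finite (f ` carrier W)" by (rule finite_subset)
  fix v w assume vw: "v \<in> carrier W" "w \<in> carrier W" "f v = f w"
  have eq: "bil (rho (inv v) (unit_vec s)) (unit_vec t) = bil (rho (inv w) (unit_vec s)) (unit_vec t)"
    if "s \<in> S" "t \<in> S" for s t
    using fun_cong[OF fun_cong[OF vw(3), of s], of t] that by (simp add: f_def)
  have "rho (v \<otimes> inv w) (unit_vec s) - unit_vec s \<in> radical" if s: "s \<in> S" for s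
  proof -
    let ?d = "rho (inv w) (unit_vec s) - rho (inv v) (unit_vec s)"
    have d: "?d \<in> radical" using eq[OF s] by (simp add: radical_def bil_simps)
    have "rho v ?d = rho (v \<otimes> inv w) (unit_vec s) - unit_vec s"
      using vw by (simp add: rho_diff rho_mult)
    then show ?thesis using rho_radical[OF d vw(1)] d by simp
  qed
  then show "v \<otimes> inv w \<in> transl_group" using vw by (simp add: transl_group_def)
qed

lemma disp_int_scl:
  assumes w: "w \<in> transl_group"
  shows "\<exists>v\<in>transl_group. disp v = real_of_int n *\<^sub>v disp w"
proof -
  have nat: "\<exists>v\<in>transl_group. disp v = real k *\<^sub>v disp w" for k
  proof (induction k)
    case 0
    show ?case
      using disp_one subgroup.one_closed[OF transl_group_subgroup]
      by (intro bexI[of _ "\<one>"]) (auto simp: fun_eq_iff)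
  next
    case (Suc k)
    then obtain v where v: "v \<in> transl_group" "disp v = real k *\<^sub>v disp w" by blast
    have "disp (w \<otimes> v) = real (Suc k) *\<^sub>v disp w"
      unfolding translation_mult(2)[OF w v(1)] v(2) by (simp add: fun_eq_iff algebra_simps)
    then show ?case using translation_mult(1)[OF w v(1)] by blast
  qed
  show ?thesis
  proof (cases "0 \<le> n")
    case True
    then show ?thesis using nat[of "nat n"] by simp
  next
    case False
    then obtain v where v: "v \<in> transl_group" "disp v = real (nat (- n)) *\<^sub>v disp w"
      using nat by blast
    have "disp (inv v) = real_of_int n *\<^sub>v disp w"
      unfolding translation_inv(2)[OF v(1)] v(2) using False by (simp add: fun_eq_iff)
    then show ?thesis using translation_inv(1)[OF v(1)] by blast
  qed
qed

text \<open>The displacements form a discrete group \<open>L\<close> in a finite-dimensional space.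
  A maximal independent subset of \<open>L\<close> need not be a lattice basis, but its integer
  combinations have finite index: rounding down real coordinates leaves a bounded remainder, and
  only finitely many translations are that small.\<close>

lemma affine_if_bounded_roots:
  assumes inf: "infinite (carrier W)"
    and bound: "\<And>x y. x \<in> roots \<Longrightarrow> y \<in> roots \<Longrightarrow> \<bar>bil x y\<bar> \<le> 1"
  shows "affine_group W"
proof -
  interpret vs: vector_space "scl :: real \<Rightarrow> ('a \<times> 'a \<Rightarrow> real) \<Rightarrow> _"
    by (rule vector_space_scl)
  note fin_idx = finite_index_translations[OF bound]
  define L where "L = disp ` transl_group"
  obtain Bs where Bs: "Bs \<subseteq> L" "vs.independent Bs" "L \<subseteq> vs.span Bs"
    using vs.maximal_independent_subset by blast
  \<comment> \<open>Displacements vanish off \<open>S \<times> S\<close>, so independent sets of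
    them are finite.\<close>
  have L_span: "v \<in> vs.span (unit_vec ` (S \<times> S))" if v: "v \<in> L" for v
  proof -
    have "v = (\<Sum>p\<in>S \<times> S. v p *\<^sub>v unit_vec p)"
    proof
      fix q
      have *: "(\<Sum>p\<in>A. v p *\<^sub>v unit_vec p) q = (\<Sum>p\<in>A. v p * unit_vec p q)"
        if "finite A" for A :: "('a \<times> 'a) set"
        using that by induction simp_all
      have out: "v q = 0" if "q \<notin> S \<times> S" using v disp_outside[OF _ that] unfolding L_def by blast
      have "(\<Sum>p\<in>S \<times> S. v p * unit_vec p q) = (\<Sum>p\<in>S \<times> S. if p = q then v p else 0)"
        by (rule sum.cong) (simp_all add: unit_vec_def)
      also have "\<dots> = v q" using out finite_gens by (simp add: sum.delta del: mem_Sigma_iff)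
      finally have "(\<Sum>p\<in>S \<times> S. v p * unit_vec p q) = v q" .
      then show "v q = (\<Sum>p\<in>S \<times> S. v p *\<^sub>v unit_vec p) q"
        using *[of "S \<times> S"] finite_gens by simp
    qed
    also have "\<dots> \<in> vs.span (unit_vec ` (S \<times> S))"
      by (intro vs.span_sum vs.span_scale vs.span_base) auto
    finally show ?thesis .
  qed
  have finB: "finite Bs"
    using vs.independent_span_bound[of "unit_vec ` (S \<times> S)" Bs] Bs L_span finite_gens by auto
  define d where "d = card Bs"
  obtain idx where idx: "bij_betw idx Bs {..<d}"
    using ex_bij_betw_finite_nat[OF finB] by (auto simp: d_def atLeast0LessThan)
  let ?P = "product_group {..<d} (\<lambda>_. integer_group)"
  define comb where "comb f = (\<Sum>v\<in>Bs. real_of_int (f (idx v)) *\<^sub>v v)" for f :: "nat \<Rightarrow> int"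
  have comb_L: "comb f \<in> L" for f
  proof -
    have zero: "0 \<in> L"
      using disp_one subgroup.one_closed[OF transl_group_subgroup] by (metis L_def image_eqI)
    have add: "u + v \<in> L" if "u \<in> L" "v \<in> L" for u v
      using that translation_mult by (auto simp: L_def) (metis image_eqI)
    have scale: "real_of_int n *\<^sub>v v \<in> L" if "v \<in> L" for n v
      using that disp_int_scl by (auto simp: L_def) (metis image_eqI)
    have "(\<Sum>v\<in>A. real_of_int (f (idx v)) *\<^sub>v v) \<in> L" if "A \<subseteq> Bs" for A
      using finite_subset[OF that finB] that
      by induction (use zero add scale Bs(1) in auto)
    then show ?thesis by (simp add: comb_def)
  qed
  define h where "h f = inv_into transl_group disp (comb f)" for f
  have h: "h f \<in> transl_group" "disp (h f) = comb f" for f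
    using comb_L[of f] by (auto simp: h_def L_def inv_into_into f_inv_into_f)
  have comb_mult: "comb (f \<otimes>\<^bsub>?P\<^esub> f') = comb f + comb f'" for f f'
    unfolding comb_def sum.distrib[symmetric]
  proof (rule sum.cong[OF HOL.refl])
    fix v assume "v \<in> Bs"
    then have "idx v < d" using idx by (auto simp: bij_betw_def)
    then show "real_of_int ((f \<otimes>\<^bsub>?P\<^esub> f') (idx v)) *\<^sub>v v
        = real_of_int (f (idx v)) *\<^sub>v v + real_of_int (f' (idx v)) *\<^sub>v v"
      by (simp add: fun_eq_iff algebra_simps)
  qed
  have hom: "h \<in> hom ?P W"
  proof (rule homI)
    fix f f' assume "f \<in> carrier ?P" "f' \<in> carrier ?P"
    show "h (f \<otimes>\<^bsub>?P\<^esub> f') = h f \<otimes> h f'"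
    proof (rule disp_inj)
      show "disp (h (f \<otimes>\<^bsub>?P\<^esub> f')) = disp (h f \<otimes> h f')"
        by (simp only: h comb_mult translation_mult(2))
    qed (use h translation_mult in auto)
  qed (use h transl_groupD(1) in blast)
  have inj: "inj_on h (carrier ?P)"
  proof (rule inj_onI)
    fix f f' assume f: "f \<in> carrier ?P" "f' \<in> carrier ?P" "h f = h f'"
    have "comb f = comb f'" using f(3) h(2) by metis
    then have "comb f - comb f' = 0" by simp
    also have "comb f - comb f' = (\<Sum>v\<in>Bs. (real_of_int (f (idx v)) - real_of_int (f' (idx v))) *\<^sub>v v)"
      unfolding comb_def sum_subtractf[symmetric]
      by (rule sum.cong[OF HOL.refl]) (simp add: fun_eq_iff algebra_simps)
    finally have eq: "real_of_int (f (idx v)) - real_of_int (f' (idx v)) = 0" if "v \<in> Bs" for v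
      using vs.independentD[OF Bs(2) finB subset_refl,
        of "\<lambda>v. real_of_int (f (idx v)) - real_of_int (f' (idx v))"] that by blast
    have "f i = f' i" if "i < d" for i
    proof -
      have "i \<in> idx ` Bs" using idx that by (simp add: bij_betw_imp_surj_on)
      then obtain v where "v \<in> Bs" "idx v = i" by blast
      then show ?thesis using eq by force
    qed
    then show "f = f'" using f(1,2) by (intro PiE_ext[of f "{..<d}" _ f']) auto
  qed
  have K: "subgroup (h ` carrier ?P) W" by (rule image_iso(1)[OF _ hom inj]) simp
  define F where "F = {w \<in> transl_group. \<forall>p. \<bar>disp w p\<bar> \<le> (\<Sum>v\<in>Bs. \<bar>v p\<bar>)}"
  have finF: "finite F" unfolding F_def by (rule finite_bounded_translations)
  have fin: "finite (rcosets (h ` carrier ?P))"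
  proof (rule finite_rcosets_trans[OF K transl_group_subgroup fin_idx finF])
    show "F \<subseteq> carrier W" using transl_groupD(1) by (auto simp: F_def)
    fix w assume w: "w \<in> transl_group"
    have "disp w \<in> vs.span Bs" using w Bs(3) by (auto simp: L_def)
    then obtain r where r: "disp w = (\<Sum>v\<in>Bs. r v *\<^sub>v v)"
      unfolding vs.span_finite[OF finB] by blast
    define f where "f = (\<lambda>i\<in>{..<d}. floor (r (inv_into Bs idx i)))"
    have f: "f \<in> carrier ?P" by (simp add: f_def)
    have fv: "f (idx v) = floor (r v)" if "v \<in> Bs" for v
      using that idx by (auto simp: f_def bij_betw_def inv_into_f_f)
    let ?w = "inv (h f) \<otimes> w"
    have wt: "?w \<in> transl_group" by (intro translation_mult(1) translation_inv(1) h(1) w)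
    have sum_apply: "(\<Sum>v\<in>A. g v) p = (\<Sum>v\<in>A. g v p)" if "finite A"
      for A and g :: "('a \<times> 'a \<Rightarrow> real) \<Rightarrow> 'a \<times> 'a \<Rightarrow> real" and p
      using that by induction simp_all
    have "\<bar>disp ?w p\<bar> \<le> (\<Sum>v\<in>Bs. \<bar>v p\<bar>)" for p
    proof -
      have "disp ?w = - comb f + disp w"
        using translation_mult(2)[OF translation_inv(1)[OF h(1)] w] translation_inv(2)[OF h(1)] h(2) by simp
      then have "disp ?w p = (\<Sum>v\<in>Bs. r v * v p) - (\<Sum>v\<in>Bs. real_of_int (f (idx v)) * v p)"
        by (simp add: r comb_def sum_apply[OF finB])
      also have "\<dots> = (\<Sum>v\<in>Bs. (r v - real_of_int (floor (r v))) * v p)"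
        by (simp add: fv sum_subtractf[symmetric] left_diff_distrib)
      also have "\<bar>\<dots>\<bar> \<le> (\<Sum>v\<in>Bs. \<bar>v p\<bar>)"
      proof (rule order_trans[OF sum_abs], rule sum_mono)
        fix v assume "v \<in> Bs"
        have "\<bar>r v - real_of_int (floor (r v))\<bar> \<le> 1" by linarith
        then show "\<bar>(r v - real_of_int (floor (r v))) * v p\<bar> \<le> \<bar>v p\<bar>"
          unfolding abs_mult by (rule mult_left_le_one_le[OF abs_ge_zero abs_ge_zero])
      qed
      finally show ?thesis .
    qed
    then have "?w \<in> F" using wt by (simp add: F_def)
    moreover have "w = h f \<otimes> ?w"
      using h w transl_groupD(1) by (simp add: m_assoc[symmetric])
    ultimately show "\<exists>u\<in>F. \<exists>k\<in>h ` carrier ?P. w = k \<otimes> u" using f by blast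
  qed
  \<comment> \<open>For \<open>d = 0\<close> all displacements vanish, so the translation group is
    trivial and its finite index makes \<open>W\<close> finite.\<close>
  have "1 \<le> d"
  proof (rule ccontr)
    assume "\<not> 1 \<le> d"
    then have "Bs = {}" using finB card_gt_0_iff[of Bs] by (auto simp: d_def Suc_le_eq)
    then have "L \<subseteq> {0}" using Bs(3) by simp
    then have "transl_group \<subseteq> {\<one>}"
      using disp_inj disp_one subgroup.one_closed[OF transl_group_subgroup] by (auto simp: L_def)
    moreover obtain R where R: "finite R" "\<And>w. w \<in> carrier W \<Longrightarrow> \<exists>r\<in>R. \<exists>h\<in>transl_group. w = h \<otimes> r"
      "R \<subseteq> carrier W" using finite_rcosetsE[OF fin_idx transl_group_subgroup] by metis
    ultimately have "carrier W \<subseteq> R" by fastforce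
    then show False using R(1) inf finite_subset by blast
  qed
  then show ?thesis using affine_groupI[OF inf _ hom inj fin] by simp
qed

end

subsection \<open>Commuting subgroups with product of finite index\<close>

context irred_coxeter
begin

lemma hyperbolic_axis_exists:
  assumes "infinite (carrier W)" "\<not> affine_group W"
  shows "\<exists>x y c. hyperbolic_axis W S x y c"
proof -
  have "\<exists>x\<in>posroots. \<exists>y\<in>posroots. bil x y < - 1"
  proof (rule ccontr)
    assume "\<not> ?thesis"
    then have "- 1 \<le> bil x y" if "x \<in> posroots" "y \<in> posroots" for x y
      using that by (meson not_less)
    then have "\<bar>bil x y\<bar> \<le> 1" if "x \<in> roots" "y \<in> roots" for x y
      using abs_bil_root_le that by blast
    then show False using affine_if_bounded_roots assms by blast
  qed
  then obtain x y v where g: "good_pair x y v" and v: "\<forall>s\<in>S. 0 < v s"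
    using good_pair_exists good_pair_full_support by meson
  obtain a b c where c: "bil x y = - c" "1 < c" "x \<in> posroots" "y \<in> posroots"
    using good_pairD[OF g] by metis
  have "finite {w \<in> carrier W. rho w x = x \<and> rho w y = y}"
    using finite_common_stabiliser[OF g] v by blast
  then have "hyperbolic_axis W S x y c"
    using c posroot_root by unfold_locales
  then show ?thesis by blast
qed

lemma no_commuting_subgroups:
  assumes inf: "infinite (carrier W)" and naff: "\<not> affine_group W"
    and P: "subgroup P W" "infinite P" and Q: "subgroup Q W" "infinite Q"
    and comm: "\<And>p q. p \<in> P \<Longrightarrow> q \<in> Q \<Longrightarrow> p \<otimes> q = q \<otimes> p"
    and H: "subgroup H W" "finite (rcosets H)"
    and prod: "\<And>h. h \<in> H \<Longrightarrow> \<exists>p\<in>P. \<exists>q\<in>Q. h = p \<otimes> q"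
  shows False
proof -
  obtain x y c where "hyperbolic_axis W S x y c"
    using hyperbolic_axis_exists[OF inf naff] by blast
  then interpret ax: hyperbolic_axis W S x y c .
  obtain n :: nat where n: "0 < n" "ax.g [^] n \<in> H"
    using pow_in_finite_index[OF H ax.g_closed] by blast
  obtain p q where pq: "p \<in> P" "q \<in> Q" "ax.g [^] n = p \<otimes> q" using prod[OF n(2)] by blast
  have pc: "p \<in> carrier W" "q \<in> carrier W"
    using pq subgroup.mem_carrier[OF P(1)] subgroup.mem_carrier[OF Q(1)] by auto
  \<comment> \<open>Both factors commute with \<open>p \<otimes> q\<close>, a positive power of
    \<open>g\<close>, so \<open>centraliser_subset\<close> applies to each.\<close>
  have "p \<otimes> (p \<otimes> q) = (p \<otimes> q) \<otimes> p" "q \<otimes> (p \<otimes> q) = (p \<otimes> q) \<otimes> q"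
    using comm[OF pq(1,2)] pc by (metis m_assoc)+
  then have E: "p \<in> ax.axis_stab" "q \<in> ax.axis_stab"
    using ax.centraliser_subset[OF n(1)] pc pq(3) by simp_all
  have "ax.chi p * ax.chi q = ax.chi ax.g ^ n"
    using ax.axis_stab_mult(2)[OF E] ax.axis_stab_pow[OF ax.g_axis_stab(1), of n] pq(3) by simp
  moreover have "1 < ax.chi ax.g ^ n" using ax.chi_g_gt_1 n(1) by (simp add: one_less_power)
  \<comment> \<open>At least one of the two absolute values exceeds \<open>1\<close>; the subgroup
    containing that element starts the argument.\<close>
  ultimately have gt: "1 < \<bar>ax.chi p\<bar> * \<bar>ax.chi q\<bar>" by (simp add: abs_mult[symmetric])
  have "P \<subseteq> ax.axis_stab \<and> Q \<subseteq> ax.axis_stab"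
  proof (cases "1 < \<bar>ax.chi p\<bar>")
    case True
    then show ?thesis
      using ax.commuting_in_axis_stab[OF P(1) Q comm pq(1) E(1)] by blast
  next
    case False
    then have "\<bar>ax.chi p\<bar> * \<bar>ax.chi q\<bar> \<le> 1 * \<bar>ax.chi q\<bar>" by (intro mult_right_mono) auto
    then have "1 < \<bar>ax.chi q\<bar>" using gt by linarith
    then show ?thesis
      using ax.commuting_in_axis_stab[OF Q(1) P comm[symmetric] pq(2) E(2)] by blast
  qed
  \<comment> \<open>The stabiliser now contains a subgroup of finite index, hence has finite index
    itself.\<close>
  then have HE: "H \<subseteq> ax.axis_stab"
    using prod ax.axis_stab_mult(1) by blast
  obtain R where "finite R" "R \<subseteq> carrier W" "\<And>w. w \<in> carrier W \<Longrightarrow> \<exists>r\<in>R. \<exists>h\<in>H. w = h \<otimes> r"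
    using finite_rcosetsE[OF H(2,1)] by blast
  then have "finite (rcosets ax.axis_stab)"
    using HE by (intro finite_rcosetsI[OF ax.axis_stab_subgroup]) blast+
  then show False using ax.affine_if_axis_stab_finite_index inf naff by blast
qed

end

theorem theorem6p9:
  fixes W :: "('a, 'm) monoid_scheme" and S :: "'a set"
  assumes "irreducible_coxeter_system W S"
    and "finite S"
    and "infinite (carrier W)"
    and "\<not> affine_group W"
  shows "\<not> presentable_by_product TYPE('b) TYPE('c) W"
proof
  assume "presentable_by_product TYPE('b) TYPE('c) W"
  then obtain G1 :: "'b monoid" and G2 :: "'c monoid" and \<phi> where
    G: "group G1" "group G2" and \<phi>: "\<phi> \<in> hom (G1 \<times>\<times> G2) W"
    and inf: "infinite (\<phi> ` (carrier G1 \<times> {\<one>\<^bsub>G2\<^esub>}))" "infinite (\<phi> ` ({\<one>\<^bsub>G1\<^esub>} \<times> carrier G2))"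
    and fin: "finite_index_subgroup (\<phi> ` carrier (G1 \<times>\<times> G2)) W"
    by (auto simp: presentable_by_product_def)
  interpret irred_coxeter W S
    using assms(1,2) by unfold_locales (auto simp: irreducible_coxeter_system_def)
  interpret G1: group G1 by (rule G)
  interpret G2: group G2 by (rule G)
  \<comment> \<open>Elements of the two factors commute inside the direct product, so their images
    give the commuting subgroups.\<close>
  let ?p = "\<lambda>a. \<phi> (a, \<one>\<^bsub>G2\<^esub>)" and ?q = "\<lambda>b. \<phi> (\<one>\<^bsub>G1\<^esub>, b)"
  have mult: "\<phi> (a, b) \<otimes>\<^bsub>W\<^esub> \<phi> (a', b') = \<phi> (a \<otimes>\<^bsub>G1\<^esub> a', b \<otimes>\<^bsub>G2\<^esub> b')"
    if "a \<in> carrier G1" "b \<in> carrier G2" "a' \<in> carrier G1" "b' \<in> carrier G2" for a b a' b'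
    using hom_mult[OF \<phi>, of "(a, b)" "(a', b')"] that by simp
  have closed: "\<phi> (a, b) \<in> carrier W" if "a \<in> carrier G1" "b \<in> carrier G2" for a b
    using hom_in_carrier[OF \<phi>, of "(a, b)"] that by simp
  have "?p \<in> hom G1 W" "?q \<in> hom G2 W" by (auto simp: hom_def mult closed)
  then have sub: "subgroup (?p ` carrier G1) W" "subgroup (?q ` carrier G2) W"
    using G is_group by (auto intro!: group_hom.img_is_subgroup simp: group_hom_def group_hom_axioms_def)
  have img: "\<phi> ` (carrier G1 \<times> {\<one>\<^bsub>G2\<^esub>}) = ?p ` carrier G1"
    "\<phi> ` ({\<one>\<^bsub>G1\<^esub>} \<times> carrier G2) = ?q ` carrier G2" by auto
  show False
  proof (rule no_commuting_subgroups[OF assms(3,4) sub(1) _ sub(2)])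
    show "infinite (?p ` carrier G1)" "infinite (?q ` carrier G2)" using inf unfolding img by blast+
    show "subgroup (\<phi> ` carrier (G1 \<times>\<times> G2)) W" "finite (rcosets\<^bsub>W\<^esub> (\<phi> ` carrier (G1 \<times>\<times> G2)))"
      using fin by (simp_all add: finite_index_subgroup_def)
    show "x \<otimes>\<^bsub>W\<^esub> y = y \<otimes>\<^bsub>W\<^esub> x" if "x \<in> ?p ` carrier G1" "y \<in> ?q ` carrier G2" for x y
      using that by (auto simp: mult)
    show "\<exists>x\<in>?p ` carrier G1. \<exists>y\<in>?q ` carrier G2. h = x \<otimes>\<^bsub>W\<^esub> y"
      if h: "h \<in> \<phi> ` carrier (G1 \<times>\<times> G2)" for h
    proof -
      obtain a b where ab: "a \<in> carrier G1" "b \<in> carrier G2" "h = \<phi> (a, b)"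
        using h by auto
      then have "h = ?p a \<otimes>\<^bsub>W\<^esub> ?q b" by (simp add: mult)
      then show ?thesis using ab by blast
    qed
  qed
qed

end
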